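(* Let $1\le p_1,p_2,q_1,q_2\le\infty$; let $s,b\in\mathbb N$ and $N:=sb$. Consider the following three conditions on the tuple $(p_1,p_2,q_1,q_2)$: (i) $q_1\le\max\{p_1,2\}$; (ii) $q_2\le\max\{p_2,2\}$; (iii) the tuple does not fall into the "exceptional case", i.e. it is not true that both $q_1<\min\{p_1,q_2\}$ and $p_2<q_2\le 2$ hold. A) Assume that $(p_1,p_2,q_1,q_2)$ satisfies (i), (ii) and (iii). Then for any $\varepsilon>0$ we have $$d_n(B_{p_1,p_2}^{s,b},\ell_{q_1,q_2}^{s,b})\ge c(q_2,\varepsilon)\,d_0(B_{p_1,p_2}^{s,b},\ell_{q_1,q_2}^{s,b}),\quad\mbox{if } n\le N(1-\varepsilon),$$ where $c(q_2,\varepsilon)>0$ depends only on $q_2$ and $\varepsilon$ (in particular, not on $s,b,n$). B) For any tuple $(p_1,p_2,q_1,q_2)\in[1,\infty]^4$ that fails at least one of the conditions (i), (ii), (iii), there exists $\gamma>0$ (depending on the tuple) such that for all $s,b$ with $t:=\min(s,b)$ sufficiently large (depending on the tuple) we have $$d_n(B_{p_1,p_2}^{s,b},\ell_{q_1,q_2}^{s,b})\le t^{-\gamma}\,d_0(B_{p_1,p_2}^{s,b},\ell_{q_1,q_2}^{s,b}),\quad\mbox{when } n\ge Nt^{-\gamma}.$$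
   Context: For a set $K$ in a normed space $X$ and an integer $n\ge 0$, the Kolmogorov width is $$d_n(K,X):=\inf_{Q_n\subset X}\sup_{x\in K}\inf_{y\in Q_n}\|x-y\|_X,$$ where $\inf_{Q_n}$ is over all linear subspaces of $X$ of dimension at most $n$. In particular $d_0(K,X)=\sup_{x\in K}\|x\|_X$. For $1\le q\le\infty$, $\|x\|_q:=(\sum_k|x_k|^q)^{1/q}$ (with the usual modification $\max_k |x_k|$ for $q=\infty$). Mixed norms: let $s,b\in\mathbb N$, $N=sb$, and divide the coordinates of $\mathbb R^N$ into $b$ blocks of size $s$; let $x[j]\in\mathbb R^s$ denote the $j$-th block of $x\in\mathbb R^N$, $j=1,\ldots,b$. For $1\le q_1,q_2\le\infty$ set $$\|x\|_{q_1,q_2}:=\|y\|_{q_2},\quad y:=(\|x[1]\|_{q_1},\ldots,\|x[b]\|_{q_1})\in\mathbb R^b .$$ The space $\mathbb R^N$ with this norm is denoted $\ell_{q_1,q_2}^{s,b}$ and its unit ball is $B_{q_1,q_2}^{s,b}=\{x\in\mathbb R^N:\|x\|_{q_1,q_2}\le 1\}$. *)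

theory Defs
  imports "HOL-Analysis.Analysis" "HOL-Analysis.Finite_Function_Topology"
begin

text \<open>
  The dimension \<open>N = s * b\<close> varies inside the statement, so \<open>\<real>\<^sup>N\<close> is not a type here:
  it is the subspace of the finitely supported sequences \<open>nat \<Rightarrow>\<^sub>0 real\<close> whose support
  is contained in \<open>{..<N}\<close>.
\<close>

definition coord_space :: "nat \<Rightarrow> (nat \<Rightarrow>\<^sub>0 real) set" where
  "coord_space N = {x. Poly_Mapping.keys x \<subseteq> {..<N}}"

text \<open>
  A normed space is given by a subspace \<open>X\<close> of a real vector space together with a norm
  \<open>\<nu>\<close> on it, which need not be the norm that the type class may provide.
  Since \<^const>\<open>dim\<close> is \<open>0\<close> on infinite-dimensional subspaces, finite dimensionality is
  required separately. Values are in \<^typ>\<open>ennreal\<close>, so that the suprema always exist.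
\<close>

definition kolmogorov_width ::
    "nat \<Rightarrow> 'v::real_vector set \<Rightarrow> 'v set \<Rightarrow> ('v \<Rightarrow> real) \<Rightarrow> ennreal" where
  "kolmogorov_width n K X \<nu> =
     (INF Q \<in> {Q. subspace Q \<and> Q \<subseteq> X \<and> (\<exists>B. finite B \<and> Q = span B) \<and> dim Q \<le> n}.
        SUP x\<in>K. INF y\<in>Q. ennreal (\<nu> (x - y)))"

lemma kolmogorov_width_0:
  assumes "subspace X"
  shows "kolmogorov_width 0 K X \<nu> = (SUP x\<in>K. ennreal (\<nu> x))"
proof -
  have "{Q. subspace Q \<and> Q \<subseteq> X \<and> (\<exists>B. finite B \<and> Q = span B) \<and> dim Q \<le> 0} = {{0}}"
    (is "?L = _")
  proof (rule set_eqI, rule iffI)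
    fix Q assume "Q \<in> ?L"
    then obtain B where B: "subspace Q" "finite B" "Q = span B" "dim Q = 0"
      by auto
    obtain C where C: "C \<subseteq> B" "independent C" "B \<subseteq> span C"
      by (metis maximal_independent_subset)
    then have QC: "Q = span C"
      using B by (metis span_mono span_span subset_antisym)
    have "finite C"
      using C B finite_subset by blast
    moreover have "card C = 0"
      using B(4) QC C(2) by (metis dim_eq_card_independent dim_span)
    ultimately show "Q \<in> {{0}}"
      using QC by simp
  next
    fix Q :: "'a set" assume "Q \<in> {{0}}"
    then have "Q = span {}" by simp
    moreover have "dim (span {} :: 'a set) = 0"
      by (metis card.empty dim_eq_card_independent dim_span independent_empty)
    moreover have "Q \<subseteq> X"
      using \<open>Q \<in> {{0}}\<close> subspace_0[OF assms] by simp
    ultimately show "Q \<in> ?L"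
      by (metis (mono_tags, lifting) CollectI finite.emptyI le_refl subspace_span)
  qed
  then show ?thesis
    by (simp add: kolmogorov_width_def)
qed

lemma lookup_scaleR:
  "Poly_Mapping.lookup (c *\<^sub>R x) k = c * Poly_Mapping.lookup x k"
  for x :: "nat \<Rightarrow>\<^sub>0 real"
  by (simp add: scaleR_poly_mapping_def)

lemma subspace_coord_space: "subspace (coord_space N)"
proof (rule subspaceI)
  fix x y :: "nat \<Rightarrow>\<^sub>0 real" and c :: real
  assume x: "x \<in> coord_space N"
  then show "c *\<^sub>R x \<in> coord_space N"
    by (auto simp: coord_space_def in_keys_iff lookup_scaleR subset_iff)
  assume "y \<in> coord_space N"
  with x show "x + y \<in> coord_space N"
    using Poly_Mapping.keys_add[of x y] by (auto simp: coord_space_def)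
qed (simp add: coord_space_def)

text \<open>The norm \<open>\<parallel>(x 0, \<dots>, x (m - 1))\<parallel>\<^sub>q\<close> for \<open>1 \<le> q \<le> \<infinity>\<close> and \<open>m \<ge> 1\<close>.\<close>

definition lq_norm :: "ereal \<Rightarrow> nat \<Rightarrow> (nat \<Rightarrow> real) \<Rightarrow> real" where
  "lq_norm q m x =
     (if q = \<infinity> then Max ((\<lambda>k. \<bar>x k\<bar>) ` {..<m})
      else (\<Sum>k<m. \<bar>x k\<bar> powr real_of_ereal q) powr (1 / real_of_ereal q))"

text \<open>The \<open>j\<close>-th block (\<open>j < b\<close>) consists of the coordinates \<open>j * s, \<dots>, j * s + s - 1\<close>.\<close>

definition mixed_norm :: "ereal \<Rightarrow> ereal \<Rightarrow> nat \<Rightarrow> nat \<Rightarrow> (nat \<Rightarrow>\<^sub>0 real) \<Rightarrow> real" where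
  "mixed_norm q1 q2 s b x =
     lq_norm q2 b (\<lambda>j. lq_norm q1 s (\<lambda>i. Poly_Mapping.lookup x (j * s + i)))"

definition mixed_ball :: "ereal \<Rightarrow> ereal \<Rightarrow> nat \<Rightarrow> nat \<Rightarrow> (nat \<Rightarrow>\<^sub>0 real) set" where
  "mixed_ball p1 p2 s b = {x \<in> coord_space (s * b). mixed_norm p1 p2 s b x \<le> 1}"

definition mixed_width ::
    "nat \<Rightarrow> ereal \<Rightarrow> ereal \<Rightarrow> ereal \<Rightarrow> ereal \<Rightarrow> nat \<Rightarrow> nat \<Rightarrow> ennreal" where
  "mixed_width n p1 p2 q1 q2 s b =
     kolmogorov_width n (mixed_ball p1 p2 s b) (coord_space (s * b)) (mixed_norm q1 q2 s b)"

definition exceptional_case :: "ereal \<Rightarrow> ereal \<Rightarrow> ereal \<Rightarrow> ereal \<Rightarrow> bool" where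
  "exceptional_case p1 p2 q1 q2 \<longleftrightarrow> q1 < min p1 q2 \<and> p2 < q2 \<and> q2 \<le> 2"

end

theory Submission
  imports Defs
begin

text \<open>
  Write \<open>1/\<infinity> = 0\<close> and \<open>x\<^sub>+ = max 0 x\<close>. The two levels of a mixed norm decouple on product vectors,
  so \<open>d_0\<close> is exactly \<open>s powr (1/q1 - 1/p1)\<^sub>+ * b powr (1/q2 - 1/p2)\<^sub>+\<close> (\<open>mixed_width_0_eq\<close>);
  \<open>norm_ratio\<close> names these two factors. Both halves of the theorem compare widths with this number.

  \<^bold>\<open>Lower bounds.\<close> If \<open>z\<close> is orthogonal to the approximating space \<open>Q\<close> and
  \<open>\<langle>w, z\<rangle> \<le> \<parallel>w\<parallel>\<close> for all \<open>w\<close>, then every \<open>x\<close> has distance at least \<open>\<langle>x, z\<rangle>\<close> from \<open>Q\<close>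
  (\<open>mixed_width_ge\<close>). Norm comparison with sharp constants (\<open>dual_bound_change_exponents\<close>)
  reduces all tuples satisfying (i)-(iii) to four extremal ones, written \<open>(p1, p2 \<rightarrow> q1, q2)\<close>:
  the octahedron \<open>(1, 1 \<rightarrow> 2, 2)\<close>, the cube \<open>(\<infinity>, \<infinity> \<rightarrow> 1, 1)\<close>, the product of octahedra
  \<open>(1, \<infinity> \<rightarrow> 2, 1)\<close> and the union of the cubes in single blocks \<open>(\<infinity>, 1 \<rightarrow> q2, q2)\<close> with
  \<open>1 < q2 \<le> 2\<close>. The vector \<open>z\<close> always comes from the orthogonal projection \<open>P\<close> onto the complement
  of \<open>Q\<close>, whose trace is at least \<open>\<epsilon> N\<close>:

  \<^item> for the octahedron, \<open>z = P e\<close> for a unit vector \<open>e\<close> with \<open>\<langle>e, P e\<rangle> \<ge> \<epsilon>\<close>;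
  \<^item> for products of octahedra (and the cube, where \<open>s = 1\<close>), \<open>z\<close> is a signed sum of about
    \<open>\<epsilon> b / 4\<close> projected unit vectors from different blocks. A block in which \<open>z\<close> has reached norm 1
    is frozen, that is, later projections vanish on it. Signs are chosen such that
    \<open>\<langle>x, z\<rangle> - \<parallel>z\<parallel>\<^sup>2 / 2\<close> grows, so that as long as \<open>\<langle>x, z\<rangle>\<close> is small only few blocks are frozen
    and the trace stays large (\<open>signed_projection_sum\<close>);
  \<^item> for a cube in one block, \<open>z = P \<sigma>\<close> for a sign vector \<open>\<sigma>\<close> in a block where the trace is large, with
    \<open>\<sigma>\<close> found by derandomizing Khinchine's inequality (\<open>projected_signs\<close>). This is the only place
    where the constant depends on \<open>q2\<close>.

  \<^bold>\<open>Upper bounds.\<close> Blocks of \<open>x\<close> with small \<open>p1\<close>-norm contribute little to the \<open>q2\<close>-norm if \<open>p2 < q2\<close>,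
  and there are few large ones; so it suffices to approximate vectors supported in one block by a linear
  map \<open>A\<close> of small rank with unit diagonal (\<open>kernel_approximation\<close>). Such maps come from hash functions
  \<open>h_0, h_1, \<dots>\<close> of the block number, any two blocks being identified by at most one \<open>h_x\<close>
  (\<open>hash_collide_once\<close>). If \<open>q2 > max p2 2\<close>, averaging the collision matrices of many \<open>h_x\<close> makes the
  off-diagonal entries small in \<open>q2\<close>-norm (\<open>averaged_hash_approximable\<close>); if \<open>q1 > max p1 2\<close>, this is
  applied inside each block. In the exceptional case the \<open>i\<close>-th coordinates of the blocks are hashed by
  \<open>h_x\<close> with \<open>x = i mod K\<close>: the error of one block then has few nonzero coordinates in every other block,
  so its inner \<open>q1\<close>-norms are small relative to \<open>p1\<close>, and it is spread over many blocks, which costs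
  little because \<open>q1 < q2\<close> (\<open>rotating_hash_approximable\<close>).
\<close>

section \<open>Norms on finite sequences\<close>

definition recip :: "ereal \<Rightarrow> real" where
  "recip q = (if q = \<infinity> then 0 else 1 / real_of_ereal q)"

lemma exponent_cases [consumes 1, case_names infinite finite]:
  assumes "1 \<le> q"
  obtains "q = \<infinity>" | r where "1 \<le> r" "q = ereal r"
  using assms by (cases q) auto

lemma recip_ereal [simp]: "recip (ereal r) = 1 / r"
  by (simp add: recip_def)

lemma recip_infinity [simp]: "recip \<infinity> = 0"
  by (simp add: recip_def)

lemma recip_nonneg: "1 \<le> q \<Longrightarrow> 0 \<le> recip q"
  by (cases rule: exponent_cases) auto

lemma recip_antimono:
  assumes "1 \<le> p" "p \<le> q" shows "recip q \<le> recip p"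
proof -
  have "1 \<le> q" using assms by (rule order_trans)
  with assms show ?thesis
    by (cases p; cases q) (auto simp: recip_def frac_le)
qed

lemma recip_strict_antimono:
  assumes "1 \<le> p" "p < q" shows "recip q < recip p"
proof -
  have "1 \<le> q" using assms by (meson order_trans less_imp_le)
  with assms show ?thesis
    by (cases p; cases q) (auto simp: recip_def frac_less2)
qed

lemma Holder_sum:
  fixes a b :: "'i \<Rightarrow> real"
  assumes "1 < p" "1 < q" "1 / p + 1 / q = 1"
    and nn: "\<And>k. k \<in> A \<Longrightarrow> 0 \<le> a k" "\<And>k. k \<in> A \<Longrightarrow> 0 \<le> b k" and "finite A"
  shows "(\<Sum>k\<in>A. a k * b k)
      \<le> (\<Sum>k\<in>A. a k powr p) powr (1 / p) * (\<Sum>k\<in>A. b k powr q) powr (1 / q)"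
proof -
  define S where "S = (\<Sum>k\<in>A. a k powr p)"
  define T where "T = (\<Sum>k\<in>A. b k powr q)"
  have S0: "0 \<le> S" and T0: "0 \<le> T" unfolding S_def T_def by (auto intro: sum_nonneg)
  show ?thesis
  proof (cases "S = 0 \<or> T = 0")
    case True
    then have "(\<forall>k\<in>A. a k = 0) \<or> (\<forall>k\<in>A. b k = 0)"
      unfolding S_def T_def using \<open>finite A\<close> by (subst (asm) (1 2) sum_nonneg_eq_0_iff) auto
    then have "(\<Sum>k\<in>A. a k * b k) = 0" by (auto intro!: sum.neutral)
    then show ?thesis by simp
  next
    case False
    define \<alpha> where "\<alpha> = S powr (1 / p)"
    define \<beta> where "\<beta> = T powr (1 / q)"
    have pos: "0 < \<alpha>" "0 < \<beta>" using False S0 T0 by (auto simp: \<alpha>_def \<beta>_def)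
    have \<alpha>p: "\<alpha> powr p = S" "\<beta> powr q = T"
      using assms False S0 T0 by (auto simp: \<alpha>_def \<beta>_def powr_powr)
    have "(\<Sum>k\<in>A. a k / \<alpha> * (b k / \<beta>)) \<le> (\<Sum>k\<in>A. (a k / \<alpha>) powr p / p + (b k / \<beta>) powr q / q)"
      by (intro sum_mono Youngs_inequality) (use assms pos nn in auto)
    also have "\<dots> = (\<Sum>k\<in>A. a k powr p / S) / p + (\<Sum>k\<in>A. b k powr q / T) / q"
      using pos nn by (simp add: sum.distrib sum_divide_distrib powr_divide \<alpha>p)
    also have "\<dots> = 1 / p + 1 / q"
      using False by (simp add: sum_divide_distrib [symmetric] S_def T_def)
    finally have "(\<Sum>k\<in>A. a k * b k) / (\<alpha> * \<beta>) \<le> 1"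
      using assms(3) by (simp add: sum_divide_distrib)
    then show ?thesis using pos by (simp add: \<alpha>_def \<beta>_def S_def T_def divide_le_eq)
  qed
qed

text \<open>Hoelder's inequality against the constant function 1.\<close>

lemma power_mean_sum:
  fixes a :: "'i \<Rightarrow> real"
  assumes "0 < q" "q \<le> p" and nn: "\<And>k. k \<in> A \<Longrightarrow> 0 \<le> a k" and "finite A"
  shows "(\<Sum>k\<in>A. a k powr q)
      \<le> real (card A) powr (1 - q / p) * (\<Sum>k\<in>A. a k powr p) powr (q / p)"
proof (cases "q = p")
  case True
  then show ?thesis using assms by (cases "A = {}") (auto intro: sum_nonneg)
next
  case False
  define r where "r = p / q"
  define r' where "r' = p / (p - q)"
  have "1 < r" "1 < r'" "1 / r + 1 / r' = 1" "1 / r = q / p" "1 / r' = 1 - q / p"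
    using assms False by (auto simp: r_def r'_def field_simps)
  moreover have "(a k powr q) powr r = a k powr p" for k
    using assms by (simp add: powr_powr r_def)
  ultimately show ?thesis
    using Holder_sum[of r r' A "\<lambda>k. a k powr q" "\<lambda>_. 1"] assms(4)
    by (simp add: mult.commute)
qed

lemma Minkowski_sum:
  fixes a b :: "'i \<Rightarrow> real"
  assumes "1 \<le> p" and nn: "\<And>k. k \<in> A \<Longrightarrow> 0 \<le> a k" "\<And>k. k \<in> A \<Longrightarrow> 0 \<le> b k" and "finite A"
  shows "(\<Sum>k\<in>A. (a k + b k) powr p) powr (1 / p)
      \<le> (\<Sum>k\<in>A. a k powr p) powr (1 / p) + (\<Sum>k\<in>A. b k powr p) powr (1 / p)"
proof (cases "p = 1")
  case True
  then show ?thesis using assms by (simp add: sum.distrib sum_nonneg)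
next
  case False
  then have p: "1 < p" using assms by simp
  define q where "q = p / (p - 1)"
  have q: "1 < q" "1 / p + 1 / q = 1" "1 / q = 1 - 1 / p" using p by (auto simp: q_def field_simps)
  define S where "S = (\<Sum>k\<in>A. (a k + b k) powr p)"
  have S0: "0 \<le> S" unfolding S_def by (auto intro: sum_nonneg)
  have pq: "((a k + b k) powr (p - 1)) powr q = (a k + b k) powr p" for k
    using p by (simp add: powr_powr q_def)
  have "S = (\<Sum>k\<in>A. a k * (a k + b k) powr (p - 1)) + (\<Sum>k\<in>A. b k * (a k + b k) powr (p - 1))"
    unfolding S_def sum.distrib [symmetric]
  proof (rule sum.cong, rule refl)
    fix k assume "k \<in> A"
    then have "0 \<le> a k + b k" using nn by (simp add: add_nonneg_nonneg)
    then have "(a k + b k) powr p = (a k + b k) * (a k + b k) powr (p - 1)"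
      using p by (cases "a k + b k = 0") (auto simp: powr_mult_base)
    then show "(a k + b k) powr p
        = a k * (a k + b k) powr (p - 1) + b k * (a k + b k) powr (p - 1)"
      by (simp add: distrib_right)
  qed
  also have "\<dots> \<le> (\<Sum>k\<in>A. a k powr p) powr (1 / p) * S powr (1 / q)
      + (\<Sum>k\<in>A. b k powr p) powr (1 / p) * S powr (1 / q)"
    using Holder_sum[OF p q(1,2), of A a "\<lambda>k. (a k + b k) powr (p - 1)"]
      Holder_sum[OF p q(1,2), of A b "\<lambda>k. (a k + b k) powr (p - 1)"] assms
    by (intro add_mono) (auto simp: pq S_def)
  finally have *: "S \<le> ((\<Sum>k\<in>A. a k powr p) powr (1 / p) + (\<Sum>k\<in>A. b k powr p) powr (1 / p))
      * S powr (1 / q)" by (simp add: distrib_right)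
  show ?thesis
  proof (cases "S = 0")
    case True
    then show ?thesis by (simp add: S_def)
  next
    case False
    then have "S = S powr (1 / p) * S powr (1 / q)"
      using S0 q by (simp flip: powr_add)
    with * have "S powr (1 / p) * S powr (1 / q)
        \<le> ((\<Sum>k\<in>A. a k powr p) powr (1 / p) + (\<Sum>k\<in>A. b k powr p) powr (1 / p)) * S powr (1 / q)"
      by simp
    then show ?thesis using False S0 by (simp add: S_def)
  qed
qed

lemma lq_norm_ereal:
  "lq_norm (ereal r) m x = (\<Sum>k<m. \<bar>x k\<bar> powr r) powr (1 / r)"
  by (simp add: lq_norm_def)

lemma lq_norm_infinity: "lq_norm \<infinity> m x = Max ((\<lambda>k. \<bar>x k\<bar>) ` {..<m})"
  by (simp add: lq_norm_def)

lemma lq_norm_infinity_le_iff: "0 < m \<Longrightarrow> lq_norm \<infinity> m x \<le> M \<longleftrightarrow> (\<forall>k<m. \<bar>x k\<bar> \<le> M)"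
  by (subst lq_norm_infinity, subst Max_le_iff) auto

lemma lq_norm_cong: "(\<And>k. k < m \<Longrightarrow> \<bar>x k\<bar> = \<bar>y k\<bar>) \<Longrightarrow> lq_norm q m x = lq_norm q m y"
  unfolding lq_norm_def by (intro if_cong refl arg_cong2[where f="(powr)"] arg_cong[where f=Max]
    image_cong sum.cong) auto

lemma lq_norm_abs [simp]: "lq_norm q m (\<lambda>k. \<bar>x k\<bar>) = lq_norm q m x"
  by (rule lq_norm_cong) simp

lemma lq_norm_powr:
  "0 < r \<Longrightarrow> lq_norm (ereal r) m x powr r = (\<Sum>k<m. \<bar>x k\<bar> powr r)"
  by (simp add: lq_norm_ereal powr_powr sum_nonneg)

lemma lq_norm_ge_component:
  assumes "1 \<le> q" "k < m" shows "\<bar>x k\<bar> \<le> lq_norm q m x"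
  using assms(1)
proof (cases rule: exponent_cases)
  case infinite
  then show ?thesis using assms(2) by (auto simp: lq_norm_infinity intro: Max_ge)
next
  case (finite r)
  have "\<bar>x k\<bar> powr r \<le> (\<Sum>k<m. \<bar>x k\<bar> powr r)"
    using assms(2) by (intro member_le_sum) auto
  then have "(\<bar>x k\<bar> powr r) powr (1 / r) \<le> lq_norm q m x"
    using finite by (auto simp: lq_norm_ereal intro: powr_mono2)
  then show ?thesis using finite by (simp add: powr_powr)
qed

lemma lq_norm_nonneg:
  assumes "1 \<le> q" "0 < m" shows "0 \<le> lq_norm q m x"
  using lq_norm_ge_component[OF assms, of x] by linarith

lemma lq_norm_mono:
  assumes "1 \<le> q" "0 < m" "\<And>k. k < m \<Longrightarrow> \<bar>x k\<bar> \<le> \<bar>y k\<bar>"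
  shows "lq_norm q m x \<le> lq_norm q m y"
  using assms(1)
proof (cases rule: exponent_cases)
  case infinite
  then show ?thesis using assms lq_norm_ge_component[of \<infinity> _ m y]
    by (auto simp: lq_norm_infinity_le_iff intro: order_trans)
next
  case (finite r)
  then show ?thesis using assms(3)
    by (auto simp: lq_norm_ereal intro!: powr_mono2 sum_mono sum_nonneg)
qed

lemma lq_norm_scale:
  assumes "1 \<le> q" "0 < m" shows "lq_norm q m (\<lambda>k. c * x k) = \<bar>c\<bar> * lq_norm q m x"
  using assms(1)
proof (cases rule: exponent_cases)
  case infinite
  have "lq_norm q m (\<lambda>k. c * x k) = Max ((*) \<bar>c\<bar> ` ((\<lambda>k. \<bar>x k\<bar>) ` {..<m}))"
    using infinite by (simp add: lq_norm_infinity image_image abs_mult)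
  also have "\<dots> = \<bar>c\<bar> * Max ((\<lambda>k. \<bar>x k\<bar>) ` {..<m})"
    using assms(2) by (intro mono_Max_commute [symmetric]) (auto simp: mono_def intro: mult_left_mono)
  finally show ?thesis using infinite by (simp add: lq_norm_infinity)
next
  case (finite r)
  have "(\<Sum>k<m. \<bar>c * x k\<bar> powr r) = \<bar>c\<bar> powr r * (\<Sum>k<m. \<bar>x k\<bar> powr r)"
    by (simp add: abs_mult powr_mult sum_distrib_left)
  then show ?thesis using finite by (simp add: lq_norm_ereal powr_mult powr_powr sum_nonneg)
qed

lemma lq_norm_0: "1 \<le> q \<Longrightarrow> 0 < m \<Longrightarrow> lq_norm q m (\<lambda>_. 0) = 0"
  using lq_norm_scale[of q m 0 "\<lambda>_. 0"] by simp

lemma lq_norm_triangle: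
  assumes "1 \<le> q" "0 < m"
  shows "lq_norm q m (\<lambda>k. x k + y k) \<le> lq_norm q m x + lq_norm q m y"
  using assms(1)
proof (cases rule: exponent_cases)
  case infinite
  then show ?thesis
    using lq_norm_ge_component[of \<infinity> _ m x] lq_norm_ge_component[of \<infinity> _ m y] assms(2)
    by (simp add: lq_norm_infinity_le_iff) (meson abs_triangle_ineq add_mono order_trans)
next
  case (finite r)
  have "lq_norm q m (\<lambda>k. x k + y k) \<le> lq_norm q m (\<lambda>k. \<bar>x k\<bar> + \<bar>y k\<bar>)"
    using assms by (intro lq_norm_mono) auto
  also have "\<dots> \<le> lq_norm q m x + lq_norm q m y"
    using Minkowski_sum[of r "{..<m}" "\<lambda>k. \<bar>x k\<bar>" "\<lambda>k. \<bar>y k\<bar>"] finite by (simp add: lq_norm_ereal)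
  finally show ?thesis .
qed

lemma lq_norm_antimono:
  assumes "1 \<le> p" "p \<le> q" "0 < m"
  shows "lq_norm q m x \<le> lq_norm p m x"
proof -
  define M where "M = lq_norm p m x"
  have xM: "\<bar>x k\<bar> \<le> M" if "k < m" for k
    using lq_norm_ge_component[OF assms(1) that] by (simp add: M_def)
  have M0: "0 \<le> M" using assms by (simp add: M_def lq_norm_nonneg)
  have "1 \<le> q" using assms by (meson order_trans)
  then show ?thesis
  proof (cases rule: exponent_cases)
    case infinite
    then show ?thesis using xM assms(3) by (simp add: lq_norm_infinity_le_iff M_def)
  next
    case (finite r)
    with assms obtain p' where p': "p = ereal p'" "1 \<le> p'" "p' \<le> r" by (cases p) auto
    have "(\<Sum>k<m. \<bar>x k\<bar> powr r) \<le> (\<Sum>k<m. \<bar>x k\<bar> powr p' * M powr (r - p'))"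
    proof (rule sum_mono)
      fix k assume "k \<in> {..<m}"
      then have "\<bar>x k\<bar> powr (r - p') \<le> M powr (r - p')" using xM p' by (intro powr_mono2) auto
      then have "\<bar>x k\<bar> powr p' * \<bar>x k\<bar> powr (r - p') \<le> \<bar>x k\<bar> powr p' * M powr (r - p')"
        by (intro mult_left_mono) auto
      then show "\<bar>x k\<bar> powr r \<le> \<bar>x k\<bar> powr p' * M powr (r - p')"
        by (simp flip: powr_add)
    qed
    also have "\<dots> = M powr p' * M powr (r - p')"
      using p' by (simp add: M_def lq_norm_powr sum_distrib_right)
    also have "\<dots> = M powr r" by (simp flip: powr_add)
    finally have "lq_norm q m x \<le> (M powr r) powr (1 / r)"
      using finite by (auto simp: lq_norm_ereal intro!: powr_mono2 sum_nonneg)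
    then show ?thesis using finite M0 by (simp add: powr_powr M_def)
  qed
qed

lemma lq_norm_le_lower_exponent:
  assumes "1 \<le> q" "q \<le> p" "0 < m"
  shows "lq_norm q m x \<le> real m powr (recip q - recip p) * lq_norm p m x"
proof -
  have p1: "1 \<le> p" using assms by (meson order_trans)
  show ?thesis
  proof (cases "q = \<infinity>")
    case True
    then show ?thesis using assms by simp
  next
    case False
    then obtain r where r: "q = ereal r" "1 \<le> r" using assms by (cases q) auto
    from p1 show ?thesis
    proof (cases rule: exponent_cases)
      case infinite
      have "(\<Sum>k<m. \<bar>x k\<bar> powr r) \<le> (\<Sum>k<m. lq_norm p m x powr r)"
        using r p1 lq_norm_ge_component[of p _ m x] by (intro sum_mono powr_mono2) auto
      also have "\<dots> = real m * lq_norm p m x powr r" by simp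
      finally have "lq_norm q m x \<le> (real m * lq_norm p m x powr r) powr (1 / r)"
        unfolding r lq_norm_ereal using r by (intro powr_mono2 sum_nonneg) auto
      also have "\<dots> = real m powr (1 / r) * lq_norm p m x"
        using r lq_norm_nonneg[OF p1 assms(3), of x] by (simp add: powr_mult powr_powr)
      finally show ?thesis using infinite r by simp
    next
      case (finite u)
      have "(\<Sum>k<m. \<bar>x k\<bar> powr r)
          \<le> real m powr (1 - r / u) * (\<Sum>k<m. \<bar>x k\<bar> powr u) powr (r / u)"
        using power_mean_sum[of r u "{..<m}" "\<lambda>k. \<bar>x k\<bar>"] finite r assms by simp
      then have "lq_norm q m x
          \<le> (real m powr (1 - r / u) * (\<Sum>k<m. \<bar>x k\<bar> powr u) powr (r / u)) powr (1 / r)"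
        unfolding r lq_norm_ereal using r by (intro powr_mono2 sum_nonneg) auto
      also have "\<dots> = real m powr (1 / r - 1 / u) * (\<Sum>k<m. \<bar>x k\<bar> powr u) powr (1 / u)"
        using r finite by (simp add: powr_mult powr_powr field_simps sum_nonneg)
      finally show ?thesis using r finite by (simp add: lq_norm_ereal)
    qed
  qed
qed

lemma lq_norm_Holder:
  assumes "1 < p" "1 < q" "1 / p + 1 / q = 1"
  shows "(\<Sum>k<m. x k * y k) \<le> lq_norm (ereal p) m x * lq_norm (ereal q) m y"
proof -
  have "(\<Sum>k<m. x k * y k) \<le> (\<Sum>k<m. \<bar>x k\<bar> * \<bar>y k\<bar>)"
    by (intro sum_mono) (metis abs_ge_self abs_mult)
  also have "\<dots> \<le> lq_norm (ereal p) m x * lq_norm (ereal q) m y"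
    unfolding lq_norm_ereal using assms by (intro Holder_sum) auto
  finally show ?thesis .
qed

lemma lq_norm_1: "lq_norm 1 m x = (\<Sum>k<m. \<bar>x k\<bar>)"
  by (simp add: lq_norm_def sum_nonneg)

lemma lq_norm_2: "lq_norm 2 m x = sqrt (\<Sum>k<m. (x k)\<^sup>2)"
proof -
  have "real_of_ereal 2 = 2" by simp
  moreover have "\<bar>u\<bar> powr 2 = u\<^sup>2" for u :: real by (cases "u = 0") (auto simp: powr_numeral)
  ultimately show ?thesis by (simp add: lq_norm_def powr_half_sqrt sum_nonneg)
qed

lemma lq_norm_delta:
  assumes "1 \<le> q" "i < m" shows "lq_norm q m (\<lambda>k. if k = i then c else 0) = \<bar>c\<bar>"
proof (rule antisym)
  have "lq_norm q m (\<lambda>k. if k = i then c else 0) \<le> lq_norm 1 m (\<lambda>k. if k = i then c else 0)"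
    using assms by (intro lq_norm_antimono) auto
  also have "\<dots> = (\<Sum>k<m. if k = i then \<bar>c\<bar> else 0)"
    unfolding lq_norm_1 by (rule sum.cong) auto
  also have "\<dots> = \<bar>c\<bar>" using assms by simp
  finally show "lq_norm q m (\<lambda>k. if k = i then c else 0) \<le> \<bar>c\<bar>" .
  show "\<bar>c\<bar> \<le> lq_norm q m (\<lambda>k. if k = i then c else 0)"
    using lq_norm_ge_component[OF assms, of "\<lambda>k. if k = i then c else 0"] by simp
qed

lemma lq_norm_const:
  assumes "1 \<le> q" "0 < m" shows "lq_norm q m (\<lambda>_. c) = real m powr recip q * \<bar>c\<bar>"
  using assms(1)
proof (cases rule: exponent_cases)
  case infinite
  have "(\<lambda>_. \<bar>c\<bar>) ` {..<m} = {\<bar>c\<bar>}" using assms by auto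
  then show ?thesis using infinite assms by (simp add: lq_norm_infinity)
next
  case (finite r)
  then show ?thesis using assms by (simp add: lq_norm_ereal powr_mult powr_powr)
qed

section \<open>Block norms and their comparison\<close>

text \<open>
  Most arguments treat blocks and coordinates inside a block separately, so vectors are handled
  as functions of the block number and the position in the block.
\<close>

definition block_norm :: "ereal \<Rightarrow> ereal \<Rightarrow> nat \<Rightarrow> nat \<Rightarrow> (nat \<Rightarrow> nat \<Rightarrow> real) \<Rightarrow> real" where
  "block_norm q1 q2 s b F = lq_norm q2 b (\<lambda>j. lq_norm q1 s (F j))"

lemma block_norm_nonneg: "1 \<le> q2 \<Longrightarrow> 0 < b \<Longrightarrow> 0 \<le> block_norm q1 q2 s b F"
  unfolding block_norm_def by (rule lq_norm_nonneg)

lemma block_norm_cong: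
  "(\<And>j i. j < b \<Longrightarrow> i < s \<Longrightarrow> \<bar>F j i\<bar> = \<bar>G j i\<bar>) \<Longrightarrow> block_norm q1 q2 s b F = block_norm q1 q2 s b G"
  unfolding block_norm_def by (rule lq_norm_cong, rule arg_cong[where f=abs], rule lq_norm_cong) auto

lemma block_norm_triangle:
  assumes "1 \<le> q1" "1 \<le> q2" "0 < s" "0 < b"
  shows "block_norm q1 q2 s b (\<lambda>j i. F j i + G j i) \<le> block_norm q1 q2 s b F + block_norm q1 q2 s b G"
proof -
  have "block_norm q1 q2 s b (\<lambda>j i. F j i + G j i)
      \<le> lq_norm q2 b (\<lambda>j. lq_norm q1 s (F j) + lq_norm q1 s (G j))"
    unfolding block_norm_def using assms
    by (intro lq_norm_mono) (auto simp: lq_norm_nonneg lq_norm_triangle)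
  also have "\<dots> \<le> block_norm q1 q2 s b F + block_norm q1 q2 s b G"
    unfolding block_norm_def using assms by (intro lq_norm_triangle)
  finally show ?thesis .
qed

lemma block_norm_0: "1 \<le> q1 \<Longrightarrow> 1 \<le> q2 \<Longrightarrow> 0 < s \<Longrightarrow> 0 < b \<Longrightarrow> block_norm q1 q2 s b (\<lambda>_ _. 0) = 0"
  by (simp add: block_norm_def lq_norm_0)

lemma block_norm_sum:
  assumes "1 \<le> q1" "1 \<le> q2" "0 < s" "0 < b" "finite J"
  shows "block_norm q1 q2 s b (\<lambda>j i. \<Sum>l\<in>J. F l j i) \<le> (\<Sum>l\<in>J. block_norm q1 q2 s b (F l))"
  using assms(5)
proof (induction J rule: finite_induct)
  case empty
  then show ?case using assms by (simp add: block_norm_0)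
next
  case (insert l J)
  then show ?case
    using block_norm_triangle[OF assms(1-4), of "F l" "\<lambda>j i. \<Sum>l\<in>J. F l j i"] by simp
qed

lemma block_norm_scale:
  "1 \<le> q1 \<Longrightarrow> 1 \<le> q2 \<Longrightarrow> 0 < s \<Longrightarrow> 0 < b \<Longrightarrow>
    block_norm q1 q2 s b (\<lambda>j i. c * F j i) = \<bar>c\<bar> * block_norm q1 q2 s b F"
  by (simp add: block_norm_def lq_norm_scale)

definition norm_ratio :: "ereal \<Rightarrow> ereal \<Rightarrow> nat \<Rightarrow> real" where
  "norm_ratio q p m = real m powr max 0 (recip q - recip p)"

lemma norm_ratio_nonneg [simp]: "0 \<le> norm_ratio q p m"
  by (simp add: norm_ratio_def)

lemma norm_ratio_eq_1: "1 \<le> p \<Longrightarrow> p \<le> q \<Longrightarrow> 0 < m \<Longrightarrow> norm_ratio q p m = 1"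
  using recip_antimono[of p q] by (simp add: norm_ratio_def max_def)

lemma norm_ratio_eq_powr:
  "1 \<le> q \<Longrightarrow> q \<le> p \<Longrightarrow> norm_ratio q p m = real m powr (recip q - recip p)"
  using recip_antimono[of q p] by (simp add: norm_ratio_def max_def)

lemma lq_norm_le_norm_ratio:
  assumes "1 \<le> p" "1 \<le> q" "0 < m"
  shows "lq_norm q m x \<le> norm_ratio q p m * lq_norm p m x"
proof (cases "q \<le> p")
  case True
  then show ?thesis using assms lq_norm_le_lower_exponent by (simp add: norm_ratio_eq_powr)
next
  case False
  then show ?thesis using assms lq_norm_antimono[of p q m x] by (simp add: norm_ratio_eq_1)
qed

lemma norm_ratio_attained:
  assumes "1 \<le> p" "1 \<le> q" "0 < m"
  shows "\<exists>x. lq_norm p m x = 1 \<and> lq_norm q m x = norm_ratio q p m"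
proof (cases "q \<le> p")
  case True
  have "lq_norm p m (\<lambda>_. real m powr - recip p) = 1"
    "lq_norm q m (\<lambda>_. real m powr - recip p) = norm_ratio q p m"
    using assms True by (simp_all add: lq_norm_const norm_ratio_eq_powr flip: powr_add)
  then show ?thesis by blast
next
  case False
  then have "lq_norm p m (\<lambda>k. if k = 0 then 1 else 0) = 1"
    "lq_norm q m (\<lambda>k. if k = 0 then 1 else 0) = norm_ratio q p m"
    using assms by (simp_all add: lq_norm_delta norm_ratio_eq_1)
  then show ?thesis by blast
qed

lemma block_norm_le_norm_ratio:
  assumes "1 \<le> p1" "1 \<le> p2" "1 \<le> q1" "1 \<le> q2" "0 < s" "0 < b"
  shows "block_norm q1 q2 s b F \<le> norm_ratio q1 p1 s * norm_ratio q2 p2 b * block_norm p1 p2 s b F"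
proof -
  have "block_norm q1 q2 s b F \<le> lq_norm q2 b (\<lambda>j. norm_ratio q1 p1 s * lq_norm p1 s (F j))"
    unfolding block_norm_def using assms
    by (intro lq_norm_mono) (auto simp: lq_norm_nonneg lq_norm_le_norm_ratio)
  also have "\<dots> = norm_ratio q1 p1 s * lq_norm q2 b (\<lambda>j. lq_norm p1 s (F j))"
    using assms by (simp add: lq_norm_scale)
  also have "\<dots> \<le> norm_ratio q1 p1 s * (norm_ratio q2 p2 b * block_norm p1 p2 s b F)"
    unfolding block_norm_def using assms by (intro mult_left_mono lq_norm_le_norm_ratio) auto
  finally show ?thesis by (simp add: mult.assoc)
qed

lemma block_norm_tensor:
  assumes "1 \<le> q1" "1 \<le> q2" "0 < s" "0 < b"
  shows "block_norm q1 q2 s b (\<lambda>j i. u j * v i) = lq_norm q2 b u * lq_norm q1 s v"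
  using assms lq_norm_scale[of q2 b "lq_norm q1 s v" "\<lambda>j. \<bar>u j\<bar>"]
  by (simp add: block_norm_def lq_norm_scale lq_norm_nonneg mult.commute)

section \<open>Widths in terms of coordinates\<close>

definition block_vec :: "nat \<Rightarrow> nat \<Rightarrow> (nat \<Rightarrow> nat \<Rightarrow> real) \<Rightarrow> nat \<Rightarrow>\<^sub>0 real" where
  "block_vec s b F = Abs_poly_mapping (\<lambda>l. if l < s * b then F (l div s) (l mod s) else 0)"

lemma lookup_block_vec:
  "Poly_Mapping.lookup (block_vec s b F) l = (if l < s * b then F (l div s) (l mod s) else 0)"
proof -
  have "finite {l. (if l < s * b then F (l div s) (l mod s) else 0) \<noteq> 0}"
    by (rule finite_subset[of _ "{..<s * b}"]) (auto split: if_splits)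
  then show ?thesis by (simp add: block_vec_def)
qed

lemma block_index_less: "j < b \<Longrightarrow> i < s \<Longrightarrow> j * s + i < s * (b :: nat)"
proof -
  assume "j < b" "i < s"
  then have "j * s + i < (j + 1) * s" by simp
  also have "\<dots> \<le> b * s" using \<open>j < b\<close> by (intro mult_right_mono) auto
  finally show ?thesis by (simp add: mult.commute)
qed

lemma lookup_block_vec_block:
  "j < b \<Longrightarrow> i < s \<Longrightarrow> Poly_Mapping.lookup (block_vec s b F) (j * s + i) = F j i"
  by (simp add: lookup_block_vec block_index_less)

lemma block_vec_in: "block_vec s b F \<in> coord_space (s * b)"
  by (auto simp: coord_space_def in_keys_iff lookup_block_vec split: if_splits)

lemma mixed_norm_eq_block_norm:
  "mixed_norm q1 q2 s b x = block_norm q1 q2 s b (\<lambda>j i. Poly_Mapping.lookup x (j * s + i))"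
  by (simp add: mixed_norm_def block_norm_def)

lemma mixed_norm_block_vec: "mixed_norm q1 q2 s b (block_vec s b F) = block_norm q1 q2 s b F"
  unfolding mixed_norm_eq_block_norm by (rule block_norm_cong) (simp add: lookup_block_vec_block)

lemma block_vec_in_ball: "block_norm p1 p2 s b F \<le> 1 \<Longrightarrow> block_vec s b F \<in> mixed_ball p1 p2 s b"
  by (simp add: mixed_ball_def block_vec_in mixed_norm_block_vec)

lemma sum_blocks: "(\<Sum>l<s * b. f l) = (\<Sum>j<b. \<Sum>i<s. f (j * s + i :: nat))"
  for f :: "nat \<Rightarrow> real"
proof -
  have "(\<Sum>l<s * b. f l) = (\<Sum>j<b. sum f {j * s..<j * s + s})"
    by (simp add: sum.nat_group mult.commute)
  also have "\<dots> = (\<Sum>j<b. \<Sum>i<s. f (j * s + i))"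
  proof (rule sum.cong, rule refl)
    fix j
    show "sum f {j * s..<j * s + s} = (\<Sum>i<s. f (j * s + i))"
      using sum.shift_bounds_nat_ivl[of f 0 "j * s" s] by (simp add: lessThan_atLeast0 add.commute)
  qed
  finally show ?thesis .
qed

lemma mixed_width_0_eq:
  assumes "1 \<le> p1" "1 \<le> p2" "1 \<le> q1" "1 \<le> q2" "0 < s" "0 < b"
  shows "mixed_width 0 p1 p2 q1 q2 s b = ennreal (norm_ratio q1 p1 s * norm_ratio q2 p2 b)"
  unfolding mixed_width_def kolmogorov_width_0[OF subspace_coord_space]
proof (rule antisym)
  show "(SUP x\<in>mixed_ball p1 p2 s b. ennreal (mixed_norm q1 q2 s b x))
      \<le> ennreal (norm_ratio q1 p1 s * norm_ratio q2 p2 b)"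
  proof (rule SUP_least, rule ennreal_leI)
    fix x assume "x \<in> mixed_ball p1 p2 s b"
    then have "mixed_norm p1 p2 s b x \<le> 1" by (simp add: mixed_ball_def)
    then have "norm_ratio q1 p1 s * norm_ratio q2 p2 b * mixed_norm p1 p2 s b x
        \<le> norm_ratio q1 p1 s * norm_ratio q2 p2 b * 1"
      by (intro mult_left_mono) auto
    then show "mixed_norm q1 q2 s b x \<le> norm_ratio q1 p1 s * norm_ratio q2 p2 b"
      using block_norm_le_norm_ratio[OF assms] unfolding mixed_norm_eq_block_norm
      by (metis mult.right_neutral order_trans)
  qed
next
  obtain u v where u: "lq_norm p2 b u = 1" "lq_norm q2 b u = norm_ratio q2 p2 b"
    and v: "lq_norm p1 s v = 1" "lq_norm q1 s v = norm_ratio q1 p1 s"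
    using norm_ratio_attained assms by meson
  define F where "F = (\<lambda>j i. u j * v i)"
  have F: "block_norm p1 p2 s b F = 1" "block_norm q1 q2 s b F = norm_ratio q2 p2 b * norm_ratio q1 p1 s"
    using assms u v by (simp_all add: F_def block_norm_tensor)
  have "ennreal (mixed_norm q1 q2 s b (block_vec s b F))
      \<le> (SUP x\<in>mixed_ball p1 p2 s b. ennreal (mixed_norm q1 q2 s b x))"
    using F by (intro SUP_upper block_vec_in_ball) auto
  then show "ennreal (norm_ratio q1 p1 s * norm_ratio q2 p2 b)
      \<le> (SUP x\<in>mixed_ball p1 p2 s b. ennreal (mixed_norm q1 q2 s b x))"
    by (simp add: mixed_norm_block_vec F mult.commute)
qed

text \<open>
  The approximant may depend nonlinearly on \<open>F\<close>; only the span of the \<open>g k\<close> is fixed.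
\<close>

lemma mixed_width_le:
  fixes g :: "'k \<Rightarrow> nat \<Rightarrow> nat \<Rightarrow> real"
  assumes "finite I" "card I \<le> n"
    and approx: "\<And>F. block_norm p1 p2 s b F \<le> 1 \<Longrightarrow>
      \<exists>c. block_norm q1 q2 s b (\<lambda>j i. F j i - (\<Sum>k\<in>I. c k * g k j i)) \<le> D"
  shows "mixed_width n p1 p2 q1 q2 s b \<le> ennreal D"
  unfolding mixed_width_def kolmogorov_width_def
proof (rule INF_lower2)
  let ?B = "(\<lambda>k. block_vec s b (g k)) ` I"
  show "span ?B \<in> {Q. subspace Q \<and> Q \<subseteq> coord_space (s * b) \<and> (\<exists>B. finite B \<and> Q = span B) \<and> dim Q \<le> n}"
  proof (intro CollectI conjI)
    show "subspace (span ?B)" by (rule subspace_span)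
    show "span ?B \<subseteq> coord_space (s * b)"
      using subspace_coord_space block_vec_in by (intro span_minimal) auto
    show "\<exists>B. finite B \<and> span ?B = span B" using assms(1) by blast
    have "dim (span ?B) \<le> card ?B" using assms(1) by (simp add: dim_le_card')
    also have "\<dots> \<le> n" using assms(1,2) card_image_le order_trans by blast
    finally show "dim (span ?B) \<le> n" .
  qed
  show "(SUP x\<in>mixed_ball p1 p2 s b. INF y\<in>span ?B. ennreal (mixed_norm q1 q2 s b (x - y))) \<le> ennreal D"
  proof (rule SUP_least)
    fix x assume x: "x \<in> mixed_ball p1 p2 s b"
    then obtain c where c: "block_norm q1 q2 s b
        (\<lambda>j i. Poly_Mapping.lookup x (j * s + i) - (\<Sum>k\<in>I. c k * g k j i)) \<le> D"
      using approx by (auto simp: mixed_ball_def mixed_norm_eq_block_norm)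
    define y where "y = (\<Sum>k\<in>I. c k *\<^sub>R block_vec s b (g k))"
    have "y \<in> span ?B" unfolding y_def by (intro span_sum span_scale span_base) auto
    moreover have "mixed_norm q1 q2 s b (x - y) = block_norm q1 q2 s b
        (\<lambda>j i. Poly_Mapping.lookup x (j * s + i) - (\<Sum>k\<in>I. c k * g k j i))"
      unfolding mixed_norm_eq_block_norm
      by (rule block_norm_cong)
        (simp add: y_def lookup_minus lookup_sum lookup_scaleR lookup_block_vec_block)
    ultimately show "(INF y\<in>span ?B. ennreal (mixed_norm q1 q2 s b (x - y))) \<le> ennreal D"
      using c by (intro INF_lower2[of y]) (auto intro: ennreal_leI)
  qed
qed

text \<open>
  A functional \<open>Z\<close> of dual norm at most 1 that annihilates the approximating space cannot
  distinguish \<open>X\<close> from \<open>X - y\<close>. The space enters only through a basis, given as a finite set \<open>C\<close>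
  of coordinate functions.
\<close>

lemma mixed_width_ge:
  assumes pos: "0 < s" "0 < b"
    and dual: "\<And>C. finite C \<Longrightarrow> card C \<le> n \<Longrightarrow> \<exists>X Z. block_norm p1 p2 s b X \<le> 1 \<and>
      (\<forall>c\<in>C. (\<Sum>j<b. \<Sum>i<s. c (j * s + i) * Z j i) = 0) \<and>
      D \<le> (\<Sum>j<b. \<Sum>i<s. X j i * Z j i) \<and>
      (\<forall>W. (\<Sum>j<b. \<Sum>i<s. W j i * Z j i) \<le> block_norm q1 q2 s b W)"
  shows "ennreal D \<le> mixed_width n p1 p2 q1 q2 s b"
  unfolding mixed_width_def kolmogorov_width_def
proof (rule INF_greatest)
  let ?lk = Poly_Mapping.lookup
  fix Q :: "(nat \<Rightarrow>\<^sub>0 real) set"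
  assume "Q \<in> {Q. subspace Q \<and> Q \<subseteq> coord_space (s * b) \<and> (\<exists>B. finite B \<and> Q = span B) \<and> dim Q \<le> n}"
  then obtain B where B: "finite B" "Q = span B" "dim Q \<le> n" by auto
  obtain A where A: "A \<subseteq> B" "independent A" "B \<subseteq> span A"
    by (metis maximal_independent_subset)
  have QA: "Q = span A" using B A by (metis span_mono span_span subset_antisym)
  have "finite A" using A B finite_subset by blast
  have "card A = dim Q" using A QA by (simp add: dim_eq_card_independent)
  then have "card (?lk ` A) \<le> n"
    using card_image_le[OF \<open>finite A\<close>, of ?lk] B(3) by linarith
  then obtain X Z where X: "block_norm p1 p2 s b X \<le> 1"
    and orth: "\<And>c. c \<in> ?lk ` A \<Longrightarrow> (\<Sum>j<b. \<Sum>i<s. c (j * s + i) * Z j i) = 0"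
    and D: "D \<le> (\<Sum>j<b. \<Sum>i<s. X j i * Z j i)"
    and W: "\<And>W. (\<Sum>j<b. \<Sum>i<s. W j i * Z j i) \<le> block_norm q1 q2 s b W"
    using dual[of "?lk ` A"] \<open>finite A\<close> by auto
  have orthQ: "(\<Sum>j<b. \<Sum>i<s. ?lk y (j * s + i) * Z j i) = 0" if "y \<in> Q" for y
    using that unfolding QA
  proof (induction rule: span_induct_alt)
    case base
    show ?case by simp
  next
    case (step c x y)
    then show ?case using orth[of "?lk x"]
      by (simp add: lookup_add lookup_scaleR distrib_right sum.distrib mult.assoc
          flip: sum_distrib_left)
  qed
  have "ennreal D \<le> (INF y\<in>Q. ennreal (mixed_norm q1 q2 s b (block_vec s b X - y)))"
  proof (rule INF_greatest, rule ennreal_leI)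
    fix y assume "y \<in> Q"
    let ?W = "\<lambda>j i. ?lk (block_vec s b X - y) (j * s + i)"
    have "(\<Sum>j<b. \<Sum>i<s. X j i * Z j i) = (\<Sum>j<b. \<Sum>i<s. ?W j i * Z j i)"
      using orthQ[OF \<open>y \<in> Q\<close>]
      by (simp add: lookup_minus left_diff_distrib sum_subtractf lookup_block_vec_block)
    also have "\<dots> \<le> mixed_norm q1 q2 s b (block_vec s b X - y)"
      unfolding mixed_norm_eq_block_norm by (rule W)
    finally show "D \<le> mixed_norm q1 q2 s b (block_vec s b X - y)" using D by simp
  qed
  also have "\<dots> \<le> (SUP x\<in>mixed_ball p1 p2 s b. INF y\<in>Q. ennreal (mixed_norm q1 q2 s b (x - y)))"
    by (rule SUP_upper[OF block_vec_in_ball[OF X]])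
  finally show "ennreal D
      \<le> (SUP x\<in>mixed_ball p1 p2 s b. INF y\<in>Q. ennreal (mixed_norm q1 q2 s b (x - y)))" .
qed

section \<open>Orthogonal projections\<close>

text \<open>Gaussian elimination, one equation at a time.\<close>

lemma homogeneous_system_nontrivial:
  fixes S :: "'i set" and T :: "('i \<Rightarrow> real) set"
  assumes "finite T" "finite S" "card T \<le> m" "m < card S"
  shows "\<exists>x. (\<exists>i\<in>S. x i \<noteq> 0) \<and> (\<forall>c\<in>T. (\<Sum>i\<in>S. c i * x i) = 0)"
  using assms
proof (induction m arbitrary: S T)
  case 0
  then have "T = {}" "S \<noteq> {}" by auto
  then show ?case by (intro exI[of _ "\<lambda>_. 1"]) auto
next
  case (Suc m)
  show ?case
  proof (cases "\<forall>d\<in>T. \<forall>i\<in>S. d i = 0")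
    case True
    have "S \<noteq> {}" using Suc.prems by auto
    then show ?thesis using True by (intro exI[of _ "\<lambda>_. 1"]) auto
  next
    case False
    then obtain d i0 where d: "d \<in> T" and i0: "i0 \<in> S" "d i0 \<noteq> 0" by blast
    define el where "el = (\<lambda>c i. c i - c i0 / d i0 * d i)"
    have "card (T - {d}) \<le> m" using Suc.prems d by simp
    then have "card (el ` (T - {d})) \<le> m" "finite (el ` (T - {d}))"
      using card_image_le[of "T - {d}" el] Suc.prems by auto
    moreover have "m < card (S - {i0})" using Suc.prems i0 by simp
    ultimately have "\<exists>x. (\<exists>i\<in>S - {i0}. x i \<noteq> 0)
        \<and> (\<forall>c\<in>el ` (T - {d}). (\<Sum>i\<in>S - {i0}. c i * x i) = 0)"
      using Suc.IH[of "el ` (T - {d})" "S - {i0}"] Suc.prems by blast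
    then obtain x where x: "\<exists>i\<in>S - {i0}. x i \<noteq> 0"
      "\<And>c. c \<in> T - {d} \<Longrightarrow> (\<Sum>i\<in>S - {i0}. el c i * x i) = 0" by blast
    define r where "r = (\<Sum>i\<in>S - {i0}. d i * x i)"
    define x' where "x' = x(i0 := - r / d i0)"
    have split: "(\<Sum>i\<in>S. c i * x' i) = - c i0 * r / d i0 + (\<Sum>i\<in>S - {i0}. c i * x i)" for c
    proof -
      have "(\<Sum>i\<in>S - {i0}. c i * x' i) = (\<Sum>i\<in>S - {i0}. c i * x i)"
        by (rule sum.cong) (auto simp: x'_def)
      then show ?thesis using i0 Suc.prems(2) by (simp add: sum.remove[of S i0] x'_def)
    qed
    have "(\<Sum>i\<in>S. c i * x' i) = 0" if "c \<in> T" for c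
    proof (cases "c = d")
      case True
      then show ?thesis using i0 by (simp add: split r_def)
    next
      case False
      have "(\<Sum>i\<in>S - {i0}. el c i * x i) = (\<Sum>i\<in>S - {i0}. c i * x i) - c i0 / d i0 * r"
        unfolding el_def r_def by (simp add: left_diff_distrib sum_subtractf sum_distrib_left mult.assoc)
      then show ?thesis using x(2)[of c] that False by (simp add: split)
    qed
    moreover have "\<exists>i\<in>S. x' i \<noteq> 0" using x(1) by (auto simp: x'_def)
    ultimately show ?thesis by blast
  qed
qed

lemma orthonormal_family_exists:
  fixes C :: "(nat \<Rightarrow> real) set"
  assumes "finite C" "card C + d \<le> N"
  shows "\<exists>w. (\<forall>a<d. \<forall>c\<in>C. (\<Sum>i<N. c i * w a i) = 0) \<and>
    (\<forall>a<d. \<forall>a'<d. (\<Sum>i<N. w a i * w a' i) = (if a = a' then 1 else (0::real)))"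
  using assms(2)
proof (induction d)
  case 0
  then show ?case by simp
next
  case (Suc d)
  then obtain w where w: "\<And>a c. a < d \<Longrightarrow> c \<in> C \<Longrightarrow> (\<Sum>i<N. c i * w a i) = 0"
    "\<And>a a'. a < d \<Longrightarrow> a' < d \<Longrightarrow> (\<Sum>i<N. w a i * w a' i) = (if a = a' then 1 else 0)"
    by fastforce
  have "card (C \<union> w ` {..<d}) \<le> card C + d"
    using card_Un_le[of C "w ` {..<d}"] card_image_le[of "{..<d}" w] by simp
  then have "card (C \<union> w ` {..<d}) < card {..<N}" using Suc.prems by simp
  then obtain x where x: "\<exists>i<N. x i \<noteq> 0" "\<And>c. c \<in> C \<union> w ` {..<d} \<Longrightarrow> (\<Sum>i<N. c i * x i) = 0"
    using homogeneous_system_nontrivial[of "C \<union> w ` {..<d}" "{..<N}" "card (C \<union> w ` {..<d})"] assms(1)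
    by auto
  define r where "r = sqrt (\<Sum>i<N. x i * x i)"
  obtain i where i: "i < N" "x i \<noteq> 0" using x(1) by blast
  then have "x i * x i > 0" by (metis not_real_square_gt_zero)
  then have "(\<Sum>i<N. x i * x i) > 0"
    using i(1) by (intro sum_pos2[of _ i]) auto
  then have r: "r > 0" "r * r = (\<Sum>i<N. x i * x i)" by (auto simp: r_def)
  define w' where "w' = w(d := (\<lambda>i. x i / r))"
  have dd: "(\<Sum>i<N. w' d i * w' d i) = 1"
  proof -
    have "(\<Sum>i<N. w' d i * w' d i) = (\<Sum>i<N. x i * x i) / (r * r)"
      by (simp add: w'_def sum_divide_distrib)
    also have "\<dots> = (r * r) / (r * r)" by (simp only: r(2))
    finally show ?thesis using r(1) by simp
  qed
  have ad: "(\<Sum>i<N. w' a i * w' d i) = 0" if "a < d" for a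
  proof -
    have "(\<Sum>i<N. w a i * x i) = 0" using x(2)[of "w a"] that by auto
    then show ?thesis using that by (simp add: w'_def flip: sum_divide_distrib)
  qed
  have da: "(\<Sum>i<N. w' d i * w' a i) = 0" if "a < d" for a
    using ad[OF that] by (simp add: mult.commute)
  have "(\<Sum>i<N. w' a i * w' a' i) = (if a = a' then 1 else 0)" if "a < Suc d" "a' < Suc d" for a a'
  proof -
    consider "a < d" "a' < d" | "a < d" "a' = d" | "a = d" "a' < d" | "a = d" "a' = d"
      using \<open>a < Suc d\<close> \<open>a' < Suc d\<close> by linarith
    then show ?thesis using ad da dd w(2) by cases (auto simp: w'_def)
  qed
  moreover have "(\<Sum>i<N. c i * w' a i) = 0" if "a < Suc d" "c \<in> C" for a c
  proof (cases "a = d")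
    case True
    then show ?thesis using x(2)[of c] that by (simp add: w'_def flip: sum_divide_distrib)
  next
    case False
    then show ?thesis using w(1)[of a c] that by (simp add: w'_def)
  qed
  ultimately show ?case by blast
qed

text \<open>
  The matrix of an orthogonal projection of \<open>\<real>\<^sup>N\<close>: symmetric and idempotent. Requiring this for
  all indices, including those beyond \<open>N\<close>, avoids range conditions and is harmless for projections
  built from an orthonormal family.
\<close>

definition orth_proj :: "nat \<Rightarrow> (nat \<Rightarrow> nat \<Rightarrow> real) \<Rightarrow> bool" where
  "orth_proj N P \<longleftrightarrow> (\<forall>i j. P i j = P j i) \<and> (\<forall>i j. (\<Sum>k<N. P i k * P k j) = P i j)"

lemma orth_proj_exists:
  fixes C :: "(nat \<Rightarrow> real) set"
  assumes "finite C"
  obtains P where "orth_proj N P"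
    "\<And>c j. c \<in> C \<Longrightarrow> (\<Sum>i<N. c i * P i j) = 0"
    "real N - real (card C) \<le> (\<Sum>i<N. P i i)"
proof -
  define d where "d = N - card C"
  have "\<exists>w. (\<forall>a<d. \<forall>c\<in>C. (\<Sum>i<N. c i * w a i) = 0) \<and>
    (\<forall>a<d. \<forall>a'<d. (\<Sum>i<N. w a i * w a' i) = (if a = a' then 1 else (0::real)))"
  proof (cases "card C \<le> N")
    case True
    then show ?thesis using orthonormal_family_exists[OF assms, of d N] by (simp add: d_def)
  qed (simp add: d_def)
  then obtain w where w: "\<And>a c. a < d \<Longrightarrow> c \<in> C \<Longrightarrow> (\<Sum>i<N. c i * w a i) = 0"
    "\<And>a a'. a < d \<Longrightarrow> a' < d \<Longrightarrow> (\<Sum>i<N. w a i * w a' i) = (if a = a' then 1 else (0::real))"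
    by blast
  define P where "P = (\<lambda>i j. \<Sum>a<d. w a i * w a j)"
  have "(\<Sum>k<N. P i k * P k j) = P i j" for i j
  proof -
    have "(\<Sum>k<N. P i k * P k j) = (\<Sum>k<N. \<Sum>a<d. \<Sum>a'<d. w a i * w a' j * (w a k * w a' k))"
      by (simp add: P_def sum_product mult_ac)
    also have "\<dots> = (\<Sum>a<d. \<Sum>a'<d. \<Sum>k<N. w a i * w a' j * (w a k * w a' k))"
      by (subst sum.swap, rule sum.cong, rule refl, subst sum.swap) simp
    also have "\<dots> = (\<Sum>a<d. \<Sum>a'<d. if a = a' then w a i * w a' j else 0)"
      by (intro sum.cong refl) (simp add: w(2) flip: sum_distrib_left)
    also have "\<dots> = P i j" by (simp add: P_def)
    finally show ?thesis .
  qed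
  moreover have "P i j = P j i" for i j by (simp add: P_def mult.commute)
  moreover have "(\<Sum>i<N. c i * P i j) = 0" if "c \<in> C" for c j
  proof -
    have "(\<Sum>i<N. c i * P i j) = (\<Sum>a<d. (\<Sum>i<N. c i * w a i) * w a j)"
      by (simp add: P_def sum_distrib_left sum_distrib_right mult.assoc) (rule sum.swap)
    then show ?thesis using w(1) that by simp
  qed
  moreover have "real N - real (card C) \<le> (\<Sum>i<N. P i i)"
  proof -
    have "(\<Sum>i<N. P i i) = (\<Sum>a<d. \<Sum>i<N. w a i * w a i)" by (simp add: P_def) (rule sum.swap)
    also have "\<dots> = real d" by (simp add: w(2))
    finally show ?thesis by (simp add: d_def)
  qed
  ultimately show thesis by (intro that[of P]) (simp_all add: orth_proj_def)
qed

lemma orth_proj_sym: "orth_proj N P \<Longrightarrow> P i j = P j i"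
  by (simp add: orth_proj_def)

lemma orth_proj_row: "orth_proj N P \<Longrightarrow> (\<Sum>k<N. (P k i)\<^sup>2) = P i i"
proof -
  assume P: "orth_proj N P"
  have "(\<Sum>k<N. (P k i)\<^sup>2) = (\<Sum>k<N. P i k * P k i)"
  proof (rule sum.cong, rule refl)
    fix k show "(P k i)\<^sup>2 = P i k * P k i"
      using orth_proj_sym[OF P, of i k] by (simp add: power2_eq_square)
  qed
  also have "\<dots> = P i i" using P unfolding orth_proj_def by blast
  finally show ?thesis .
qed

lemma orth_proj_diag_nonneg: "orth_proj N P \<Longrightarrow> 0 \<le> P i i"
  by (subst orth_proj_row [symmetric]) (auto intro: sum_nonneg)

lemma orth_proj_diag_le_1:
  assumes "orth_proj N P" "i < N" shows "P i i \<le> 1"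
proof -
  have "(P i i)\<^sup>2 \<le> (\<Sum>k<N. (P k i)\<^sup>2)"
    using assms(2) member_le_sum[of i "{..<N}" "\<lambda>k. (P k i)\<^sup>2"] by auto
  then have "P i i * P i i \<le> P i i" using orth_proj_row[OF assms(1)] by (simp add: power2_eq_square)
  then show ?thesis using mult_strict_right_mono[of 1 "P i i" "P i i"] by linarith
qed

section \<open>Signed sums of projected unit vectors\<close>

text \<open>
  The dual certificate for the product of octahedra. Suppose that no good pair exists. Then
  \<open>\<langle>x, z\<rangle>\<close> stays below \<open>\<epsilon>\<^sup>2 b / 16\<close>, and the process described at the beginning can be continued
  for \<open>\<epsilon> b / 4\<close> steps, each of which increases \<open>\<langle>x, z\<rangle> - \<parallel>z\<parallel>\<^sup>2 / 2\<close> by at least \<open>\<epsilon> / 4\<close>;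
  after these steps \<open>\<langle>x, z\<rangle>\<close> is too large. Using different blocks keeps \<open>x\<close> in the product of
  octahedra. A block norm of \<open>z\<close> is below 1 before the step that freezes the block, and a step adds
  at most 1, which explains the bound \<open>4\<close> for its square.
\<close>

lemma signed_projection_sum:
  fixes C :: "(nat \<Rightarrow> real) set"
  assumes pos: "0 < s" "0 < b" and C: "finite C" "real (card C) \<le> real (s * b) * (1 - \<epsilon>)"
    and \<epsilon>: "0 < \<epsilon>"
  shows "\<exists>x z. (\<forall>j<b. (\<Sum>i<s. \<bar>x (j * s + i)\<bar>) \<le> 1) \<and>
    (\<forall>c\<in>C. (\<Sum>l<s * b. c l * z l) = 0) \<and>
    (\<forall>j<b. (\<Sum>i<s. (z (j * s + i))\<^sup>2) \<le> 4) \<and>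
    \<epsilon>\<^sup>2 * real b / 16 \<le> (\<Sum>l<s * b. x l * z l)"
    (is "\<exists>x z. ?good x z")
proof (rule ccontr)
  assume bad: "\<not> (\<exists>x z. ?good x z)"
  define N where "N = s * b"
  have Npos: "0 < real N" using pos by (simp add: N_def)
  have "0 \<le> real N * (1 - \<epsilon>)" using C(2) by (simp add: N_def order_trans[OF of_nat_0_le_iff])
  then have \<epsilon>1: "\<epsilon> \<le> 1" using Npos by (simp add: zero_le_mult_iff)
  \<comment> \<open>The state after \<open>k\<close> steps; \<open>U\<close> collects the blocks used so far.\<close>
  define st where "st = (\<lambda>k x z U. U \<subseteq> {..<b} \<and> card U = k \<and>
    (\<forall>j<b. (\<Sum>i<s. \<bar>x (j * s + i)\<bar>) \<le> (if j \<in> U then 1 else 0)) \<and>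
    (\<forall>c\<in>C. (\<Sum>l<N. c l * z l) = 0) \<and>
    (\<forall>j<b. (\<Sum>i<s. (z (j * s + i))\<^sup>2) \<le> 4) \<and>
    real k * (\<epsilon> / 4) \<le> (\<Sum>l<N. x l * z l) - (\<Sum>l<N. (z l)\<^sup>2) / (2::real))"
  have small: "(\<Sum>l<N. x l * z l) < \<epsilon>\<^sup>2 * real b / 16" if "st k x z U" for k x z U
  proof (rule ccontr)
    assume "\<not> ?thesis"
    moreover have "(\<Sum>i<s. \<bar>x (j * s + i)\<bar>) \<le> 1" if "j < b" for j
      using \<open>st k x z U\<close> that unfolding st_def by (cases "j \<in> U") fastforce+
    ultimately have "?good x z" using that unfolding st_def N_def by auto
    then show False using bad by blast
  qed
  have step: "\<exists>x z U. st (Suc k) x z U" if st: "st k x z U" and k: "real k < \<epsilon> * real b / 4" for k x z U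
  proof -
    note st' = st[unfolded st_def]
    have U: "U \<subseteq> {..<b}" "card U = k" "finite U" using st' finite_subset by auto
    have "0 \<le> real k * (\<epsilon> / 4)" using \<epsilon> by simp
    then have "(\<Sum>l<N. (z l)\<^sup>2) \<le> 2 * (\<Sum>l<N. x l * z l)" using st' by linarith
    also have "\<dots> \<le> \<epsilon>\<^sup>2 * real b / 8" using small[OF st] by simp
    also have "\<dots> \<le> \<epsilon> * real b / 8"
      using \<epsilon> \<epsilon>1 mult_right_mono[of \<epsilon> 1 "\<epsilon> * real b"] by (simp add: power2_eq_square)
    finally have znorm: "(\<Sum>l<N. (z l)\<^sup>2) \<le> \<epsilon> * real b / 8" .
    define F where "F = {j. j < b \<and> 1 \<le> (\<Sum>i<s. (z (j * s + i))\<^sup>2)}"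
    have finF: "finite F" and Fb: "F \<subseteq> {..<b}" by (auto simp: F_def)
    have "real (card F) = (\<Sum>j\<in>F. 1)" by simp
    also have "\<dots> \<le> (\<Sum>j\<in>F. \<Sum>i<s. (z (j * s + i))\<^sup>2)" by (rule sum_mono) (simp add: F_def)
    also have "\<dots> \<le> (\<Sum>j<b. \<Sum>i<s. (z (j * s + i))\<^sup>2)"
      using Fb by (intro sum_mono2) (auto intro: sum_nonneg)
    also have "\<dots> \<le> \<epsilon> * real b / 8" using znorm by (simp add: N_def sum_blocks)
    finally have cardF: "real (card F) \<le> \<epsilon> * real b / 8" .
    \<comment> \<open>Unit vectors of the frozen blocks \<open>F\<close> join the constraints, so the new projection vanishes there.\<close>
    define un where "un = (\<lambda>(j, i) l. if l = j * s + i then 1 else (0::real))"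
    define C' where "C' = C \<union> un ` (F \<times> {..<s})"
    have finC': "finite C'" using C finF by (simp add: C'_def)
    have "card C' \<le> card C + card F * s"
      using card_Un_le[of C "un ` (F \<times> {..<s})"] card_image_le[of "F \<times> {..<s}" un] finF
      by (simp add: C'_def card_cartesian_product)
    then have "real (card C') \<le> real (card C) + real (card F) * real s"
      by (metis of_nat_add of_nat_le_iff of_nat_mult)
    also have "\<dots> \<le> real N * (1 - \<epsilon>) + \<epsilon> * real b / 8 * real s"
      using C(2) cardF by (intro add_mono mult_right_mono) (auto simp: N_def)
    finally have cardC': "real (card C') \<le> real N * (1 - \<epsilon>) + \<epsilon> * real N / 8"
      by (simp add: N_def mult_ac)
    obtain P where P: "orth_proj N P" and orth: "\<And>c j. c \<in> C' \<Longrightarrow> (\<Sum>i<N. c i * P i j) = 0"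
      and tr: "real N - real (card C') \<le> (\<Sum>i<N. P i i)"
      using orth_proj_exists[OF finC'] by blast
    have P1: "P i i \<le> 1" if "i < N" for i using orth_proj_diag_le_1[OF P that] .
    have frozen: "P (j * s + i) m = 0" if "j \<in> F" "i < s" for j i m
    proof -
      have "j * s + i < N" using that Fb block_index_less[of j b i s] by (auto simp: N_def)
      have "un (j, i) \<in> C'" using that by (auto simp: C'_def)
      from orth[OF this, of m] have "(\<Sum>l<N. if l = j * s + i then P l m else 0) = 0"
        by (simp add: un_def if_distrib[of "\<lambda>t. t * _"] cong: if_cong)
      then show ?thesis using \<open>j * s + i < N\<close> by simp
    qed
    have "\<exists>j i. j < b \<and> j \<notin> U \<and> i < s \<and> \<epsilon> / 2 \<le> P (j * s + i) (j * s + i)"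
    proof (rule ccontr)
      assume neg: "\<not> ?thesis"
      have "(\<Sum>l<N. P l l) = (\<Sum>j<b. \<Sum>i<s. P (j * s + i) (j * s + i))"
        unfolding N_def by (rule sum_blocks)
      also have "\<dots> = (\<Sum>j\<in>{..<b} - U. \<Sum>i<s. P (j * s + i) (j * s + i))
          + (\<Sum>j\<in>U. \<Sum>i<s. P (j * s + i) (j * s + i))"
        using U by (intro sum.subset_diff) auto
      also have "\<dots> \<le> (\<Sum>j\<in>{..<b} - U. \<Sum>i<s. \<epsilon> / 2) + (\<Sum>j\<in>U. \<Sum>i<s. 1)"
      proof (intro add_mono sum_mono)
        show "P (j * s + i) (j * s + i) \<le> \<epsilon> / 2" if "j \<in> {..<b} - U" "i \<in> {..<s}" for j i
          using neg that by force
        show "P (j * s + i) (j * s + i) \<le> 1" if "j \<in> U" "i \<in> {..<s}" for j i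
          using that U(1) block_index_less[of j b i s] by (intro P1) (auto simp: N_def)
      qed
      also have "\<dots> \<le> real b * (real s * (\<epsilon> / 2)) + real k * real s"
        using U \<epsilon> by (auto simp: card_Diff_subset intro!: mult_right_mono)
      also have "\<dots> \<le> real b * (real s * (\<epsilon> / 2)) + \<epsilon> * real b / 4 * real s"
        using k by (intro add_left_mono mult_right_mono) auto
      also have "\<dots> = 3 / 4 * (\<epsilon> * real N)" by (simp add: N_def field_simps)
      finally have "real N - real (card C') \<le> 3 / 4 * (\<epsilon> * real N)" using tr by linarith
      then have "7 / 8 * (\<epsilon> * real N) \<le> 3 / 4 * (\<epsilon> * real N)"
        using cardC' by (simp add: algebra_simps)
      moreover have "0 < \<epsilon> * real N" using \<epsilon> Npos by simp
      ultimately show False by linarith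
    qed
    then obtain j0 i0 where j0: "j0 < b" "j0 \<notin> U" and i0: "i0 < s"
      and big: "\<epsilon> / 2 \<le> P (j0 * s + i0) (j0 * s + i0)" by blast
    define l0 where "l0 = j0 * s + i0"
    have l0: "l0 < N" using j0 i0 block_index_less[of j0 b i0 s] by (simp add: l0_def N_def)
    define v where "v = (\<lambda>l. P l l0)"
    \<comment> \<open>The part of the change of \<open>\<langle>x, z\<rangle> - \<parallel>z\<parallel>\<^sup>2 / 2\<close> that is odd in the sign.\<close>
    define lin where "lin = z l0 + (\<Sum>l<N. x l * v l) - (\<Sum>l<N. z l * v l)"
    define \<sigma> where "\<sigma> = (if 0 \<le> lin then 1 else - 1 :: real)"
    have \<sigma>: "\<sigma> * \<sigma> = 1" "\<bar>\<sigma>\<bar> = 1" "0 \<le> \<sigma> * lin" by (auto simp: \<sigma>_def)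
    define x' where "x' = (\<lambda>l. x l + \<sigma> * (if l = l0 then 1 else 0))"
    define z' where "z' = (\<lambda>l. z l + \<sigma> * v l)"
    have vnorm: "(\<Sum>l<N. (v l)\<^sup>2) = v l0" unfolding v_def by (rule orth_proj_row[OF P])
    have xz: "(\<Sum>l<N. x' l * z' l) = (\<Sum>l<N. x l * z l) + \<sigma> * (z l0 + (\<Sum>l<N. x l * v l)) + v l0"
    proof -
      have "(\<Sum>l<N. x' l * z' l) = (\<Sum>l<N. x l * z l + \<sigma> * (x l * v l)
          + (if l = l0 then \<sigma> * z l + \<sigma> * \<sigma> * v l else 0))"
        by (rule sum.cong) (auto simp: x'_def z'_def algebra_simps)
      then show ?thesis using l0 \<sigma>(1)
        by (simp add: sum.distrib algebra_simps flip: sum_distrib_left)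
    qed
    have zz: "(\<Sum>l<N. (z' l)\<^sup>2) = (\<Sum>l<N. (z l)\<^sup>2) + 2 * \<sigma> * (\<Sum>l<N. z l * v l) + v l0"
    proof -
      have "(\<Sum>l<N. (z' l)\<^sup>2) = (\<Sum>l<N. (z l)\<^sup>2 + 2 * \<sigma> * (z l * v l) + \<sigma> * \<sigma> * (v l)\<^sup>2)"
        by (rule sum.cong) (auto simp: z'_def algebra_simps power2_eq_square)
      then show ?thesis using \<sigma>(1) vnorm
        by (simp add: sum.distrib flip: sum_distrib_left)
    qed
    have "real (Suc k) * (\<epsilon> / 4) = real k * (\<epsilon> / 4) + \<epsilon> / 4" by (simp add: algebra_simps)
    also have "\<dots> \<le> (\<Sum>l<N. x l * z l) - (\<Sum>l<N. (z l)\<^sup>2) / 2 + \<sigma> * lin + v l0 / 2"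
    proof -
      have "\<epsilon> / 2 \<le> v l0" using big by (simp add: v_def l0_def)
      then show ?thesis using st' \<sigma>(3) by linarith
    qed
    also have "\<dots> = (\<Sum>l<N. x' l * z' l) - (\<Sum>l<N. (z' l)\<^sup>2) / 2"
      unfolding xz zz lin_def by (simp add: field_simps)
    finally have pot: "real (Suc k) * (\<epsilon> / 4) \<le> (\<Sum>l<N. x' l * z' l) - (\<Sum>l<N. (z' l)\<^sup>2) / 2" .
    have x'_block: "(\<Sum>i<s. \<bar>x' (j * s + i)\<bar>) \<le> (if j \<in> insert j0 U then 1 else 0)" if "j < b" for j
    proof -
      have old: "(\<Sum>i<s. \<bar>x (j * s + i)\<bar>) \<le> (if j \<in> U then 1 else 0)" using st' that by blast
      have inj: "j * s + i = l0 \<longleftrightarrow> j = j0 \<and> i = i0" if "i < s" for i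
      proof
        assume *: "j * s + i = l0"
        then have "(j * s + i) div s = (j0 * s + i0) div s" "(j * s + i) mod s = (j0 * s + i0) mod s"
          by (simp_all add: l0_def)
        then show "j = j0 \<and> i = i0" using that i0 by simp
      qed (simp add: l0_def)
      have "(\<Sum>i<s. \<bar>x' (j * s + i)\<bar>)
          \<le> (\<Sum>i<s. \<bar>x (j * s + i)\<bar> + (if i = i0 then if j = j0 then 1 else 0 else 0))"
        by (rule sum_mono) (use inj \<sigma>(2) in \<open>auto simp: x'_def intro: order_trans[OF abs_triangle_ineq]\<close>)
      also have "\<dots> = (\<Sum>i<s. \<bar>x (j * s + i)\<bar>) + (if j = j0 then 1 else 0)"
        using i0 by (simp add: sum.distrib)
      finally show ?thesis using old j0 by (cases "j = j0") auto
    qed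
    have z'_block: "(\<Sum>i<s. (z' (j * s + i))\<^sup>2) \<le> 4" if "j < b" for j
    proof (cases "j \<in> F")
      case True
      then have "(\<Sum>i<s. (z' (j * s + i))\<^sup>2) = (\<Sum>i<s. (z (j * s + i))\<^sup>2)"
        by (intro sum.cong) (auto simp: z'_def v_def frozen)
      then show ?thesis using st' that by simp
    next
      case False
      have "(\<Sum>i<s. (z' (j * s + i))\<^sup>2) \<le> (\<Sum>i<s. 2 * (z (j * s + i))\<^sup>2 + 2 * (v (j * s + i))\<^sup>2)"
      proof (rule sum_mono)
        fix i
        have "2 * (z (j * s + i))\<^sup>2 + 2 * (\<sigma> * v (j * s + i))\<^sup>2 - (z' (j * s + i))\<^sup>2
            = (z (j * s + i) - \<sigma> * v (j * s + i))\<^sup>2"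
          by (simp add: z'_def power2_eq_square algebra_simps)
        moreover have "(\<sigma> * v (j * s + i))\<^sup>2 = (v (j * s + i))\<^sup>2"
          using \<sigma>(1) by (simp add: power_mult_distrib power2_eq_square)
        ultimately show "(z' (j * s + i))\<^sup>2 \<le> 2 * (z (j * s + i))\<^sup>2 + 2 * (v (j * s + i))\<^sup>2"
          by (metis diff_ge_0_iff_ge zero_le_power2)
      qed
      also have "\<dots> = 2 * (\<Sum>i<s. (z (j * s + i))\<^sup>2) + 2 * (\<Sum>i<s. (v (j * s + i))\<^sup>2)"
        by (simp add: sum.distrib sum_distrib_left)
      also have "\<dots> \<le> 2 * 1 + 2 * 1"
      proof (intro add_mono mult_left_mono)
        show "(\<Sum>i<s. (z (j * s + i))\<^sup>2) \<le> 1" using False that by (simp add: F_def)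
        have "(\<Sum>i<s. (v (j * s + i))\<^sup>2) \<le> (\<Sum>j<b. \<Sum>i<s. (v (j * s + i))\<^sup>2)"
          using that by (intro member_le_sum) (auto intro: sum_nonneg)
        also have "\<dots> = v l0" using vnorm by (simp add: N_def sum_blocks)
        also have "\<dots> \<le> 1" using P1[OF l0] by (simp add: v_def)
        finally show "(\<Sum>i<s. (v (j * s + i))\<^sup>2) \<le> 1" .
      qed auto
      finally show ?thesis by simp
    qed
    have "(\<Sum>l<N. c l * z' l) = 0" if "c \<in> C" for c
    proof -
      have "(\<Sum>l<N. c l * z' l) = (\<Sum>l<N. c l * z l) + \<sigma> * (\<Sum>l<N. c l * v l)"
        by (simp add: z'_def distrib_left sum.distrib sum_distrib_left mult_ac)
      then show ?thesis using st' orth[of c l0] that by (simp add: v_def C'_def)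
    qed
    then have "st (Suc k) x' z' (insert j0 U)"
      unfolding st_def using U j0 x'_block z'_block pot by auto
    then show ?thesis by blast
  qed
  have "\<exists>x z U. st k x z U" if "real k < \<epsilon> * real b / 4 + 1" for k
    using that
  proof (induction k)
    case 0
    have "st 0 (\<lambda>_. 0) (\<lambda>_. 0) {}" unfolding st_def by simp
    then show ?case by blast
  next
    case (Suc k)
    then show ?case using step[of k] by auto
  qed
  moreover define k where "k = nat \<lceil>\<epsilon> * real b / 4\<rceil>"
  moreover have "0 < \<epsilon> * real b / 4" using \<epsilon> pos by simp
  then have k: "\<epsilon> * real b / 4 \<le> real k" "real k < \<epsilon> * real b / 4 + 1"
    unfolding k_def by linarith+
  ultimately obtain x z U where st: "st k x z U" by blast
  have "\<epsilon>\<^sup>2 * real b / 16 = \<epsilon> * real b / 4 * (\<epsilon> / 4)" by (simp add: power2_eq_square)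
  also have "\<dots> \<le> real k * (\<epsilon> / 4)" using k \<epsilon> by (intro mult_right_mono) auto
  also have "\<dots> \<le> (\<Sum>l<N. x l * z l) - (\<Sum>l<N. (z l)\<^sup>2) / 2" using st unfolding st_def by blast
  also have "\<dots> \<le> (\<Sum>l<N. x l * z l)" by (simp add: sum_nonneg)
  finally show False using small[OF st] by simp
qed

section \<open>Projections of sign vectors\<close>

lemma cosh_le_exp_half_square: "cosh x \<le> exp (x\<^sup>2 / 2)" for x :: real
proof -
  have tanh_le: "tanh y \<le> y" if "0 \<le> y" for y :: real
  proof -
    have "0 - tanh 0 \<le> y - tanh y"
    proof (rule DERIV_nonneg_imp_nondecreasing[OF that])
      fix u :: real
      have "((\<lambda>u. u - tanh u) has_real_derivative 1 - (1 - (tanh u)\<^sup>2)) (at u)"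
        by (auto intro!: derivative_eq_intros simp: less_imp_neq[OF cosh_real_pos, symmetric])
      then show "\<exists>d. ((\<lambda>u. u - tanh u) has_real_derivative d) (at u) \<and> 0 \<le> d"
        by (intro exI conjI) auto
    qed
    then show ?thesis by simp
  qed
  have main: "cosh y \<le> exp (y\<^sup>2 / 2)" if "0 \<le> y" for y :: real
  proof -
    have "0\<^sup>2 / 2 - ln (cosh 0) \<le> y\<^sup>2 / 2 - ln (cosh y)"
    proof (rule DERIV_nonneg_imp_nondecreasing[OF that])
      fix u :: real assume "0 \<le> u"
      have "((\<lambda>u. u\<^sup>2 / 2 - ln (cosh u)) has_real_derivative u - tanh u) (at u)"
        by (auto intro!: derivative_eq_intros simp: tanh_def)
      then show "\<exists>d. ((\<lambda>u. u\<^sup>2 / 2 - ln (cosh u)) has_real_derivative d) (at u) \<and> 0 \<le> d"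
        using tanh_le[OF \<open>0 \<le> u\<close>] by (intro exI conjI) auto
    qed
    then have "ln (cosh y) \<le> y\<^sup>2 / 2" by simp
    then show ?thesis by (subst ln_le_cancel_iff [symmetric]) auto
  qed
  show ?thesis using main[of x] main[of "- x"] by (cases "0 \<le> x") auto
qed

lemma abs_powr_le_cosh:
  fixes u :: real assumes "0 < p" shows "\<bar>u\<bar> powr p \<le> 2 * p powr p * cosh u"
proof -
  have "\<bar>u\<bar> / p \<le> exp (\<bar>u\<bar> / p)" using exp_ge_add_one_self[of "\<bar>u\<bar> / p"] by linarith
  then have "\<bar>u\<bar> \<le> p * exp (\<bar>u\<bar> / p)" using assms by (simp add: field_simps)
  then have "\<bar>u\<bar> powr p \<le> (p * exp (\<bar>u\<bar> / p)) powr p" using assms by (intro powr_mono2) auto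
  also have "\<dots> = p powr p * exp \<bar>u\<bar>"
    using assms by (simp add: powr_mult exp_powr_real)
  also have "exp \<bar>u\<bar> \<le> 2 * cosh u"
    by (cases "0 \<le> u") (auto simp: cosh_field_def)
  finally show ?thesis using assms by (simp add: mult_left_mono)
qed

text \<open>
  For random signs on \<open>A\<close>, each coordinate of \<open>z = P x\<close> is a Rademacher sum with variance
  \<open>a m = \<Sum>k\<in>A. (P m k)\<^sup>2 \<le> 1\<close>, so its \<open>p\<close>-th moment is of order \<open>a m powr (p / 2) \<le> a m\<close>, while
  \<open>\<Sum>m. a m\<close> is the trace of \<open>P\<close> on \<open>A\<close>. Signs that control all coordinates at once and keep
  \<open>\<langle>x, z\<rangle>\<close> large are found by conditional expectations: the \<open>p\<close>-th powers are majorized by \<open>cosh\<close>,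
  for which averaging over one sign is exact.
\<close>

lemma projected_signs:
  assumes P: "orth_proj N P" and A: "A \<subseteq> {..<N}" and p: "2 \<le> p"
  shows "\<exists>x. (\<forall>l. \<bar>x l\<bar> \<le> (if l \<in> A then 1 else (0::real))) \<and>
    (\<Sum>l\<in>A. P l l) / 2 \<le> (\<Sum>l\<in>A. x l * (\<Sum>k\<in>A. P l k * x k)) \<and>
    (\<Sum>m<N. \<bar>\<Sum>k\<in>A. P m k * x k\<bar> powr p) \<le> 8 * p powr p * real (card A)"
proof -
  have finA: "finite A" using A finite_subset by blast
  define a where "a = (\<lambda>m. \<Sum>k\<in>A. (P m k)\<^sup>2)"
  have a0: "0 \<le> a m" for m unfolding a_def by (rule sum_nonneg) auto
  have a1: "a m \<le> 1" if "m < N" for m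
  proof -
    have "a m \<le> (\<Sum>k<N. (P m k)\<^sup>2)" unfolding a_def by (rule sum_mono2) (use A in auto)
    also have "\<dots> = P m m"
    proof -
      have "(\<Sum>k<N. (P m k)\<^sup>2) = (\<Sum>k<N. (P k m)\<^sup>2)"
        by (rule sum.cong, rule refl) (metis orth_proj_sym[OF P])
      then show ?thesis using orth_proj_row[OF P, of m] by simp
    qed
    finally show ?thesis using orth_proj_diag_le_1[OF P that] by simp
  qed
  have "(\<Sum>m<N. a m) = (\<Sum>k\<in>A. \<Sum>m<N. (P m k)\<^sup>2)"
    unfolding a_def by (rule sum.swap)
  then have suma: "(\<Sum>m<N. a m) = (\<Sum>k\<in>A. P k k)" by (simp add: orth_proj_row[OF P])
  define z where "z = (\<lambda>B x m. \<Sum>k\<in>B. P m k * x k)"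
  define E where "E = (\<lambda>B m. \<Sum>k\<in>B. (P m k)\<^sup>2 / (2 * a m))"
  \<comment> \<open>Once the signs on \<open>B\<close> are fixed, \<open>exp (- E B m)\<close> removes the variance already spent,
    so that averaging over the next sign does not increase \<open>G\<close>.\<close>
  define G where "G = (\<lambda>B x. \<Sum>m<N. a m * (cosh (z B x m / sqrt (a m)) * exp (- E B m)))"
  have "\<exists>x. (\<forall>l. \<bar>x l\<bar> \<le> (if l \<in> B then 1 else (0::real))) \<and>
      (\<Sum>l\<in>B. P l l) - (\<Sum>m<N. a m) / 2 \<le> (\<Sum>l\<in>B. x l * z B x l) - G B x / 2"
    if "B \<subseteq> A" for B
    using finite_subset[OF that finA] that
  proof (induction B rule: finite_induct)
    case empty
    then show ?case by (intro exI[of _ "\<lambda>_. 0"]) (simp add: z_def E_def G_def)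
  next
    case (insert l0 B)
    then obtain x where x: "\<And>l. \<bar>x l\<bar> \<le> (if l \<in> B then 1 else (0::real))"
      and pot: "(\<Sum>l\<in>B. P l l) - (\<Sum>m<N. a m) / 2 \<le> (\<Sum>l\<in>B. x l * z B x l) - G B x / 2"
      by auto
    have l0: "l0 \<in> A" "l0 \<notin> B" "finite B" using insert by auto
    define x' where "x' = (\<lambda>\<sigma>. x(l0 := \<sigma>))"
    have z': "z (insert l0 B) (x' \<sigma>) m = z B x m + \<sigma> * P m l0" for \<sigma> m
    proof -
      have "(\<Sum>k\<in>B. P m k * x' \<sigma> k) = (\<Sum>k\<in>B. P m k * x k)"
        by (rule sum.cong) (use l0 in \<open>auto simp: x'_def\<close>)
      then show ?thesis using l0 by (simp add: z_def x'_def)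
    qed
    have form: "(\<Sum>l\<in>insert l0 B. x' \<sigma> l * z (insert l0 B) (x' \<sigma>) l)
        = (\<Sum>l\<in>B. x l * z B x l) + 2 * \<sigma> * z B x l0 + \<sigma> * \<sigma> * P l0 l0" for \<sigma>
    proof -
      have "x' \<sigma> l0 = \<sigma>" by (simp add: x'_def)
      have "(\<Sum>l\<in>B. x' \<sigma> l * z (insert l0 B) (x' \<sigma>) l)
          = (\<Sum>l\<in>B. x l * z B x l + \<sigma> * (P l0 l * x l))"
      proof (rule sum.cong, rule refl)
        fix l assume "l \<in> B"
        then have "x' \<sigma> l = x l" using l0 by (auto simp: x'_def)
        then show "x' \<sigma> l * z (insert l0 B) (x' \<sigma>) l = x l * z B x l + \<sigma> * (P l0 l * x l)"
          using orth_proj_sym[OF P, of l0 l] by (simp add: z' algebra_simps)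
      qed
      also have "\<dots> = (\<Sum>l\<in>B. x l * z B x l) + \<sigma> * z B x l0"
        by (simp add: sum.distrib z_def sum_distrib_left)
      finally show ?thesis using l0 \<open>x' \<sigma> l0 = \<sigma>\<close> by (simp add: z' algebra_simps)
    qed
    \<comment> \<open>Averaging over the sign at \<open>l0\<close> multiplies \<open>cosh u\<close> by \<open>cosh d \<le> exp (d\<^sup>2 / 2)\<close>.\<close>
    have "G (insert l0 B) (x' 1) + G (insert l0 B) (x' (-1)) \<le> 2 * G B x"
      unfolding G_def sum.distrib [symmetric] sum_distrib_left
    proof (rule sum_mono)
      fix m
      show "a m * (cosh (z (insert l0 B) (x' 1) m / sqrt (a m)) * exp (- E (insert l0 B) m))
          + a m * (cosh (z (insert l0 B) (x' (-1)) m / sqrt (a m)) * exp (- E (insert l0 B) m))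
          \<le> 2 * (a m * (cosh (z B x m / sqrt (a m)) * exp (- E B m)))"
      proof (cases "a m = 0")
        case False
        define u where "u = z B x m / sqrt (a m)"
        define d where "d = P m l0 / sqrt (a m)"
        have d2: "d\<^sup>2 / 2 = (P m l0)\<^sup>2 / (2 * a m)"
          using a0[of m] by (simp add: d_def power_divide)
        have E: "E (insert l0 B) m = E B m + d\<^sup>2 / 2" using l0 by (simp add: E_def d2)
        have "cosh (u + d) + cosh (u - d) = 2 * cosh u * cosh d"
          by (simp add: cosh_add cosh_diff)
        also have "\<dots> \<le> 2 * cosh u * exp (d\<^sup>2 / 2)"
          by (intro mult_left_mono cosh_le_exp_half_square) (simp add: less_imp_le)
        finally have "(cosh (u + d) + cosh (u - d)) * exp (- (d\<^sup>2 / 2)) \<le> 2 * cosh u"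
          by (simp add: exp_minus field_simps)
        then have "a m * exp (- E B m) * ((cosh (u + d) + cosh (u - d)) * exp (- (d\<^sup>2 / 2)))
            \<le> a m * exp (- E B m) * (2 * cosh u)"
          using a0[of m] by (intro mult_left_mono) auto
        moreover have e1: "exp (- E (insert l0 B) m) = exp (- E B m) * exp (- (d\<^sup>2 / 2))"
          by (simp add: E flip: exp_add)
        moreover have e2: "z (insert l0 B) (x' 1) m / sqrt (a m) = u + d"
          and e3: "z (insert l0 B) (x' (-1)) m / sqrt (a m) = u - d"
          by (simp_all add: z' u_def d_def add_divide_distrib diff_divide_distrib)
        ultimately show ?thesis
          unfolding e1 e2 e3 u_def [symmetric] by (simp add: algebra_simps)
      qed simp
    qed
    then have "G (insert l0 B) (x' 1) - 4 * 1 * z B x l0 \<le> G B x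
        \<or> G (insert l0 B) (x' (-1)) - 4 * (-1) * z B x l0 \<le> G B x"
      by linarith
    then obtain \<sigma> :: real where \<sigma>: "\<sigma> = 1 \<or> \<sigma> = -1"
      and G: "G (insert l0 B) (x' \<sigma>) - 4 * \<sigma> * z B x l0 \<le> G B x" by metis
    have "\<sigma> * \<sigma> = 1" using \<sigma> by auto
    then have "(\<Sum>l\<in>insert l0 B. P l l) - (\<Sum>m<N. a m) / 2
        \<le> (\<Sum>l\<in>insert l0 B. x' \<sigma> l * z (insert l0 B) (x' \<sigma>) l) - G (insert l0 B) (x' \<sigma>) / 2"
      unfolding form using pot G l0 by simp
    moreover have "\<bar>x' \<sigma> l\<bar> \<le> (if l \<in> insert l0 B then 1 else 0)" for l
      using x[of l] \<sigma> by (auto simp: x'_def)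
    ultimately show ?case by blast
  qed
  then obtain x where x: "\<And>l. \<bar>x l\<bar> \<le> (if l \<in> A then 1 else (0::real))"
    and pot: "(\<Sum>l\<in>A. P l l) - (\<Sum>m<N. a m) / 2 \<le> (\<Sum>l\<in>A. x l * z A x l) - G A x / 2"
    by blast
  define T where "T = (\<Sum>l\<in>A. x l * z A x l)"
  have G0: "0 \<le> G A x" unfolding G_def using a0 by (intro sum_nonneg mult_nonneg_nonneg) (auto simp: less_imp_le)
  have tr0: "0 \<le> (\<Sum>l\<in>A. P l l)" by (intro sum_nonneg orth_proj_diag_nonneg[OF P])
  have T_lower: "(\<Sum>l\<in>A. P l l) / 2 \<le> T" using pot G0 by (simp add: T_def suma)
  have GT: "G A x \<le> 2 * T" using pot tr0 by (simp add: T_def suma)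
  have "(\<Sum>m<N. (z A x m)\<^sup>2) = T"
  proof -
    have "(\<Sum>m<N. (z A x m)\<^sup>2) = (\<Sum>m<N. \<Sum>l\<in>A. \<Sum>k\<in>A. x l * x k * (P l m * P m k))"
    proof (rule sum.cong, rule refl)
      fix m
      have "(z A x m)\<^sup>2 = (\<Sum>l\<in>A. P l m * x l) * (\<Sum>k\<in>A. P m k * x k)"
        unfolding z_def power2_eq_square by (subst (1) orth_proj_sym[OF P]) (rule refl)
      then show "(z A x m)\<^sup>2 = (\<Sum>l\<in>A. \<Sum>k\<in>A. x l * x k * (P l m * P m k))"
        by (simp add: sum_product mult_ac)
    qed
    also have "\<dots> = (\<Sum>l\<in>A. \<Sum>k\<in>A. \<Sum>m<N. x l * x k * (P l m * P m k))"
      by (subst sum.swap, rule sum.cong, rule refl, subst sum.swap) simp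
    also have "\<dots> = (\<Sum>l\<in>A. \<Sum>k\<in>A. x l * x k * P l k)"
    proof -
      have "(\<Sum>m<N. P l m * P m k) = P l k" for l k using P unfolding orth_proj_def by blast
      then show ?thesis by (simp flip: sum_distrib_left)
    qed
    also have "\<dots> = T" by (simp add: T_def z_def sum_distrib_left mult_ac)
    finally show ?thesis .
  qed
  moreover have "2 * T \<le> (\<Sum>l\<in>A. (x l)\<^sup>2 + (z A x l)\<^sup>2)"
    unfolding T_def sum_distrib_left
  proof (rule sum_mono)
    fix l show "2 * (x l * z A x l) \<le> (x l)\<^sup>2 + (z A x l)\<^sup>2"
      using sum_squares_bound[of "x l" "z A x l"] by simp
  qed
  moreover have "(\<Sum>l\<in>A. (z A x l)\<^sup>2) \<le> (\<Sum>m<N. (z A x m)\<^sup>2)"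
    using A by (intro sum_mono2) auto
  moreover have "(\<Sum>l\<in>A. (x l)\<^sup>2) \<le> (\<Sum>l\<in>A. 1)"
  proof (rule sum_mono)
    fix l assume "l \<in> A"
    then show "(x l)\<^sup>2 \<le> 1" using x[of l] by (simp add: abs_square_le_1)
  qed
  ultimately have T_upper: "T \<le> real (card A)" by (simp add: sum.distrib)
  have "(\<Sum>m<N. \<bar>z A x m\<bar> powr p) \<le> (\<Sum>m<N. 2 * p powr p * 2 * (a m * (cosh (z A x m / sqrt (a m)) * exp (- E A m))))"
  proof (rule sum_mono)
    fix m assume m: "m \<in> {..<N}"
    show "\<bar>z A x m\<bar> powr p \<le> 2 * p powr p * 2 * (a m * (cosh (z A x m / sqrt (a m)) * exp (- E A m)))"
    proof (cases "a m = 0")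
      case True
      then have "\<forall>k\<in>A. P m k = 0" using finA by (simp add: a_def sum_nonneg_eq_0_iff)
      then show ?thesis by (simp add: z_def True)
    next
      case False
      then have am: "0 < a m" using a0[of m] by simp
      define u where "u = z A x m / sqrt (a m)"
      have EA: "E A m = 1 / 2"
        using am by (simp add: E_def a_def flip: sum_divide_distrib)
      have "exp (1 / 2) \<le> (2::real)"
        using exp_half_le2 by simp
      then have "1 \<le> 2 * exp (- (1 / 2 :: real))" by (simp add: exp_minus field_simps)
      then have half: "1 \<le> 2 * exp (- E A m)" by (simp only: EA)
      have "\<bar>z A x m\<bar> = sqrt (a m) * \<bar>u\<bar>" using am by (simp add: u_def)
      moreover have "sqrt (a m) = a m powr (1 / 2)" using am by (simp add: powr_half_sqrt)
      ultimately have "\<bar>z A x m\<bar> powr p = a m powr (p / 2) * \<bar>u\<bar> powr p"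
        by (simp only: powr_mult powr_powr) simp
      also have "\<dots> \<le> a m * (2 * p powr p * cosh u)"
      proof (rule mult_mono)
        have "a m powr (p / 2) \<le> a m powr 1"
          using am a1[of m] m p by (intro powr_mono') auto
        then show "a m powr (p / 2) \<le> a m" using am by simp
      qed (use abs_powr_le_cosh p am in auto)
      also have "\<dots> \<le> a m * (2 * p powr p * cosh u) * (2 * exp (- E A m))"
        using mult_left_mono[OF half, of "a m * (2 * p powr p * cosh u)"] am
        by (simp add: mult_nonneg_nonneg less_imp_le)
      finally show ?thesis by (simp add: u_def mult_ac)
    qed
  qed
  also have "\<dots> = 4 * p powr p * G A x" by (simp add: G_def sum_distrib_left)
  also have "\<dots> \<le> 4 * p powr p * (2 * real (card A))"
    using GT T_upper by (intro mult_left_mono) auto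
  finally have "(\<Sum>m<N. \<bar>z A x m\<bar> powr p) \<le> 8 * p powr p * real (card A)" by simp
  then show ?thesis using x T_lower unfolding T_def z_def by (intro exI[of _ x] conjI allI)
qed

section \<open>Lower bounds by duality\<close>

text \<open>The dual certificate that yields \<open>D\<close> as a lower bound for the \<open>n\<close>-th width.\<close>

definition dual_bound :: "nat \<Rightarrow> ereal \<Rightarrow> ereal \<Rightarrow> ereal \<Rightarrow> ereal \<Rightarrow> nat \<Rightarrow> nat \<Rightarrow> real \<Rightarrow> bool" where
  "dual_bound n p1 p2 q1 q2 s b D \<longleftrightarrow> (\<forall>C. finite C \<longrightarrow> card C \<le> n \<longrightarrow> (\<exists>X Z. block_norm p1 p2 s b X \<le> 1 \<and>
      (\<forall>c\<in>C. (\<Sum>j<b. \<Sum>i<s. c (j * s + i) * Z j i) = 0) \<and>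
      D \<le> (\<Sum>j<b. \<Sum>i<s. X j i * Z j i) \<and>
      (\<forall>W. (\<Sum>j<b. \<Sum>i<s. W j i * Z j i) \<le> block_norm q1 q2 s b W)))"

lemma dual_bound_width:
  "0 < s \<Longrightarrow> 0 < b \<Longrightarrow> dual_bound n p1 p2 q1 q2 s b D \<Longrightarrow> ennreal D \<le> mixed_width n p1 p2 q1 q2 s b"
  unfolding dual_bound_def by (rule mixed_width_ge) blast+

lemma norm_ratio_pos: "0 < m \<Longrightarrow> 0 < norm_ratio q p m"
  by (simp add: norm_ratio_def)

text \<open>
  Scaling \<open>X\<close> into the \<open>p\<close>-ball and \<open>Z\<close> into the dual \<open>q\<close>-ball costs exactly the norm ratios. For the
  extremal tuples these ratios combine to \<open>d_0\<close> without loss.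
\<close>

lemma dual_bound_change_exponents:
  assumes db: "dual_bound n u1 u2 r1 r2 s b D" and pos: "0 < s" "0 < b"
    and e: "1 \<le> u1" "1 \<le> u2" "1 \<le> r1" "1 \<le> r2" "1 \<le> p1" "1 \<le> p2" "1 \<le> q1" "1 \<le> q2"
  shows "dual_bound n p1 p2 q1 q2 s b
    (D / (norm_ratio p1 u1 s * norm_ratio p2 u2 b * (norm_ratio r1 q1 s * norm_ratio r2 q2 b)))"
  unfolding dual_bound_def
proof (intro allI impI)
  fix C :: "(nat \<Rightarrow> real) set" assume "finite C" "card C \<le> n"
  then have "\<exists>X Z. block_norm u1 u2 s b X \<le> 1 \<and>
      (\<forall>c\<in>C. (\<Sum>j<b. \<Sum>i<s. c (j * s + i) * Z j i) = 0) \<and>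
      D \<le> (\<Sum>j<b. \<Sum>i<s. X j i * Z j i) \<and>
      (\<forall>W. (\<Sum>j<b. \<Sum>i<s. W j i * Z j i) \<le> block_norm r1 r2 s b W)"
    by (rule db[unfolded dual_bound_def, rule_format])
  then obtain X Z where XZ: "block_norm u1 u2 s b X \<le> 1 \<and>
      (\<forall>c\<in>C. (\<Sum>j<b. \<Sum>i<s. c (j * s + i) * Z j i) = 0) \<and>
      D \<le> (\<Sum>j<b. \<Sum>i<s. X j i * Z j i) \<and>
      (\<forall>W. (\<Sum>j<b. \<Sum>i<s. W j i * Z j i) \<le> block_norm r1 r2 s b W)"
    by (elim exE) (rule that)
  note X = XZ[THEN conjunct1] and D = XZ[THEN conjunct2, THEN conjunct2, THEN conjunct1]
  note C = XZ[THEN conjunct2, THEN conjunct1, rule_format]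
    and W = XZ[THEN conjunct2, THEN conjunct2, THEN conjunct2, rule_format]
  define \<alpha> where "\<alpha> = norm_ratio p1 u1 s * norm_ratio p2 u2 b"
  define \<beta> where "\<beta> = norm_ratio r1 q1 s * norm_ratio r2 q2 b"
  have ab: "0 < \<alpha>" "0 < \<beta>" using pos by (simp_all add: \<alpha>_def \<beta>_def norm_ratio_pos)
  let ?X = "\<lambda>j i. 1 / \<alpha> * X j i" and ?Z = "\<lambda>j i. 1 / \<beta> * Z j i"
  have "block_norm p1 p2 s b X \<le> \<alpha> * block_norm u1 u2 s b X"
    unfolding \<alpha>_def using e pos by (intro block_norm_le_norm_ratio)
  also have "\<dots> \<le> \<alpha> * 1" using X ab by (intro mult_left_mono) auto
  finally have m1: "block_norm p1 p2 s b ?X \<le> 1"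
    using ab e pos by (subst block_norm_scale) (auto simp: divide_le_eq)
  have m2: "(\<Sum>j<b. \<Sum>i<s. c (j * s + i) * ?Z j i) = 0" if "c \<in> C" for c
  proof -
    have "(\<Sum>j<b. \<Sum>i<s. c (j * s + i) * ?Z j i) = (\<Sum>j<b. \<Sum>i<s. c (j * s + i) * Z j i) / \<beta>"
      by (simp add: sum_divide_distrib)
    then show ?thesis using C[OF that] by simp
  qed
  have m3: "D / (\<alpha> * \<beta>) \<le> (\<Sum>j<b. \<Sum>i<s. ?X j i * ?Z j i)"
  proof -
    have "(\<Sum>j<b. \<Sum>i<s. ?X j i * ?Z j i) = (\<Sum>j<b. \<Sum>i<s. X j i * Z j i) / (\<alpha> * \<beta>)"
      by (simp add: sum_divide_distrib)
    then show ?thesis using D ab by (simp add: divide_right_mono)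
  qed
  have m4: "(\<Sum>j<b. \<Sum>i<s. V j i * ?Z j i) \<le> block_norm q1 q2 s b V" for V
  proof -
    have "(\<Sum>j<b. \<Sum>i<s. V j i * Z j i) \<le> \<beta> * block_norm q1 q2 s b V"
      using W[of V] block_norm_le_norm_ratio[of q1 q2 r1 r2 s b V] e pos by (simp add: \<beta>_def)
    then have "(\<Sum>j<b. \<Sum>i<s. V j i * Z j i) / \<beta> \<le> block_norm q1 q2 s b V"
      using ab by (simp add: divide_le_eq mult.commute)
    moreover have "(\<Sum>j<b. \<Sum>i<s. V j i * ?Z j i) = (\<Sum>j<b. \<Sum>i<s. V j i * Z j i) / \<beta>"
      by (simp add: sum_divide_distrib)
    ultimately show ?thesis by simp
  qed
  have "block_norm p1 p2 s b ?X \<le> 1 \<and>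
      (\<forall>c\<in>C. (\<Sum>j<b. \<Sum>i<s. c (j * s + i) * ?Z j i) = 0) \<and>
      D / (\<alpha> * \<beta>) \<le> (\<Sum>j<b. \<Sum>i<s. ?X j i * ?Z j i) \<and>
      (\<forall>W. (\<Sum>j<b. \<Sum>i<s. W j i * ?Z j i) \<le> block_norm q1 q2 s b W)"
    using m1 m2 m3 m4 by (intro conjI ballI allI)
  then show "\<exists>X Z. block_norm p1 p2 s b X \<le> 1 \<and>
      (\<forall>c\<in>C. (\<Sum>j<b. \<Sum>i<s. c (j * s + i) * Z j i) = 0) \<and>
      D / (norm_ratio p1 u1 s * norm_ratio p2 u2 b * (norm_ratio r1 q1 s * norm_ratio r2 q2 b))
        \<le> (\<Sum>j<b. \<Sum>i<s. X j i * Z j i) \<and>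
      (\<forall>W. (\<Sum>j<b. \<Sum>i<s. W j i * Z j i) \<le> block_norm q1 q2 s b W)"
    unfolding \<alpha>_def [symmetric] \<beta>_def [symmetric] by (intro exI)
qed

lemma dual_boundI:
  assumes pos: "0 < s"
    and ex: "\<And>C. finite C \<Longrightarrow> card C \<le> n \<Longrightarrow> \<exists>x z. block_norm p1 p2 s b (\<lambda>j i. x (j * s + i)) \<le> 1 \<and>
      (\<forall>c\<in>C. (\<Sum>l<s * b. c l * z l) = 0) \<and> D \<le> (\<Sum>l<s * b. x l * z l) \<and>
      (\<forall>W. (\<Sum>j<b. \<Sum>i<s. W j i * z (j * s + i)) \<le> block_norm q1 q2 s b W)"
  shows "dual_bound n p1 p2 q1 q2 s b D"
  unfolding dual_bound_def
proof (intro allI impI)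
  fix C :: "(nat \<Rightarrow> real) set" assume "finite C" "card C \<le> n"
  then obtain x z where "block_norm p1 p2 s b (\<lambda>j i. x (j * s + i)) \<le> 1"
    "\<forall>c\<in>C. (\<Sum>l<s * b. c l * z l) = 0" "D \<le> (\<Sum>l<s * b. x l * z l)"
    "\<forall>W. (\<Sum>j<b. \<Sum>i<s. W j i * z (j * s + i)) \<le> block_norm q1 q2 s b W"
    using ex by blast
  then show "\<exists>X Z. block_norm p1 p2 s b X \<le> 1 \<and>
      (\<forall>c\<in>C. (\<Sum>j<b. \<Sum>i<s. c (j * s + i) * Z j i) = 0) \<and>
      D \<le> (\<Sum>j<b. \<Sum>i<s. X j i * Z j i) \<and>
      (\<forall>W. (\<Sum>j<b. \<Sum>i<s. W j i * Z j i) \<le> block_norm q1 q2 s b W)"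
    unfolding sum_blocks
    by (intro exI[of _ "\<lambda>j i. x (j * s + i)"] exI[of _ "\<lambda>j i. z (j * s + i)"] conjI)
qed


lemma recip_1 [simp]: "recip 1 = 1"
  by (simp add: recip_def)

lemma norm_ratio_factor:
  assumes "1 \<le> r" "r \<le> q" "q \<le> p" "0 < m"
  shows "real m powr recip r / (norm_ratio p \<infinity> m * norm_ratio r q m) = norm_ratio q p m"
proof -
  have "1 \<le> q" "1 \<le> p" using assms by (meson order_trans)+
  then show ?thesis
    using assms by (simp add: norm_ratio_eq_powr powr_diff)
qed

lemma block_norm_Holder:
  assumes "1 < p" "1 < q" "1 / p + 1 / q = 1"
  shows "(\<Sum>j<b. \<Sum>i<s. X j i * Y j i)
    \<le> block_norm (ereal p) (ereal p) s b X * block_norm (ereal q) (ereal q) s b Y"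
proof -
  have "(\<Sum>j<b. \<Sum>i<s. X j i * Y j i)
      \<le> (\<Sum>j<b. lq_norm (ereal p) s (X j) * lq_norm (ereal q) s (Y j))"
    by (intro sum_mono lq_norm_Holder assms)
  also have "\<dots> \<le> block_norm (ereal p) (ereal p) s b X * block_norm (ereal q) (ereal q) s b Y"
    unfolding block_norm_def by (rule lq_norm_Holder[OF assms])
  finally show ?thesis .
qed

lemma block_norm_same_powr:
  assumes "1 \<le> p" "0 < s"
  shows "block_norm (ereal p) (ereal p) s b (\<lambda>j i. z (j * s + i)) powr p = (\<Sum>l<s * b. \<bar>z l\<bar> powr p)"
proof -
  have "block_norm (ereal p) (ereal p) s b (\<lambda>j i. z (j * s + i)) powr p
      = (\<Sum>j<b. lq_norm (ereal p) s (\<lambda>i. z (j * s + i)) powr p)"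
    unfolding block_norm_def using assms by (subst lq_norm_powr) (simp_all add: lq_norm_nonneg)
  also have "\<dots> = (\<Sum>l<s * b. \<bar>z l\<bar> powr p)"
    unfolding sum_blocks using assms by (subst lq_norm_powr) auto
  finally show ?thesis .
qed

lemma block_norm_11: "block_norm 1 1 s b F = (\<Sum>j<b. \<Sum>i<s. \<bar>F j i\<bar>)"
  by (simp add: block_norm_def lq_norm_1 sum_nonneg)

text \<open>The case of blocks of size 1 in \<open>signed_projection_sum\<close>, with \<open>s * b\<close> blocks.\<close>

lemma dual_bound_cube:
  assumes pos: "0 < s" "0 < b" and \<epsilon>: "0 < \<epsilon>" and n: "real n \<le> real (s * b) * (1 - \<epsilon>)"
  shows "dual_bound n \<infinity> \<infinity> 1 1 s b (\<epsilon>\<^sup>2 / 32 * real (s * b))"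
proof (rule dual_boundI[OF pos(1)])
  fix C :: "(nat \<Rightarrow> real) set" assume C: "finite C" "card C \<le> n"
  have "real (card C) \<le> real (1 * (s * b)) * (1 - \<epsilon>)" using C(2) n by simp
  from signed_projection_sum[OF _ _ C(1) this \<epsilon>] pos
  obtain x z where x: "\<And>j. j < s * b \<Longrightarrow> \<bar>x j\<bar> \<le> (1::real)"
    and orth: "\<And>c. c \<in> C \<Longrightarrow> (\<Sum>l<s * b. c l * z l) = 0"
    and z: "\<And>j. j < s * b \<Longrightarrow> (z j)\<^sup>2 \<le> (4::real)"
    and D: "\<epsilon>\<^sup>2 * real (s * b) / 16 \<le> (\<Sum>l<s * b. x l * z l)"
    by (auto simp: lessThan_Suc)
  have z2: "\<bar>z l\<bar> \<le> 2" if "l < s * b" for l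
    using z[OF that] abs_le_square_iff[of "z l" 2] by simp
  have "block_norm \<infinity> \<infinity> s b (\<lambda>j i. x (j * s + i)) \<le> 1"
    unfolding block_norm_def using pos x block_index_less
    by (simp add: lq_norm_infinity_le_iff lq_norm_nonneg)
  moreover have "(\<Sum>l<s * b. c l * (z l / 2)) = 0" if "c \<in> C" for c
    using orth[OF that] by (simp flip: sum_divide_distrib)
  moreover have "\<epsilon>\<^sup>2 / 32 * real (s * b) \<le> (\<Sum>l<s * b. x l * (z l / 2))"
    using D by (simp add: mult_ac flip: sum_divide_distrib)
  moreover have "(\<Sum>j<b. \<Sum>i<s. W j i * (z (j * s + i) / 2)) \<le> block_norm 1 1 s b W" for W
    unfolding block_norm_11
  proof (intro sum_mono)
    fix j i assume "j \<in> {..<b}" "i \<in> {..<s}"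
    then have "\<bar>z (j * s + i) / 2\<bar> \<le> 1" using z2 block_index_less by simp
    then have "\<bar>W j i\<bar> * \<bar>z (j * s + i) / 2\<bar> \<le> \<bar>W j i\<bar> * 1" by (intro mult_left_mono) auto
    then show "W j i * (z (j * s + i) / 2) \<le> \<bar>W j i\<bar>"
      by (metis abs_ge_self abs_mult mult.right_neutral order_trans)
  qed
  ultimately show "\<exists>x z. block_norm \<infinity> \<infinity> s b (\<lambda>j i. x (j * s + i)) \<le> 1 \<and>
      (\<forall>c\<in>C. (\<Sum>l<s * b. c l * z l) = 0) \<and> \<epsilon>\<^sup>2 / 32 * real (s * b) \<le> (\<Sum>l<s * b. x l * z l) \<and>
      (\<forall>W. (\<Sum>j<b. \<Sum>i<s. W j i * z (j * s + i)) \<le> block_norm 1 1 s b W)"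
    by (intro exI[of _ x] exI[of _ "\<lambda>l. z l / 2"] conjI ballI allI)
qed

lemma dual_bound_octahedra:
  assumes pos: "0 < s" "0 < b" and \<epsilon>: "0 < \<epsilon>" and n: "real n \<le> real (s * b) * (1 - \<epsilon>)"
  shows "dual_bound n 1 \<infinity> 2 1 s b (\<epsilon>\<^sup>2 / 32 * real b)"
proof (rule dual_boundI[OF pos(1)])
  fix C :: "(nat \<Rightarrow> real) set" assume C: "finite C" "card C \<le> n"
  have "real (card C) \<le> real (s * b) * (1 - \<epsilon>)" using C(2) n by simp
  from signed_projection_sum[OF pos C(1) this \<epsilon>]
  obtain x z where x: "\<And>j. j < b \<Longrightarrow> (\<Sum>i<s. \<bar>x (j * s + i)\<bar>) \<le> (1::real)"
    and orth: "\<And>c. c \<in> C \<Longrightarrow> (\<Sum>l<s * b. c l * z l) = 0"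
    and z: "\<And>j. j < b \<Longrightarrow> (\<Sum>i<s. (z (j * s + i))\<^sup>2) \<le> (4::real)"
    and D: "\<epsilon>\<^sup>2 * real b / 16 \<le> (\<Sum>l<s * b. x l * z l)"
    by blast
  have "block_norm 1 \<infinity> s b (\<lambda>j i. x (j * s + i)) \<le> 1"
    unfolding block_norm_def using pos x
    by (simp add: lq_norm_infinity_le_iff lq_norm_1 sum_nonneg)
  moreover have "(\<Sum>l<s * b. c l * (z l / 2)) = 0" if "c \<in> C" for c
    using orth[OF that] by (simp flip: sum_divide_distrib)
  moreover have "\<epsilon>\<^sup>2 / 32 * real b \<le> (\<Sum>l<s * b. x l * (z l / 2))"
    using D by (simp add: mult_ac flip: sum_divide_distrib)
  moreover have "(\<Sum>j<b. \<Sum>i<s. W j i * (z (j * s + i) / 2)) \<le> block_norm 2 1 s b W" for W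
  proof -
    have "(\<Sum>j<b. \<Sum>i<s. W j i * (z (j * s + i) / 2)) \<le> (\<Sum>j<b. lq_norm 2 s (W j))"
    proof (rule sum_mono)
      fix j assume j: "j \<in> {..<b}"
      have "lq_norm 2 s (\<lambda>i. z (j * s + i)) \<le> 2"
        using z[of j] j real_sqrt_le_mono[of "\<Sum>i<s. (z (j * s + i))\<^sup>2" 4]
        unfolding lq_norm_2 by simp
      then have "lq_norm 2 s (W j) * lq_norm 2 s (\<lambda>i. z (j * s + i)) \<le> lq_norm 2 s (W j) * 2"
        using pos by (intro mult_left_mono lq_norm_nonneg) auto
      moreover have "(\<Sum>i<s. W j i * z (j * s + i)) \<le> lq_norm 2 s (W j) * lq_norm 2 s (\<lambda>i. z (j * s + i))"
        using lq_norm_Holder[of 2 2 "W j" "\<lambda>i. z (j * s + i)" s] by simp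
      ultimately show "(\<Sum>i<s. W j i * (z (j * s + i) / 2)) \<le> lq_norm 2 s (W j)"
        by (simp flip: sum_divide_distrib)
    qed
    then show ?thesis using pos by (simp add: block_norm_def lq_norm_1 lq_norm_nonneg)
  qed
  ultimately show "\<exists>x z. block_norm 1 \<infinity> s b (\<lambda>j i. x (j * s + i)) \<le> 1 \<and>
      (\<forall>c\<in>C. (\<Sum>l<s * b. c l * z l) = 0) \<and> \<epsilon>\<^sup>2 / 32 * real b \<le> (\<Sum>l<s * b. x l * z l) \<and>
      (\<forall>W. (\<Sum>j<b. \<Sum>i<s. W j i * z (j * s + i)) \<le> block_norm 2 1 s b W)"
    by (intro exI[of _ x] exI[of _ "\<lambda>l. z l / 2"] conjI ballI allI)
qed

lemma dual_bound_octahedron: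
  assumes pos: "0 < s" "0 < b" and \<epsilon>: "0 < \<epsilon>" and n: "real n \<le> real (s * b) * (1 - \<epsilon>)"
  shows "dual_bound n 1 1 2 2 s b \<epsilon>"
proof (rule dual_boundI[OF pos(1)])
  fix C :: "(nat \<Rightarrow> real) set" assume C: "finite C" "card C \<le> n"
  define N where "N = s * b"
  obtain P where P: "orth_proj N P" and orth: "\<And>c j. c \<in> C \<Longrightarrow> (\<Sum>i<N. c i * P i j) = 0"
    and tr: "real N - real (card C) \<le> (\<Sum>i<N. P i i)"
    using orth_proj_exists[OF C(1)] by blast
  have "\<exists>l<N. \<epsilon> \<le> P l l"
  proof (rule ccontr)
    assume "\<not> ?thesis"
    then have "(\<Sum>i<N. P i i) < (\<Sum>i<N. \<epsilon>)"
      using pos by (intro sum_strict_mono) (auto simp: N_def not_le lessThan_empty_iff)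
    moreover have "\<epsilon> * real N \<le> real N - real (card C)"
      using n C(2) by (simp add: N_def algebra_simps)
    ultimately show False using tr by (simp add: mult.commute)
  qed
  then obtain l where l: "l < N" "\<epsilon> \<le> P l l" by blast
  define x where "x = (\<lambda>k. if k = l then 1 else (0::real))"
  define z where "z = (\<lambda>k. P k l)"
  have "block_norm 1 1 s b (\<lambda>j i. x (j * s + i)) = (\<Sum>k<N. \<bar>x k\<bar>)"
    unfolding block_norm_11 N_def by (rule sum_blocks [symmetric])
  also have "\<dots> = (\<Sum>k<N. x k)" by (rule sum.cong) (auto simp: x_def)
  also have "\<dots> = 1" using l by (simp add: x_def)
  finally have "block_norm 1 1 s b (\<lambda>j i. x (j * s + i)) \<le> 1" by simp
  moreover have "(\<Sum>k<N. c k * z k) = 0" if "c \<in> C" for c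
    unfolding z_def by (rule orth[OF that])
  moreover have "(\<Sum>k<N. x k * z k) = (\<Sum>k<N. if k = l then z k else 0)"
    by (rule sum.cong) (auto simp: x_def)
  then have "\<epsilon> \<le> (\<Sum>k<N. x k * z k)" using l by (simp add: z_def)
  moreover have "(\<Sum>j<b. \<Sum>i<s. W j i * z (j * s + i)) \<le> block_norm 2 2 s b W" for W
  proof -
    have "block_norm (ereal 2) (ereal 2) s b (\<lambda>j i. z (j * s + i)) powr 2 = (\<Sum>k<N. \<bar>z k\<bar> powr 2)"
      unfolding N_def using pos by (intro block_norm_same_powr) auto
    also have "\<dots> = (\<Sum>k<N. (z k)\<^sup>2)" by (simp add: powr_numeral)
    also have "\<dots> \<le> 1"
      unfolding z_def using orth_proj_row[OF P, of l] orth_proj_diag_le_1[OF P l(1)] by simp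
    finally have "(block_norm (ereal 2) (ereal 2) s b (\<lambda>j i. z (j * s + i)))\<^sup>2 \<le> 1"
      using pos by (simp add: powr_numeral block_norm_nonneg)
    then have "block_norm (ereal 2) (ereal 2) s b (\<lambda>j i. z (j * s + i)) \<le> 1"
      using abs_square_le_1 abs_le_D1 by blast
    then have "block_norm (ereal 2) (ereal 2) s b W * block_norm (ereal 2) (ereal 2) s b (\<lambda>j i. z (j * s + i))
        \<le> block_norm (ereal 2) (ereal 2) s b W * 1"
      using pos by (intro mult_left_mono block_norm_nonneg) auto
    then show ?thesis
      using block_norm_Holder[of 2 2 W "\<lambda>j i. z (j * s + i)" s b] by simp
  qed
  ultimately show "\<exists>x z. block_norm 1 1 s b (\<lambda>j i. x (j * s + i)) \<le> 1 \<and>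
      (\<forall>c\<in>C. (\<Sum>l<s * b. c l * z l) = 0) \<and> \<epsilon> \<le> (\<Sum>l<s * b. x l * z l) \<and>
      (\<forall>W. (\<Sum>j<b. \<Sum>i<s. W j i * z (j * s + i)) \<le> block_norm 2 2 s b W)"
    unfolding N_def by (intro exI[of _ x] exI[of _ z] conjI ballI allI)
qed

text \<open>
  Some block carries its share \<open>\<epsilon> s\<close> of the trace, and the projected sign vector of that block is the
  certificate. Its norm is measured with the exponent conjugate to \<open>q\<close>, which is finite because
  \<open>q > 1\<close>.
\<close>

lemma dual_bound_one_cube:
  assumes pos: "0 < s" "0 < b" and \<epsilon>: "0 < \<epsilon>" and n: "real n \<le> real (s * b) * (1 - \<epsilon>)"
    and q: "1 < q" "q \<le> 2"
  shows "dual_bound n \<infinity> 1 (ereal q) (ereal q) s b (\<epsilon> / (16 * (q / (q - 1))) * real s powr (1 / q))"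
proof (rule dual_boundI[OF pos(1)])
  fix C :: "(nat \<Rightarrow> real) set" assume C: "finite C" "card C \<le> n"
  define p where "p = q / (q - 1)"
  have p: "2 \<le> p" "1 / q + 1 / p = 1" using q by (auto simp: p_def field_simps)
  define N where "N = s * b"
  obtain P where P: "orth_proj N P" and orth: "\<And>c j. c \<in> C \<Longrightarrow> (\<Sum>i<N. c i * P i j) = 0"
    and tr: "real N - real (card C) \<le> (\<Sum>i<N. P i i)"
    using orth_proj_exists[OF C(1)] by blast
  have "\<exists>j<b. \<epsilon> * real s \<le> (\<Sum>i<s. P (j * s + i) (j * s + i))"
  proof (rule ccontr)
    assume "\<not> ?thesis"
    then have "(\<Sum>j<b. \<Sum>i<s. P (j * s + i) (j * s + i)) < (\<Sum>j<b. \<epsilon> * real s)"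
      using pos by (intro sum_strict_mono) (auto simp: not_le)
    moreover have "\<epsilon> * real N \<le> real N - real (card C)"
      using n C(2) by (simp add: N_def algebra_simps)
    moreover have "(\<Sum>j<b. \<epsilon> * real s) = \<epsilon> * real N" by (simp add: N_def)
    ultimately show False using tr sum_blocks[where f = "\<lambda>l. P l l" and s = s and b = b] unfolding N_def by linarith
  qed
  then obtain j0 where j0: "j0 < b" "\<epsilon> * real s \<le> (\<Sum>i<s. P (j0 * s + i) (j0 * s + i))" by blast
  define A where "A = (\<lambda>i. j0 * s + i) ` {..<s}"
  have A: "A \<subseteq> {..<N}" "finite A" using j0 block_index_less by (auto simp: A_def N_def)
  have inj: "inj_on (\<lambda>i. j0 * s + i) {..<s}" by (auto simp: inj_on_def)
  have cardA: "card A = s" unfolding A_def by (simp add: card_image[OF inj])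
  have trA: "(\<Sum>l\<in>A. P l l) = (\<Sum>i<s. P (j0 * s + i) (j0 * s + i))"
    unfolding A_def by (simp add: sum.reindex[OF inj])
  obtain x where x: "\<And>l. \<bar>x l\<bar> \<le> (if l \<in> A then 1 else (0::real))"
    and pair: "(\<Sum>l\<in>A. P l l) / 2 \<le> (\<Sum>l\<in>A. x l * (\<Sum>k\<in>A. P l k * x k))"
    and pow: "(\<Sum>m<N. \<bar>\<Sum>k\<in>A. P m k * x k\<bar> powr p) \<le> 8 * p powr p * real (card A)"
    using projected_signs[OF P A(1) p(1)] by blast
  define \<beta> where "\<beta> = 8 * p * real s powr (1 / p)"
  have \<beta>: "0 < \<beta>" using p pos by (simp add: \<beta>_def)
  define z0 where "z0 = (\<lambda>m. \<Sum>k\<in>A. P m k * x k)"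
  define z where "z = (\<lambda>m. z0 m / \<beta>)"
  have "block_norm \<infinity> 1 s b (\<lambda>j i. x (j * s + i)) \<le> (\<Sum>j<b. if j = j0 then 1 else 0)"
    unfolding block_norm_def lq_norm_1
  proof (rule sum_mono)
    fix j
    have "\<bar>x (j * s + i)\<bar> \<le> (if j = j0 then 1 else 0)" if "i < s" for i
    proof -
      have "j = j0" if "j * s + i = j0 * s + i'" "i' < s" for i'
      proof -
        have "(j * s + i) div s = (j0 * s + i') div s" using that by simp
        then show ?thesis using \<open>i < s\<close> \<open>i' < s\<close> by simp
      qed
      then have "j = j0" if "j * s + i \<in> A" using that by (auto simp: A_def)
      then show ?thesis using x[of "j * s + i"] by (auto split: if_splits)
    qed
    then show "\<bar>lq_norm \<infinity> s (\<lambda>i. x (j * s + i))\<bar> \<le> (if j = j0 then 1 else 0)"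
      using pos by (simp add: lq_norm_infinity_le_iff lq_norm_nonneg)
  qed
  also have "\<dots> = 1" using j0 by simp
  finally have "block_norm \<infinity> 1 s b (\<lambda>j i. x (j * s + i)) \<le> 1" .
  moreover have "(\<Sum>l<N. c l * z l) = 0" if "c \<in> C" for c
  proof -
    have "(\<Sum>l<N. c l * z0 l) = (\<Sum>k\<in>A. (\<Sum>l<N. c l * P l k) * x k)"
      unfolding z0_def sum_distrib_left sum_distrib_right mult.assoc by (rule sum.swap)
    also have "\<dots> = 0" using orth[OF that] by simp
    finally show ?thesis by (simp add: z_def flip: sum_divide_distrib)
  qed
  moreover have "\<epsilon> / (16 * p) * real s powr (1 / q) \<le> (\<Sum>l<N. x l * z l)"
  proof -
    have "\<epsilon> * real s / 2 \<le> (\<Sum>l\<in>A. x l * z0 l)" using pair j0(2) trA by (simp add: z0_def)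
    also have "\<dots> = (\<Sum>l<N. x l * z0 l)"
    proof (rule sum.mono_neutral_left)
      show "\<forall>l\<in>{..<N} - A. x l * z0 l = 0"
      proof
        fix l assume "l \<in> {..<N} - A"
        then show "x l * z0 l = 0" using x[of l] by simp
      qed
    qed (use A in auto)
    finally have "\<epsilon> * real s / 2 / \<beta> \<le> (\<Sum>l<N. x l * z0 l) / \<beta>"
      using \<beta> by (intro divide_right_mono) auto
    moreover have "real s powr (1 / q) * real s powr (1 / p) = real s"
      using p pos by (simp flip: powr_add)
    then have "\<epsilon> * real s / 2 / \<beta> = \<epsilon> / (16 * p) * real s powr (1 / q)"
      using p pos by (simp add: \<beta>_def field_simps)
    ultimately show ?thesis by (simp add: z_def sum_divide_distrib)
  qed
  moreover have "(\<Sum>j<b. \<Sum>i<s. W j i * z (j * s + i)) \<le> block_norm (ereal q) (ereal q) s b W" for W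
  proof -
    define M where "M = block_norm (ereal p) (ereal p) s b (\<lambda>j i. z0 (j * s + i))"
    have M0: "0 \<le> M" using pos p by (simp add: M_def block_norm_nonneg)
    have "M powr p \<le> 8 * p powr p * real s"
      using pow cardA p pos block_norm_same_powr[where p = p and s = s and b = b and z = z0] by (simp add: M_def z0_def N_def)
    also have "\<dots> \<le> 8 powr p * p powr p * real s"
      using p powr_mono[of 1 p 8] by (intro mult_right_mono) auto
    also have "\<dots> = \<beta> powr p" using p by (simp add: \<beta>_def powr_mult powr_powr)
    finally have "(M powr p) powr (1 / p) \<le> (\<beta> powr p) powr (1 / p)"
      using p by (rule_tac powr_mono2) auto
    then have "M \<le> \<beta>" using M0 \<beta> p by (simp add: powr_powr)
    then have "block_norm (ereal q) (ereal q) s b W * M \<le> block_norm (ereal q) (ereal q) s b W * \<beta>"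
      using pos q by (intro mult_left_mono block_norm_nonneg) auto
    moreover have "(\<Sum>j<b. \<Sum>i<s. W j i * z0 (j * s + i)) \<le> block_norm (ereal q) (ereal q) s b W * M"
      unfolding M_def using q p by (intro block_norm_Holder) auto
    ultimately have "(\<Sum>j<b. \<Sum>i<s. W j i * z0 (j * s + i)) / \<beta> \<le> block_norm (ereal q) (ereal q) s b W"
      using \<beta> by (simp add: divide_le_eq)
    then show ?thesis by (simp add: z_def sum_divide_distrib)
  qed
  ultimately show "\<exists>x z. block_norm \<infinity> 1 s b (\<lambda>j i. x (j * s + i)) \<le> 1 \<and>
      (\<forall>c\<in>C. (\<Sum>l<s * b. c l * z l) = 0) \<and>
      \<epsilon> / (16 * (q / (q - 1))) * real s powr (1 / q) \<le> (\<Sum>l<s * b. x l * z l) \<and>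
      (\<forall>W. (\<Sum>j<b. \<Sum>i<s. W j i * z (j * s + i)) \<le> block_norm (ereal q) (ereal q) s b W)"
    unfolding N_def p_def by (intro exI[of _ x] exI[of _ z] conjI ballI allI)
qed

text \<open>
  The first term serves the cube and the product of octahedra (and, as \<open>\<epsilon> \<le> 1\<close>, the octahedron), the
  second one the cubes in single blocks, where \<open>q2 / (q2 - 1)\<close> is the conjugate exponent.
\<close>

definition rigidity_const :: "ereal \<Rightarrow> real \<Rightarrow> real" where
  "rigidity_const q2 \<epsilon> = min (\<epsilon>\<^sup>2 / 32)
     (if 1 < q2 \<and> q2 \<le> 2 then \<epsilon> / (16 * (real_of_ereal q2 / (real_of_ereal q2 - 1))) else 1)"

lemma rigidity_const_pos: "0 < \<epsilon> \<Longrightarrow> 0 < rigidity_const q2 \<epsilon>"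
  by (cases q2) (auto simp: rigidity_const_def intro!: divide_pos_pos mult_pos_pos)

text \<open>
  For each of the two levels either \<open>q \<le> p\<close> or \<open>p \<le> q \<le> 2\<close>. The combination \<open>q1 \<le> p1\<close>, \<open>p2 < q2\<close> is where
  (iii) is needed: outside the exceptional case either \<open>q2 \<le> q1\<close>, so that the inner norm can be lowered
  to exponent \<open>q2\<close>, or \<open>q1 = p1 \<le> 2\<close>, in which case the octahedron suffices.
\<close>

lemma rigid_lower_bound:
  assumes e: "1 \<le> p1" "1 \<le> p2" "1 \<le> q1" "1 \<le> q2"
    and i: "q1 \<le> max p1 2" and ii: "q2 \<le> max p2 2" and iii: "\<not> exceptional_case p1 p2 q1 q2"
    and \<epsilon>: "0 < \<epsilon>" and pos: "0 < s" "0 < b" and n: "real n \<le> real (s * b) * (1 - \<epsilon>)"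
  shows "ennreal (rigidity_const q2 \<epsilon>) * mixed_width 0 p1 p2 q1 q2 s b
    \<le> mixed_width n p1 p2 q1 q2 s b"
proof -
  let ?c = "rigidity_const q2 \<epsilon>" and ?d = "norm_ratio q1 p1 s * norm_ratio q2 p2 b"
  have d0: "0 \<le> ?d" by simp
  have c1: "?c \<le> \<epsilon>\<^sup>2 / 32" by (simp add: rigidity_const_def)
  have "0 \<le> real (s * b) * (1 - \<epsilon>)" using n of_nat_0_le_iff order_trans by blast
  moreover have "0 < real (s * b)" using pos by simp
  ultimately have "0 \<le> 1 - \<epsilon>" by (simp only: zero_le_mult_iff) linarith
  then have "\<epsilon> \<le> 1" by simp
  then have "\<epsilon>\<^sup>2 / 32 \<le> \<epsilon>" using \<epsilon> mult_left_mono[of \<epsilon> 1 \<epsilon>] by (simp add: power2_eq_square)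
  then have c2: "?c \<le> \<epsilon>" using c1 by simp
  have reduce: ?thesis
    if "dual_bound n u1 u2 r1 r2 s b D" "1 \<le> u1" "1 \<le> u2" "1 \<le> r1" "1 \<le> r2"
      "?c * ?d \<le> D / (norm_ratio p1 u1 s * norm_ratio p2 u2 b * (norm_ratio r1 q1 s * norm_ratio r2 q2 b))"
    for u1 u2 r1 r2 D
  proof -
    have "ennreal ?c * mixed_width 0 p1 p2 q1 q2 s b = ennreal (?c * ?d)"
      using e pos \<epsilon> by (simp add: mixed_width_0_eq ennreal_mult rigidity_const_pos less_imp_le)
    also have "\<dots> \<le> ennreal (D / (norm_ratio p1 u1 s * norm_ratio p2 u2 b
        * (norm_ratio r1 q1 s * norm_ratio r2 q2 b)))"
      using that(6) by (rule ennreal_leI)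
    also have "\<dots> \<le> mixed_width n p1 p2 q1 q2 s b"
      by (intro dual_bound_width pos dual_bound_change_exponents that e)
    finally show ?thesis .
  qed
  have octahedron: ?thesis if "p1 \<le> q1" "q1 \<le> 2" "p2 \<le> q2" "q2 \<le> 2"
    by (rule reduce[OF dual_bound_octahedron[OF pos \<epsilon> n]])
      (use that e pos c2 in \<open>auto simp: norm_ratio_eq_1\<close>)
  consider (aa) "q1 \<le> p1" "q2 \<le> p2" | (ba) "p1 \<le> q1" "q1 \<le> 2" "q2 \<le> p2"
    | (bb) "p1 \<le> q1" "q1 \<le> 2" "p2 \<le> q2" "q2 \<le> 2"
    | (ab) "q1 \<le> p1" "q2 \<le> q1" "p2 < q2" "q2 \<le> 2"
  proof -
    have "q1 \<le> p1 \<or> q1 \<le> 2" "q2 \<le> p2 \<or> q2 \<le> 2"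
      using i ii by (simp_all only: le_max_iff_disj)
    moreover have "p1 \<le> q1 \<or> q2 \<le> q1 \<or> q2 \<le> p2 \<or> \<not> q2 \<le> 2"
      using iii unfolding exceptional_case_def min_less_iff_conj by (meson not_le)
    ultimately show thesis
      using that linear[of p1 q1] linear[of p2 q2] linear[of q1 q2] not_le[of q2 p2]
        order_trans[of q1 q2 2] by blast
  qed
  then show ?thesis
  proof cases
    case aa
    have "?d = real s powr recip 1 / (norm_ratio p1 \<infinity> s * norm_ratio 1 q1 s)
        * (real b powr recip 1 / (norm_ratio p2 \<infinity> b * norm_ratio 1 q2 b))"
      using aa e pos by (subst (1 2) norm_ratio_factor) auto
    also have "\<epsilon>\<^sup>2 / 32 * \<dots> = \<epsilon>\<^sup>2 / 32 * real (s * b)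
        / (norm_ratio p1 \<infinity> s * norm_ratio p2 \<infinity> b * (norm_ratio 1 q1 s * norm_ratio 1 q2 b))"
      using pos by simp
    finally show ?thesis
      using mult_right_mono[OF c1 d0] by (intro reduce[OF dual_bound_cube[OF pos \<epsilon> n]]) auto
  next
    case ba
    have "?d = real b powr recip 1 / (norm_ratio p2 \<infinity> b * norm_ratio 1 q2 b)"
      using ba e pos by (subst norm_ratio_factor) (auto simp: norm_ratio_eq_1)
    also have "\<epsilon>\<^sup>2 / 32 * \<dots> = \<epsilon>\<^sup>2 / 32 * real b
        / (norm_ratio p1 1 s * norm_ratio p2 \<infinity> b * (norm_ratio 2 q1 s * norm_ratio 1 q2 b))"
      using pos e ba by (simp add: norm_ratio_eq_1)
    finally show ?thesis
      using mult_right_mono[OF c1 d0] by (intro reduce[OF dual_bound_octahedra[OF pos \<epsilon> n]]) auto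
  next
    case bb
    then show ?thesis by (rule octahedron)
  next
    case ab
    have "1 < q2" using ab e by (meson le_less_trans)
    with ab obtain r where r: "q2 = ereal r" "1 < r" "r \<le> 2"
      by (cases q2) auto
    have "?d = real s powr recip q2 / (norm_ratio p1 \<infinity> s * norm_ratio q2 q1 s)"
      using ab e pos by (subst norm_ratio_factor) (auto simp: norm_ratio_eq_1)
    also have "\<epsilon> / (16 * (r / (r - 1))) * \<dots> = \<epsilon> / (16 * (r / (r - 1))) * real s powr (1 / r)
        / (norm_ratio p1 \<infinity> s * norm_ratio p2 1 b * (norm_ratio (ereal r) q1 s * norm_ratio (ereal r) q2 b))"
      using pos e ab r by (simp add: norm_ratio_eq_1)
    finally have "?c * ?d \<le> \<epsilon> / (16 * (r / (r - 1))) * real s powr (1 / r)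
        / (norm_ratio p1 \<infinity> s * norm_ratio p2 1 b * (norm_ratio (ereal r) q1 s * norm_ratio (ereal r) q2 b))"
      using mult_right_mono[of ?c "\<epsilon> / (16 * (r / (r - 1)))" ?d] r d0
      by (simp add: rigidity_const_def)
    then show ?thesis
      using r by (intro reduce[OF dual_bound_one_cube[OF pos \<epsilon> n r(2,3)]]) auto
  qed
qed

section \<open>Approximation by maps of small rank\<close>

text \<open>
  The block number \<open>j\<close> is read as the line with intercept \<open>j div m\<close> and slope \<open>j mod m\<close>, evaluated at
  \<open>x\<close>. Two lines meet at most once, which is all that is used about collisions.
\<close>

definition hash :: "nat \<Rightarrow> nat \<Rightarrow> nat \<Rightarrow> nat" where
  "hash m x j = j div m + x * (j mod m)"

lemma hash_collide_once:
  assumes "j \<noteq> j'" "hash m x j = hash m x j'" "hash m y j = hash m y j'"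
  shows "x = y"
proof (rule ccontr)
  assume "x \<noteq> y"
  define u v u' v' where "u = int (j div m)" "v = int (j mod m)" "u' = int (j' div m)" "v' = int (j' mod m)"
  note d = this
  have "u + int x * v = u' + int x * v'" "u + int y * v = u' + int y * v'"
    using assms(2,3) unfolding hash_def d by (metis of_nat_add of_nat_mult)+
  then have "(int x - int y) * (v - v') = 0" by (simp add: algebra_simps)
  then have "v = v'" using \<open>x \<noteq> y\<close> by simp
  moreover from this have "u = u'" using \<open>u + int x * v = _\<close> by simp
  ultimately have "j div m = j' div m" "j mod m = j' mod m" unfolding d by simp_all
  then show False using assms(1) by (metis div_mult_mod_eq)
qed

lemma hash_bucket:
  assumes "0 < m" shows "card {j. j < b \<and> hash m x j = y} \<le> m"
proof -
  have "inj_on (\<lambda>j. j mod m) {j. j < b \<and> hash m x j = y}"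
  proof (rule inj_onI)
    fix j j' assume "j \<in> {j. j < b \<and> hash m x j = y}" "j' \<in> {j. j < b \<and> hash m x j = y}"
      and e: "j mod m = j' mod m"
    then have "hash m x j = hash m x j'" by simp
    then have "j div m = j' div m" using e by (simp add: hash_def)
    then show "j = j'" using e by (metis div_mult_mod_eq)
  qed
  moreover have "(\<lambda>j. j mod m) ` {j. j < b \<and> hash m x j = y} \<subseteq> {..<m}" using assms by auto
  ultimately have "card {j. j < b \<and> hash m x j = y} \<le> card {..<m}" by (rule card_inj_on_le) simp
  then show ?thesis by simp
qed

lemma hash_less:
  assumes "0 < m" "j < b" "x < K" shows "hash m x j < b div m + 1 + K * m"
proof -
  have "j div m \<le> b div m" using assms by (intro div_le_mono) auto
  moreover have "x * (j mod m) \<le> K * m" using assms by (intro mult_le_mono) (auto simp: less_imp_le)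
  ultimately show ?thesis by (simp add: hash_def)
qed

text \<open>
  A homogeneous form of an upper bound for the width. Unlike the bound for the unit ball, it can be
  applied in each block separately.
\<close>

definition approximable :: "nat \<Rightarrow> ereal \<Rightarrow> ereal \<Rightarrow> ereal \<Rightarrow> ereal \<Rightarrow> nat \<Rightarrow> nat \<Rightarrow> real \<Rightarrow> bool" where
  "approximable n p1 p2 q1 q2 s b D \<longleftrightarrow> (\<exists>g :: nat \<Rightarrow> nat \<Rightarrow> nat \<Rightarrow> real. \<forall>F. \<exists>c.
     block_norm q1 q2 s b (\<lambda>j i. F j i - (\<Sum>k<n. c k * g k j i)) \<le> D * block_norm p1 p2 s b F)"

lemma approximableI:
  fixes g :: "'k \<Rightarrow> nat \<Rightarrow> nat \<Rightarrow> real"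
  assumes "finite I" "card I \<le> n"
    and approx: "\<And>F. \<exists>c. block_norm q1 q2 s b (\<lambda>j i. F j i - (\<Sum>k\<in>I. c k * g k j i)) \<le> D * block_norm p1 p2 s b F"
  shows "approximable n p1 p2 q1 q2 s b D"
proof -
  obtain h where h: "bij_betw h I {..<card I}"
    using assms(1) by (metis ex_bij_betw_finite_nat lessThan_atLeast0)
  define g' where "g' = (\<lambda>k j i. if k < card I then g (inv_into I h k) j i else 0)"
  show ?thesis
    unfolding approximable_def
  proof (intro exI[of _ g'] allI)
    fix F
    obtain c where c: "block_norm q1 q2 s b (\<lambda>j i. F j i - (\<Sum>k\<in>I. c k * g k j i)) \<le> D * block_norm p1 p2 s b F"
      using approx by blast
    define c' where "c' = (\<lambda>k. c (inv_into I h k))"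
    have "(\<Sum>k<n. c' k * g' k j i) = (\<Sum>k\<in>I. c k * g k j i)" for j i
    proof -
      have "(\<Sum>k<n. c' k * g' k j i) = (\<Sum>k<card I. c' k * g' k j i)"
        using assms(2) by (intro sum.mono_neutral_right) (auto simp: g'_def)
      also have "\<dots> = (\<Sum>k\<in>I. c' (h k) * g' (h k) j i)"
        by (rule sum.reindex_bij_betw[OF h, symmetric])
      also have "\<dots> = (\<Sum>k\<in>I. c k * g k j i)"
      proof (rule sum.cong, rule refl)
        fix k assume "k \<in> I"
        then have "inv_into I h (h k) = k" "h k < card I"
          using h by (auto simp: bij_betw_def)
        then show "c' (h k) * g' (h k) j i = c k * g k j i" by (simp add: c'_def g'_def)
      qed
      finally show ?thesis .
    qed
    then show "\<exists>c. block_norm q1 q2 s b (\<lambda>j i. F j i - (\<Sum>k<n. c k * g' k j i)) \<le> D * block_norm p1 p2 s b F"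
      using c by (intro exI[of _ c']) simp
  qed
qed

lemma approximable_width:
  assumes "approximable n p1 p2 q1 q2 s b D" "0 \<le> D"
  shows "mixed_width n p1 p2 q1 q2 s b \<le> ennreal D"
proof -
  obtain g :: "nat \<Rightarrow> nat \<Rightarrow> nat \<Rightarrow> real" where
    g: "\<And>F. \<exists>c. block_norm q1 q2 s b (\<lambda>j i. F j i - (\<Sum>k<n. c k * g k j i)) \<le> D * block_norm p1 p2 s b F"
    using assms(1) unfolding approximable_def by blast
  show ?thesis
  proof (rule mixed_width_le)
    fix F assume F: "block_norm p1 p2 s b F \<le> 1"
    obtain c where "block_norm q1 q2 s b (\<lambda>j i. F j i - (\<Sum>k<n. c k * g k j i)) \<le> D * block_norm p1 p2 s b F"
      using g by blast
    also have "\<dots> \<le> D * 1" using F assms(2) by (rule mult_left_mono)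
    finally show "\<exists>c. block_norm q1 q2 s b (\<lambda>j i. F j i - (\<Sum>k<n. c k * g k j i)) \<le> D" by auto
  qed auto
qed

text \<open>Blocks of size 1 turn the outer norm into a plain \<open>q\<close>-norm, here used inside each block.\<close>

lemma approximable_blockwise:
  assumes m: "approximable m 1 p 1 q 1 s D" and e: "1 \<le> p" "1 \<le> q" "1 \<le> p2" "1 \<le> q2"
    and pos: "0 < s" "0 < b" and D: "0 \<le> D" and n: "b * m \<le> n"
  shows "approximable n p p2 q q2 s b (D * norm_ratio q2 p2 b)"
proof -
  have one: "block_norm 1 r 1 s F = lq_norm r s (\<lambda>i. F i 0)" for r F
    unfolding block_norm_def lq_norm_1 by simp
  obtain g :: "nat \<Rightarrow> nat \<Rightarrow> nat \<Rightarrow> real" where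
    "\<And>F. \<exists>c. block_norm 1 q 1 s (\<lambda>j i. F j i - (\<Sum>k<m. c k * g k j i)) \<le> D * block_norm 1 p 1 s F"
    using m unfolding approximable_def by blast
  note g = this[unfolded one]
  let ?I = "{..<b} \<times> {..<m}"
  define G :: "nat \<times> nat \<Rightarrow> nat \<Rightarrow> nat \<Rightarrow> real"
    where "G = (\<lambda>(j0, k) j i. if j = j0 then g k i 0 else 0)"
  show ?thesis
  proof (rule approximableI[of ?I n _ _ _ _ G])
    fix F :: "nat \<Rightarrow> nat \<Rightarrow> real"
    have "\<forall>j. \<exists>c. lq_norm q s (\<lambda>i. F j i - (\<Sum>k<m. c k * g k i 0)) \<le> D * lq_norm p s (F j)"
    proof
      fix j show "\<exists>c. lq_norm q s (\<lambda>i. F j i - (\<Sum>k<m. c k * g k i 0)) \<le> D * lq_norm p s (F j)"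
        using g[of "\<lambda>i _. F j i"] by simp
    qed
    then obtain c where c: "\<And>j. lq_norm q s (\<lambda>i. F j i - (\<Sum>k<m. c j k * g k i 0)) \<le> D * lq_norm p s (F j)"
      by metis
    have sum: "(\<Sum>l\<in>?I. c (fst l) (snd l) * G l j i) = (\<Sum>k<m. c j k * g k i 0)" if "j < b" for j i
    proof -
      have "(\<Sum>l\<in>?I. c (fst l) (snd l) * G l j i) = (\<Sum>j0<b. \<Sum>k<m. if j = j0 then c j0 k * g k i 0 else 0)"
        unfolding sum.cartesian_product by (rule sum.cong) (auto simp: G_def)
      also have "\<dots> = (\<Sum>j0<b. if j = j0 then \<Sum>k<m. c j0 k * g k i 0 else 0)"
        by (rule sum.cong) auto
      finally show ?thesis using that by simp
    qed
    have "block_norm q q2 s b (\<lambda>j i. F j i - (\<Sum>l\<in>?I. c (fst l) (snd l) * G l j i))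
        = block_norm q q2 s b (\<lambda>j i. F j i - (\<Sum>k<m. c j k * g k i 0))"
      by (rule block_norm_cong) (simp add: sum)
    also have "\<dots> \<le> lq_norm q2 b (\<lambda>j. D * lq_norm p s (F j))"
      unfolding block_norm_def using c pos e D
      by (intro lq_norm_mono) (auto simp: lq_norm_nonneg)
    also have "\<dots> = D * lq_norm q2 b (\<lambda>j. lq_norm p s (F j))"
      using e pos D by (simp add: lq_norm_scale)
    also have "\<dots> \<le> D * (norm_ratio q2 p2 b * block_norm p p2 s b F)"
      unfolding block_norm_def using e pos D by (intro mult_left_mono lq_norm_le_norm_ratio) auto
    finally show "\<exists>c. block_norm q q2 s b (\<lambda>j i. F j i - (\<Sum>k\<in>?I. c k * G k j i))
        \<le> D * norm_ratio q2 p2 b * block_norm p p2 s b F"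
      by (intro exI[of _ "\<lambda>l. c (fst l) (snd l)"]) (simp add: mult.assoc)
  qed (use n in \<open>auto simp: card_cartesian_product\<close>)
qed

text \<open>
  With \<open>M\<close> the norm of \<open>F\<close>, only the blocks of norm above \<open>\<theta> M\<close> are approximated. The others form a
  vector of \<open>q\<close>-norm at most \<open>\<theta> powr (1 - p / q) * M\<close>, and at most \<open>\<theta> powr (- p)\<close> blocks are left.
\<close>

lemma kernel_approximation:
  fixes A :: "nat \<Rightarrow> nat \<Rightarrow> nat \<Rightarrow> real"
  assumes pos: "0 < s" "0 < b" and e: "1 \<le> p1" "1 \<le> q1" "1 \<le> p" "p < q"
    and \<theta>: "0 < \<theta>" and \<eta>: "0 \<le> \<eta>"
    and diag: "\<And>i j. i < s \<Longrightarrow> j < b \<Longrightarrow> A i j j = 1"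
    and off: "\<And>j w. j < b \<Longrightarrow>
      block_norm q1 (ereal q) s b (\<lambda>j' i. if j' = j then 0 else A i j' j * w i) \<le> \<eta> * lq_norm p1 s w"
  shows "\<exists>J\<subseteq>{..<b}. block_norm q1 (ereal q) s b (\<lambda>j' i. F j' i - (\<Sum>j\<in>J. A i j' j * F j i))
    \<le> (norm_ratio q1 p1 s * \<theta> powr (1 - p / q) + \<eta> * \<theta> powr - p) * block_norm p1 (ereal p) s b F"
proof -
  define r where "r = (\<lambda>j. lq_norm p1 s (F j))"
  define M where "M = block_norm p1 (ereal p) s b F"
  have r0: "0 \<le> r j" for j using e pos by (simp add: r_def lq_norm_nonneg)
  have M: "M = lq_norm (ereal p) b r" by (simp add: M_def block_norm_def r_def)
  have M0: "0 \<le> M" using e pos by (simp add: M lq_norm_nonneg)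
  have Mp: "(\<Sum>j<b. r j powr p) = M powr p"
    using lq_norm_powr[of p b r] e r0 by (simp add: M)
  have rM: "r j \<le> M" if "j < b" for j
    using lq_norm_ge_component[of "ereal p" j b r] e that r0[of j] by (simp add: M)
  define J where "J = {j. j < b \<and> \<theta> * M < r j}"
  have J: "finite J" "J \<subseteq> {..<b}" by (auto simp: J_def)
  have cardJ: "real (card J) * M \<le> \<theta> powr - p * M"
  proof (cases "M = 0")
    case False
    have "real (card J) * (\<theta> * M) powr p = (\<Sum>j\<in>J. (\<theta> * M) powr p)" by simp
    also have "\<dots> \<le> (\<Sum>j\<in>J. r j powr p)"
      using e \<theta> M0 by (intro sum_mono powr_mono2) (auto simp: J_def)
    also have "\<dots> \<le> (\<Sum>j<b. r j powr p)" using J by (intro sum_mono2) auto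
    finally have "real (card J) * (\<theta> powr p * M powr p) \<le> 1 * M powr p"
      using \<theta> M0 by (simp add: powr_mult Mp)
    then have "real (card J) * \<theta> powr p \<le> 1"
      using False M0 by (simp add: mult.assoc [symmetric])
    then have "real (card J) \<le> \<theta> powr - p"
      using \<theta> by (simp add: powr_minus field_simps)
    then show ?thesis using M0 by (rule mult_right_mono)
  qed simp
  define H where "H = (\<lambda>j i. if j \<in> J then 0 else F j i)"
  define E where "E = (\<lambda>j j' i. if j' = j then 0 else - A i j' j * F j i)"
  have split: "F j' i - (\<Sum>j\<in>J. A i j' j * F j i) = H j' i + (\<Sum>j\<in>J. E j j' i)"
    if "j' < b" "i < s" for j' i
  proof (cases "j' \<in> J")
    case True
    have "(\<Sum>j\<in>J. A i j' j * F j i) = F j' i + (\<Sum>j\<in>J - {j'}. A i j' j * F j i)"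
      using True J that diag by (simp add: sum.remove)
    moreover have "(\<Sum>j\<in>J. E j j' i) = (\<Sum>j\<in>J - {j'}. E j j' i)"
      using True J by (simp add: sum.remove E_def)
    moreover have "\<dots> = - (\<Sum>j\<in>J - {j'}. A i j' j * F j i)"
      unfolding sum_negf [symmetric] by (rule sum.cong) (auto simp: E_def)
    ultimately show ?thesis using True by (simp add: H_def)
  next
    case False
    then have "(\<Sum>j\<in>J. E j j' i) = (\<Sum>j\<in>J. - (A i j' j * F j i))"
      by (intro sum.cong) (auto simp: E_def)
    then show ?thesis using False by (simp add: H_def sum_negf)
  qed
  have "block_norm q1 (ereal q) s b H \<le> norm_ratio q1 p1 s * (\<theta> powr (1 - p / q) * M)"
  proof -
    define r' where "r' = (\<lambda>j. if j \<in> J then 0 else r j)"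
    have "block_norm q1 (ereal q) s b H \<le> lq_norm (ereal q) b (\<lambda>j. norm_ratio q1 p1 s * r' j)"
      unfolding block_norm_def
    proof (rule lq_norm_mono)
      fix j
      show "\<bar>lq_norm q1 s (H j)\<bar> \<le> \<bar>norm_ratio q1 p1 s * r' j\<bar>"
        using e pos r0[of j] lq_norm_le_norm_ratio[of p1 q1 s "F j"]
        by (simp add: H_def r'_def lq_norm_0 lq_norm_nonneg r_def)
    qed (use e pos in auto)
    also have "\<dots> = norm_ratio q1 p1 s * lq_norm (ereal q) b r'"
      using e pos by (simp add: lq_norm_scale)
    also have "\<dots> \<le> norm_ratio q1 p1 s * (\<theta> powr (1 - p / q) * M)"
    proof (rule mult_left_mono)
      have "(\<Sum>j<b. \<bar>r' j\<bar> powr q) \<le> (\<Sum>j<b. r j powr p * (\<theta> * M) powr (q - p))"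
      proof (rule sum_mono)
        fix j assume j: "j \<in> {..<b}"
        show "\<bar>r' j\<bar> powr q \<le> r j powr p * (\<theta> * M) powr (q - p)"
        proof (cases "j \<in> J")
          case False
          then have "r j powr (q - p) \<le> (\<theta> * M) powr (q - p)"
            using j r0[of j] e by (intro powr_mono2) (auto simp: J_def)
          then have "r j powr p * r j powr (q - p) \<le> r j powr p * (\<theta> * M) powr (q - p)"
            by (rule mult_left_mono) simp
          then show ?thesis using False r0[of j] by (simp add: r'_def flip: powr_add)
        qed (simp add: r'_def)
      qed
      also have "\<dots> = M powr p * (\<theta> * M) powr (q - p)" by (simp add: Mp flip: sum_distrib_right)
      also have "\<dots> = \<theta> powr (q - p) * M powr q"
        using \<theta> M0 by (simp add: powr_mult flip: powr_add)
      finally have "(\<Sum>j<b. \<bar>r' j\<bar> powr q) powr (1 / q) \<le> (\<theta> powr (q - p) * M powr q) powr (1 / q)"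
        using e by (rule_tac powr_mono2) (auto intro: sum_nonneg)
      also have "\<dots> = \<theta> powr (1 - p / q) * M"
        using e M0 by (simp add: powr_mult powr_powr diff_divide_distrib)
      finally show "lq_norm (ereal q) b r' \<le> \<theta> powr (1 - p / q) * M" by (simp add: lq_norm_ereal)
    qed simp
    finally show ?thesis .
  qed
  moreover have "block_norm q1 (ereal q) s b (\<lambda>j' i. \<Sum>j\<in>J. E j j' i) \<le> \<eta> * \<theta> powr - p * M"
  proof -
    have "block_norm q1 (ereal q) s b (\<lambda>j' i. \<Sum>j\<in>J. E j j' i) \<le> (\<Sum>j\<in>J. block_norm q1 (ereal q) s b (E j))"
      using e pos J by (intro block_norm_sum) auto
    also have "\<dots> \<le> (\<Sum>j\<in>J. \<eta> * M)"
    proof (rule sum_mono)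
      fix j assume "j \<in> J"
      then have j: "j < b" using J by auto
      have "block_norm q1 (ereal q) s b (E j)
          = block_norm q1 (ereal q) s b (\<lambda>j' i. if j' = j then 0 else A i j' j * F j i)"
        by (rule block_norm_cong) (simp add: E_def)
      also have "\<dots> \<le> \<eta> * r j" unfolding r_def by (rule off[OF j])
      also have "\<dots> \<le> \<eta> * M" using rM[OF j] \<eta> by (rule mult_left_mono)
      finally show "block_norm q1 (ereal q) s b (E j) \<le> \<eta> * M" .
    qed
    also have "\<dots> = \<eta> * (real (card J) * M)" by simp
    also have "\<dots> \<le> \<eta> * (\<theta> powr - p * M)" using cardJ \<eta> by (rule mult_left_mono)
    finally show ?thesis by simp
  qed
  moreover have "block_norm q1 (ereal q) s b (\<lambda>j' i. F j' i - (\<Sum>j\<in>J. A i j' j * F j i))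
      = block_norm q1 (ereal q) s b (\<lambda>j' i. H j' i + (\<Sum>j\<in>J. E j j' i))"
    by (rule block_norm_cong) (simp add: split)
  moreover have "\<dots> \<le> block_norm q1 (ereal q) s b H + block_norm q1 (ereal q) s b (\<lambda>j' i. \<Sum>j\<in>J. E j j' i)"
    using e pos by (intro block_norm_triangle) auto
  ultimately show ?thesis
    using J(2) unfolding M_def by (intro exI[of _ J]) (simp add: distrib_right mult.assoc)
qed

lemma approximable_kernel:
  fixes A :: "nat \<Rightarrow> nat \<Rightarrow> nat \<Rightarrow> real" and u v :: "nat \<Rightarrow> 'k \<Rightarrow> nat \<Rightarrow> real"
  assumes pos: "0 < s" "0 < b" and e: "1 \<le> p1" "1 \<le> q1" "1 \<le> p" "p < q"
    and \<theta>: "0 < \<theta>" and \<eta>: "0 \<le> \<eta>"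
    and diag: "\<And>i j. i < s \<Longrightarrow> j < b \<Longrightarrow> A i j j = 1"
    and off: "\<And>j w. j < b \<Longrightarrow>
      block_norm q1 (ereal q) s b (\<lambda>j' i. if j' = j then 0 else A i j' j * w i) \<le> \<eta> * lq_norm p1 s w"
    and S: "finite S" "s * card S \<le> n"
    and fact: "\<And>i j j'. i < s \<Longrightarrow> j < b \<Longrightarrow> j' < b \<Longrightarrow> A i j' j = (\<Sum>k\<in>S. u i k j' * v i k j)"
  shows "approximable n p1 (ereal p) q1 (ereal q) s b
    (norm_ratio q1 p1 s * \<theta> powr (1 - p / q) + \<eta> * \<theta> powr - p)"
proof -
  let ?I = "{..<s} \<times> S"
  define G where "G = (\<lambda>(i0, k) j' i. if i = i0 then u i k j' else 0)"
  show ?thesis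
  proof (rule approximableI[of ?I n _ _ _ _ G])
    fix F
    obtain J where J: "J \<subseteq> {..<b}"
      and ap: "block_norm q1 (ereal q) s b (\<lambda>j' i. F j' i - (\<Sum>j\<in>J. A i j' j * F j i))
        \<le> (norm_ratio q1 p1 s * \<theta> powr (1 - p / q) + \<eta> * \<theta> powr - p) * block_norm p1 (ereal p) s b F"
      using kernel_approximation[OF pos e \<theta> \<eta> diag off] by blast
    define c where "c = (\<lambda>(i0, k). \<Sum>j\<in>J. v i0 k j * F j i0)"
    have "(\<Sum>l\<in>?I. c l * G l j' i) = (\<Sum>j\<in>J. A i j' j * F j i)" if "j' < b" "i < s" for j' i
    proof -
      have "(\<Sum>l\<in>?I. c l * G l j' i)
          = (\<Sum>i0<s. \<Sum>k\<in>S. if i = i0 then (\<Sum>j\<in>J. v i0 k j * F j i0) * u i0 k j' else 0)"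
        unfolding sum.cartesian_product by (rule sum.cong) (auto simp: G_def c_def)
      also have "\<dots> = (\<Sum>i0<s. if i = i0 then (\<Sum>k\<in>S. (\<Sum>j\<in>J. v i0 k j * F j i0) * u i0 k j') else 0)"
        by (rule sum.cong) auto
      also have "\<dots> = (\<Sum>k\<in>S. \<Sum>j\<in>J. u i k j' * v i k j * F j i)"
        using that by (simp add: sum_distrib_left sum_distrib_right mult_ac)
      also have "\<dots> = (\<Sum>j\<in>J. \<Sum>k\<in>S. u i k j' * v i k j * F j i)" by (rule sum.swap)
      also have "\<dots> = (\<Sum>j\<in>J. A i j' j * F j i)"
      proof (rule sum.cong, rule refl)
        fix j assume "j \<in> J"
        then show "(\<Sum>k\<in>S. u i k j' * v i k j * F j i) = A i j' j * F j i"
          using J that by (subst fact) (auto simp: sum_distrib_right)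
      qed
      finally show ?thesis .
    qed
    then have "block_norm q1 (ereal q) s b (\<lambda>j' i. F j' i - (\<Sum>l\<in>?I. c l * G l j' i))
        = block_norm q1 (ereal q) s b (\<lambda>j' i. F j' i - (\<Sum>j\<in>J. A i j' j * F j i))"
      by (intro block_norm_cong) simp
    then show "\<exists>c. block_norm q1 (ereal q) s b (\<lambda>j i. F j i - (\<Sum>l\<in>?I. c l * G l j i))
        \<le> (norm_ratio q1 p1 s * \<theta> powr (1 - p / q) + \<eta> * \<theta> powr - p) * block_norm p1 (ereal p) s b F"
      using ap by (intro exI[of _ c]) (simp only:)
  qed (use S in \<open>auto simp: card_cartesian_product\<close>)
qed

lemma nat_ceiling_powr:
  assumes "1 \<le> t" "0 \<le> a"
  shows "t powr a \<le> real (nat \<lceil>t powr a\<rceil>)" "real (nat \<lceil>t powr a\<rceil>) \<le> 2 * t powr a"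
    "0 < nat \<lceil>t powr a\<rceil>"
proof -
  have "1 \<le> t powr a" using assms by (rule ge_one_powr_ge_zero)
  then show "t powr a \<le> real (nat \<lceil>t powr a\<rceil>)" "real (nat \<lceil>t powr a\<rceil>) \<le> 2 * t powr a"
    "0 < nat \<lceil>t powr a\<rceil>" by linarith+
qed

lemma real_div_le: "real (b div m) \<le> real b / real m"
  by (rule of_nat_div_le_of_nat)

text \<open>
  The entry of the averaged collision matrix at two different block numbers is \<open>0\<close> or \<open>1 / K\<close>. Off the diagonal a
  column has at most \<open>m K\<close> nonzero entries, hence \<open>q\<close>-norm at most \<open>(m K powr (1 - q)) powr (1 / q)\<close>, and the
  rank is at most \<open>K\<close> times the number of hash values. For \<open>q > 2\<close> the choice \<open>m = K powr (1 + \<delta>)\<close>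
  makes both small.
\<close>

lemma averaged_hash_approximable:
  assumes pos: "0 < s" "0 < b" "0 < m" "0 < K" and e: "1 \<le> p1" "1 \<le> q1" "1 \<le> p" "p < q" and "0 < \<theta>"
    and n: "s * (K * (b div m + 1 + K * m)) \<le> n"
  shows "approximable n p1 (ereal p) q1 (ereal q) s b (norm_ratio q1 p1 s *
    (\<theta> powr (1 - p / q) + (real m * real K powr (1 - q)) powr (1 / q) * \<theta> powr - p))"
proof -
  define R where "R = b div m + 1 + K * m"
  define A :: "nat \<Rightarrow> nat \<Rightarrow> real" where "A = (\<lambda>j' j. \<Sum>x<K. (if hash m x j' = hash m x j then 1 else 0) / real K)"
  define \<eta> where "\<eta> = norm_ratio q1 p1 s * (real m * real K powr (1 - q)) powr (1 / q)"
  have A0: "0 \<le> A j' j" for j' j unfolding A_def by (intro sum_nonneg) auto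
  have A1: "A j' j \<le> 1 / real K" if "j' \<noteq> j" for j' j
  proof -
    have "card {x. x < K \<and> hash m x j' = hash m x j} \<le> 1"
      by (rule card_le_Suc0_iff_eq[THEN iffD2, unfolded One_nat_def[symmetric]])
        (use hash_collide_once[OF that, of m] in auto)
    moreover have "A j' j = real (card {x. x < K \<and> hash m x j' = hash m x j}) / real K"
    proof -
      have "(\<Sum>x<K. if hash m x j' = hash m x j then 1 else 0)
          = real (card ({..<K} \<inter> {x. hash m x j' = hash m x j}))"
        by (simp add: sum.If_cases)
      moreover have "{..<K} \<inter> {x. hash m x j' = hash m x j} = {x. x < K \<and> hash m x j' = hash m x j}"
        by auto
      ultimately show ?thesis by (simp add: A_def flip: sum_divide_distrib)
    qed
    ultimately show ?thesis using pos by (simp add: divide_right_mono)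
  qed
  have off: "block_norm q1 (ereal q) s b (\<lambda>j' i. if j' = j then 0 else A j' j * w i) \<le> \<eta> * lq_norm p1 s w"
    if j: "j < b" for j w
  proof -
    define a where "a = (\<lambda>j'. if j' = j then 0 else A j' j)"
    have "(\<Sum>j'<b. \<bar>a j'\<bar> powr q)
        \<le> (\<Sum>j'<b. \<Sum>x<K. (if hash m x j' = hash m x j then 1 else 0) * real K powr - q)"
    proof (rule sum_mono)
      fix j'
      show "\<bar>a j'\<bar> powr q \<le> (\<Sum>x<K. (if hash m x j' = hash m x j then 1 else 0) * real K powr - q)"
      proof (cases "j' = j")
        case True
        then show ?thesis by (simp add: a_def)
      next
        case False
        have "A j' j powr q = A j' j * A j' j powr (q - 1)"
          using A0[of j' j] e by (cases "A j' j = 0") (auto simp: powr_mult_base)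
        also have "\<dots> \<le> A j' j * (1 / real K) powr (q - 1)"
          using A0 A1[OF False] e by (intro mult_left_mono powr_mono2) auto
        also have "(1 / real K) powr (q - 1) = real K * real K powr - q"
          using pos by (simp add: powr_divide powr_diff powr_minus field_simps)
        also have "A j' j * (real K * real K powr - q)
            = (\<Sum>x<K. (if hash m x j' = hash m x j then 1 else 0) * real K powr - q)"
          unfolding A_def sum_distrib_right using pos by (intro sum.cong) auto
        finally show ?thesis using False A0[of j' j] by (simp add: a_def)
      qed
    qed
    also have "\<dots> = (\<Sum>x<K. (\<Sum>j'<b. if hash m x j' = hash m x j then 1 else 0) * real K powr - q)"
      unfolding sum_distrib_right by (rule sum.swap)
    also have "\<dots> \<le> (\<Sum>x<K. real m * real K powr - q)"
    proof (intro sum_mono mult_right_mono)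
      fix x
      have "(\<Sum>j'<b. if hash m x j' = hash m x j then 1 else 0)
          = real (card ({..<b} \<inter> {j'. hash m x j' = hash m x j}))"
        by (simp add: sum.If_cases)
      also have "{..<b} \<inter> {j'. hash m x j' = hash m x j} = {j'. j' < b \<and> hash m x j' = hash m x j}"
        by auto
      finally show "(\<Sum>j'<b. if hash m x j' = hash m x j then 1 else 0) \<le> real m"
        using hash_bucket[OF pos(3), of b x "hash m x j"] by simp
    qed simp
    also have "\<dots> = real m * real K powr (1 - q)"
      using pos by (simp add: powr_diff powr_minus field_simps)
    finally have "lq_norm (ereal q) b a \<le> (real m * real K powr (1 - q)) powr (1 / q)"
      unfolding lq_norm_ereal using e by (intro powr_mono2) (auto intro: sum_nonneg)
    moreover have "block_norm q1 (ereal q) s b (\<lambda>j' i. if j' = j then 0 else A j' j * w i)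
        = block_norm q1 (ereal q) s b (\<lambda>j' i. a j' * w i)"
      by (rule block_norm_cong) (simp add: a_def)
    moreover have "\<dots> = lq_norm (ereal q) b a * lq_norm q1 s w"
      using e pos by (intro block_norm_tensor) auto
    moreover have "lq_norm q1 s w \<le> norm_ratio q1 p1 s * lq_norm p1 s w"
      using e pos by (intro lq_norm_le_norm_ratio)
    ultimately have "block_norm q1 (ereal q) s b (\<lambda>j' i. if j' = j then 0 else A j' j * w i)
        \<le> (real m * real K powr (1 - q)) powr (1 / q) * (norm_ratio q1 p1 s * lq_norm p1 s w)"
      using e pos by (simp only:) (intro mult_mono; simp add: lq_norm_nonneg)
    then show ?thesis by (simp add: \<eta>_def mult_ac)
  qed
  have "approximable n p1 (ereal p) q1 (ereal q) s b
      (norm_ratio q1 p1 s * \<theta> powr (1 - p / q) + \<eta> * \<theta> powr - p)"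
  proof (rule approximable_kernel[where A = "\<lambda>_. A" and S = "{..<K} \<times> {..<R}"
        and u = "\<lambda>_ (x, y) j'. if hash m x j' = y then 1 else 0"
        and v = "\<lambda>_ (x, y) j. (if hash m x j = y then 1 else 0) / real K"])
    show "A j j = 1" for j using pos by (simp add: A_def)
    show "s * card ({..<K} \<times> {..<R}) \<le> n" using n by (simp add: card_cartesian_product R_def)
    fix j j' assume "j < b" "j' < b"
    have "(\<Sum>k\<in>{..<K} \<times> {..<R}. (case k of (x, y) \<Rightarrow> \<lambda>j'. if hash m x j' = y then 1 else 0) j'
          * (case k of (x, y) \<Rightarrow> \<lambda>j. (if hash m x j = y then 1 else 0) / real K) j)
        = (\<Sum>x<K. \<Sum>y<R. if hash m x j' = y then (if hash m x j = y then 1 else 0) / real K else 0)"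
      unfolding sum.cartesian_product by (rule sum.cong) auto
    also have "\<dots> = A j' j"
      unfolding A_def
    proof (rule sum.cong, rule refl)
      fix x assume "x \<in> {..<K}"
      then have "hash m x j' < R"
        using hash_less[OF pos(3) \<open>j' < b\<close>] by (simp add: R_def)
      then show "(\<Sum>y<R. if hash m x j' = y then (if hash m x j = y then 1 else 0) / real K else 0)
          = (if hash m x j' = hash m x j then 1 else 0) / real K" by simp
    qed
    finally show "A j' j = (\<Sum>k\<in>{..<K} \<times> {..<R}. (case k of (x, y) \<Rightarrow> \<lambda>j'. if hash m x j' = y then 1 else 0) j'
          * (case k of (x, y) \<Rightarrow> \<lambda>j. (if hash m x j = y then 1 else 0) / real K) j)" by simp
  qed (use assms off in \<open>auto simp: \<eta>_def\<close>)
  then show ?thesis by (simp add: \<eta>_def distrib_left mult.assoc)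
qed

text \<open>
  Comparing exponents on a set of \<open>card C\<close> coordinates instead of all \<open>s\<close> is the source of the gain in
  the exceptional case.
\<close>

lemma lq_norm_subset_powr:
  assumes r: "1 \<le> r" "ereal r \<le> p" and C: "C \<subseteq> {..<s}" and s: "0 < s"
  shows "(\<Sum>i\<in>C. \<bar>w i\<bar> powr r) \<le> (real (card C) powr (1 / r - recip p) * lq_norm p s w) powr r"
proof -
  have p1: "1 \<le> p" using r by (meson ereal_less_eq(3) one_ereal_def order_trans order_refl ereal_less_eq)
  have finC: "finite C" using C finite_subset by blast
  from p1 show ?thesis
  proof (cases rule: exponent_cases)
    case infinite
    have "(\<Sum>i\<in>C. \<bar>w i\<bar> powr r) \<le> (\<Sum>i\<in>C. lq_norm p s w powr r)"
      using C r p1 lq_norm_ge_component[of p _ s w] by (intro sum_mono powr_mono2) auto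
    also have "\<dots> = (real (card C) powr (1 / r - recip p) * lq_norm p s w) powr r"
      using infinite r lq_norm_nonneg[OF p1 s, of w] by (simp add: powr_mult powr_powr)
    finally show ?thesis .
  next
    case (finite u)
    have ru: "r \<le> u" "1 \<le> u" using finite r by auto
    have "(\<Sum>i\<in>C. \<bar>w i\<bar> powr r)
        \<le> real (card C) powr (1 - r / u) * (\<Sum>i\<in>C. \<bar>w i\<bar> powr u) powr (r / u)"
      using r ru finC by (intro power_mean_sum) auto
    also have "\<dots> \<le> real (card C) powr (1 - r / u) * (\<Sum>i<s. \<bar>w i\<bar> powr u) powr (r / u)"
      using C r ru by (intro mult_left_mono powr_mono2 sum_mono2 sum_nonneg) auto
    also have "1 - r / u = (1 / r - recip p) * r" using finite r ru by (simp add: field_simps)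
    also have "real (card C) powr \<dots> * (\<Sum>i<s. \<bar>w i\<bar> powr u) powr (r / u)
        = (real (card C) powr (1 / r - recip p) * lq_norm p s w) powr r"
      using finite by (simp add: lq_norm_ereal powr_mult powr_powr)
    finally show ?thesis .
  qed
qed

lemma card_residue_class_le:
  assumes "0 < K" shows "card {i. i < s \<and> i mod K = x} \<le> s div K + 1"
proof -
  have "inj_on (\<lambda>i. i div K) {i. i < s \<and> i mod K = x}"
    by (rule inj_onI) (metis (mono_tags, lifting) div_mult_mod_eq mem_Collect_eq)
  moreover have "(\<lambda>i. i div K) ` {i. i < s \<and> i mod K = x} \<subseteq> {..s div K}"
    by (auto intro: div_le_mono)
  ultimately have "card {i. i < s \<and> i mod K = x} \<le> card {..s div K}" by (rule card_inj_on_le) simp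
  then show ?thesis by simp
qed

text \<open>
  For \<open>j' \<noteq> j\<close> the coordinates \<open>i\<close> at which block \<open>j\<close> disturbs block \<open>j'\<close> lie in one residue class
  modulo \<open>K\<close>. Let \<open>T j'\<close> be the sum of \<open>\<bar>w i\<bar> powr r\<close> over them. Each \<open>T j'\<close> is small by
  \<open>lq_norm_subset_powr\<close>, and their sum is at most \<open>m\<close> times the full sum, since at a given \<open>i\<close> only the
  members of one hash bucket are disturbed. As \<open>r < q\<close>, this controls \<open>\<Sum>j'. T j' powr (q / r)\<close>.
\<close>

lemma rotating_hash_approximable:
  assumes pos: "0 < s" "0 < b" "0 < m" "0 < K" and K: "K \<le> s"
    and e: "1 \<le> r" "ereal r \<le> p1" "1 \<le> p" "p < q" "r < q" and \<theta>: "0 < \<theta>"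
    and n: "s * (b div m + 1 + K * m) \<le> n"
  shows "approximable n p1 (ereal p) (ereal r) (ereal q) s b (norm_ratio (ereal r) p1 s *
    (\<theta> powr (1 - p / q)
      + (real m * (2 / real K) powr ((1 / r - recip p1) * (q - r))) powr (1 / q) * \<theta> powr - p))"
proof -
  define R where "R = b div m + 1 + K * m"
  define \<rho> where "\<rho> = 1 / r - recip p1"
  have p1: "1 \<le> p1" using e by (meson ereal_less_eq(3) one_ereal_def order_trans order_refl ereal_less_eq)
  have \<rho>: "0 \<le> \<rho>" using recip_antimono[of "ereal r" p1] e by (simp add: \<rho>_def)
  have nr: "norm_ratio (ereal r) p1 s = real s powr \<rho>"
    using e by (simp add: norm_ratio_eq_powr \<rho>_def)
  define \<eta> where "\<eta> = norm_ratio (ereal r) p1 s * (real m * (2 / real K) powr (\<rho> * (q - r))) powr (1 / q)"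
  define A :: "nat \<Rightarrow> nat \<Rightarrow> nat \<Rightarrow> real"
    where "A = (\<lambda>i j' j. if hash m (i mod K) j' = hash m (i mod K) j then 1 else 0)"
  have off: "block_norm (ereal r) (ereal q) s b (\<lambda>j' i. if j' = j then 0 else A i j' j * w i) \<le> \<eta> * lq_norm p1 s w"
    if j: "j < b" for j w
  proof -
    define L where "L = lq_norm p1 s w"
    have L0: "0 \<le> L" using p1 pos by (simp add: L_def lq_norm_nonneg)
    define C where "C = (\<lambda>j'. {i. i < s \<and> j' \<noteq> j \<and> hash m (i mod K) j' = hash m (i mod K) j})"
    define T where "T = (\<lambda>j'. \<Sum>i\<in>C j'. \<bar>w i\<bar> powr r)"
    have T0: "0 \<le> T j'" for j' unfolding T_def by (intro sum_nonneg) auto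
    have Cs: "C j' \<subseteq> {..<s}" for j' by (auto simp: C_def)
    have cardC: "real (card (C j')) \<le> 2 * real s / real K" for j'
    proof (cases "C j' = {}")
      case False
      then obtain i0 where i0: "i0 \<in> C j'" by blast
      then have "C j' \<subseteq> {i. i < s \<and> i mod K = i0 mod K}"
        unfolding C_def using hash_collide_once[of j' j m] by blast
      then have "card (C j') \<le> s div K + 1"
        using card_residue_class_le[OF pos(4), of s "i0 mod K"] card_mono[of "{i. i < s \<and> i mod K = i0 mod K}" "C j'"]
        by (auto intro: order_trans)
      then have "real (card (C j')) \<le> real (s div K) + 1" by linarith
      also have "\<dots> \<le> real s / real K + real s / real K"
        using K pos by (intro add_mono real_div_le) (simp add: field_simps)
      finally show ?thesis by simp
    qed (use pos in simp)
    have T_le: "T j' \<le> ((2 * real s / real K) powr \<rho> * L) powr r" for j'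
    proof -
      have "T j' \<le> (real (card (C j')) powr \<rho> * L) powr r"
        unfolding T_def \<rho>_def L_def using e Cs pos by (intro lq_norm_subset_powr)
      also have "\<dots> \<le> ((2 * real s / real K) powr \<rho> * L) powr r"
        using cardC e \<rho> L0 by (intro powr_mono2 mult_right_mono) auto
      finally show ?thesis .
    qed
    have inner: "lq_norm (ereal r) s (\<lambda>i. if j' = j then 0 else A i j' j * w i) = T j' powr (1 / r)" for j'
    proof -
      have "(\<Sum>i<s. \<bar>if j' = j then 0 else A i j' j * w i\<bar> powr r)
          = (\<Sum>i<s. if i \<in> C j' then \<bar>w i\<bar> powr r else 0)"
        by (rule sum.cong) (auto simp: C_def A_def)
      also have "\<dots> = T j'" using Cs[of j'] by (simp add: T_def sum.If_cases Int_absorb1)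
      finally show ?thesis by (simp add: lq_norm_ereal)
    qed
    have sumT: "(\<Sum>j'<b. T j') \<le> real m * (real s powr \<rho> * L) powr r"
    proof -
      have "(\<Sum>j'<b. T j') = (\<Sum>j'<b. \<Sum>i<s. if i \<in> C j' then \<bar>w i\<bar> powr r else 0)"
        using Cs by (simp add: T_def sum.If_cases Int_absorb1)
      also have "\<dots> = (\<Sum>i<s. \<Sum>j'<b. if i \<in> C j' then \<bar>w i\<bar> powr r else 0)" by (rule sum.swap)
      also have "\<dots> \<le> (\<Sum>i<s. real m * \<bar>w i\<bar> powr r)"
      proof (rule sum_mono)
        fix i
        have "({..<b} \<inter> {j'. i \<in> C j'}) \<subseteq> {j'. j' < b \<and> hash m (i mod K) j' = hash m (i mod K) j}"
          by (auto simp: C_def)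
        then have "card ({..<b} \<inter> {j'. i \<in> C j'}) \<le> m"
          using card_mono[of "{j'. j' < b \<and> hash m (i mod K) j' = hash m (i mod K) j}" "{..<b} \<inter> {j'. i \<in> C j'}"]
            hash_bucket[OF pos(3), of b "i mod K" "hash m (i mod K) j"] by simp
        then show "(\<Sum>j'<b. if i \<in> C j' then \<bar>w i\<bar> powr r else 0) \<le> real m * \<bar>w i\<bar> powr r"
          by (simp add: sum.If_cases mult_right_mono)
      qed
      also have "\<dots> = real m * (\<Sum>i<s. \<bar>w i\<bar> powr r)" by (simp add: sum_distrib_left)
      also have "\<dots> \<le> real m * (real s powr \<rho> * L) powr r"
        using lq_norm_subset_powr[OF e(1,2), of "{..<s}" s w] pos
        by (intro mult_left_mono) (auto simp: \<rho>_def L_def)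
      finally show ?thesis .
    qed
    define V where "V = ((2 * real s / real K) powr \<rho> * L) powr (q - r)"
    have "(\<Sum>j'<b. (T j' powr (1 / r)) powr q) \<le> (\<Sum>j'<b. T j' * V)"
    proof (rule sum_mono)
      fix j'
      have "(T j' powr (1 / r)) powr q = T j' powr (1 + (q - r) / r)"
        using e by (simp add: powr_powr field_simps)
      also have "\<dots> = T j' * T j' powr ((q - r) / r)"
        using T0[of j'] by (cases "T j' = 0") (auto simp: powr_add)
      also have "\<dots> \<le> T j' * (((2 * real s / real K) powr \<rho> * L) powr r) powr ((q - r) / r)"
        using T0 T_le e by (intro mult_left_mono powr_mono2) auto
      also have "\<dots> = T j' * V" using e by (simp add: V_def powr_powr)
      finally show "(T j' powr (1 / r)) powr q \<le> T j' * V" .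
    qed
    also have "\<dots> = (\<Sum>j'<b. T j') * V" by (simp add: sum_distrib_right)
    also have "\<dots> \<le> real m * (real s powr \<rho> * L) powr r * V"
      using sumT by (intro mult_right_mono) (auto simp: V_def)
    also have "V = (2 / real K) powr (\<rho> * (q - r)) * (real s powr \<rho> * L) powr (q - r)"
      using pos L0 by (simp add: V_def powr_mult powr_divide powr_powr)
    also have "real m * (real s powr \<rho> * L) powr r * ((2 / real K) powr (\<rho> * (q - r)) * (real s powr \<rho> * L) powr (q - r))
        = real m * (2 / real K) powr (\<rho> * (q - r)) * (real s powr \<rho> * L) powr q"
      by (simp add: powr_diff field_simps)
    finally have "(\<Sum>j'<b. (T j' powr (1 / r)) powr q) powr (1 / q)
        \<le> (real m * (2 / real K) powr (\<rho> * (q - r)) * (real s powr \<rho> * L) powr q) powr (1 / q)"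
      using e by (rule_tac powr_mono2) (auto intro: sum_nonneg)
    also have "\<dots> = \<eta> * L"
      using e L0 by (simp add: powr_mult powr_powr \<eta>_def nr)
    finally show ?thesis
      by (simp only: block_norm_def inner) (simp add: lq_norm_ereal L_def)
  qed
  have "approximable n p1 (ereal p) (ereal r) (ereal q) s b
      (norm_ratio (ereal r) p1 s * \<theta> powr (1 - p / q) + \<eta> * \<theta> powr - p)"
  proof (rule approximable_kernel[where A = A and S = "{..<R}"
        and u = "\<lambda>i y j'. if hash m (i mod K) j' = y then 1 else 0"
        and v = "\<lambda>i y j. if hash m (i mod K) j = y then 1 else 0"])
    fix i j j' assume "j < b" "j' < b"
    have "hash m (i mod K) j' < R"
      using hash_less[OF pos(3) \<open>j' < b\<close>, of "i mod K" K] pos by (simp add: R_def)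
    moreover have "(\<Sum>y<R. (if hash m (i mod K) j' = y then 1 else 0) * (if hash m (i mod K) j = y then 1 else (0::real)))
        = (\<Sum>y<R. if hash m (i mod K) j' = y then (if hash m (i mod K) j = y then 1 else 0) else 0)"
      by (rule sum.cong) auto
    ultimately show "A i j' j = (\<Sum>y<R. (if hash m (i mod K) j' = y then 1 else 0)
        * (if hash m (i mod K) j = y then 1 else 0))"
      by (simp add: A_def)
  qed (use assms p1 off in \<open>auto simp: \<eta>_def A_def R_def\<close>)
  then show ?thesis by (simp add: \<eta>_def distrib_left mult.assoc \<rho>_def)
qed

section \<open>Upper bounds in the non-rigid cases\<close>

text \<open>The constants \<open>2 + 2 + 8\<close> in the rank bound below add up to 12.\<close>

lemma absorb_factor_12:
  fixes t :: real
  assumes "1 \<le> t" "12 powr (1 / \<gamma>) \<le> t" "0 < \<gamma>" "2 * \<gamma> \<le> a"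
  shows "12 * t powr - a \<le> t powr - \<gamma>"
proof -
  have "(12 powr (1 / \<gamma>)) powr \<gamma> \<le> t powr \<gamma>" using assms by (intro powr_mono2) auto
  then have "12 \<le> t powr \<gamma>" using assms by (simp add: powr_powr)
  then have "12 * t powr - a \<le> t powr \<gamma> * t powr - a" by (intro mult_right_mono) auto
  also have "\<dots> = t powr (\<gamma> - a)" by (simp flip: powr_add)
  also have "\<dots> \<le> t powr - \<gamma>" using assms by (intro powr_mono) auto
  finally show ?thesis .
qed

lemma approximable_mono:
  assumes "approximable n p1 p2 q1 q2 s b D" "D \<le> D'" "1 \<le> p2" "0 < b"
  shows "approximable n p1 p2 q1 q2 s b D'"
proof -
  obtain g :: "nat \<Rightarrow> nat \<Rightarrow> nat \<Rightarrow> real" where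
    g: "\<And>F. \<exists>c. block_norm q1 q2 s b (\<lambda>j i. F j i - (\<Sum>k<n. c k * g k j i)) \<le> D * block_norm p1 p2 s b F"
    using assms(1) unfolding approximable_def by blast
  have "D * block_norm p1 p2 s b F \<le> D' * block_norm p1 p2 s b F" for F
    using assms by (intro mult_right_mono block_norm_nonneg)
  then show ?thesis
    unfolding approximable_def using g by (intro exI[of _ g]) (meson order_trans)
qed

lemma approximable_outer_infinity:
  assumes "approximable n p1 p2 q1 q s b D" "1 \<le> q" "0 < b"
  shows "approximable n p1 p2 q1 \<infinity> s b D"
proof -
  obtain g :: "nat \<Rightarrow> nat \<Rightarrow> nat \<Rightarrow> real" where
    g: "\<And>F. \<exists>c. block_norm q1 q s b (\<lambda>j i. F j i - (\<Sum>k<n. c k * g k j i)) \<le> D * block_norm p1 p2 s b F"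
    using assms(1) unfolding approximable_def by blast
  have "block_norm q1 \<infinity> s b G \<le> block_norm q1 q s b G" for G
    unfolding block_norm_def using assms by (intro lq_norm_antimono) auto
  then show ?thesis
    unfolding approximable_def using g by (intro exI[of _ g]) (meson order_trans)
qed

text \<open>
  Parameters in \<open>averaged_hash_approximable\<close> are powers of \<open>b\<close>: \<open>K\<close> about \<open>b powr (1 / 8)\<close>, \<open>m\<close> about
  \<open>K powr (1 + \<delta>)\<close> with \<open>2 \<delta> \<le> q - 2\<close>, and a threshold \<open>b powr (- \<tau>)\<close> that gives back half of the gain.
\<close>

lemma approximable_outer_finite:
  assumes e: "1 \<le> p1" "1 \<le> q1" "1 \<le> p" "p < q" "2 < q"
  shows "\<exists>\<gamma>>0. \<exists>b0. \<forall>b\<ge>b0. \<forall>s n. 0 < s \<longrightarrow> 0 < b \<longrightarrow>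
    real s * real b * real b powr - \<gamma> \<le> real n \<longrightarrow>
    approximable n p1 (ereal p) q1 (ereal q) s b (real b powr - \<gamma> * norm_ratio q1 p1 s)"
proof -
  define \<delta> where "\<delta> = min 1 ((q - 2) / 2)"
  have \<delta>: "0 < \<delta>" "\<delta> \<le> 1" "2 * \<delta> \<le> q - 2" using e by (auto simp: \<delta>_def min_def)
  define \<tau> where "\<tau> = \<delta> / (16 * p * q)"
  have \<tau>: "0 < \<tau>" using \<delta> e by (simp add: \<tau>_def)
  define a where "a = min (\<tau> * (1 - p / q)) (\<delta> / (16 * q))"
  have a: "0 < a" "a \<le> \<tau> * (1 - p / q)" "a \<le> \<delta> / (16 * q)"
    using \<tau> \<delta> e unfolding a_def by auto
  have "\<delta> / (16 * q) \<le> \<delta> / 8" using \<delta> e by (intro divide_left_mono) auto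
  then have a8: "a \<le> \<delta> / 8" using a by linarith
  define \<gamma> where "\<gamma> = a / 2"
  have \<gamma>: "0 < \<gamma>" "2 * \<gamma> \<le> a" using a by (auto simp: \<gamma>_def)
  define b0 where "b0 = nat \<lceil>12 powr (1 / \<gamma>)\<rceil>"
  have "approximable n p1 (ereal p) q1 (ereal q) s b (real b powr - \<gamma> * norm_ratio q1 p1 s)"
    if b: "b0 \<le> b" "0 < s" "0 < b" and n: "real s * real b * real b powr - \<gamma> \<le> real n" for s b n
  proof -
    define t where "t = real b"
    have t: "1 \<le> t" "12 powr (1 / \<gamma>) \<le> t" using b unfolding t_def b0_def by linarith+
    have gain: "12 * t powr - a \<le> t powr - \<gamma>" by (rule absorb_factor_12[OF t \<gamma>])
    define K where "K = nat \<lceil>t powr (1 / 8)\<rceil>"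
    define m where "m = nat \<lceil>t powr ((1 + \<delta>) / 8)\<rceil>"
    define \<theta> where "\<theta> = t powr - \<tau>"
    have K: "t powr (1 / 8) \<le> real K" "real K \<le> 2 * t powr (1 / 8)" "0 < K"
      unfolding K_def by (rule nat_ceiling_powr[OF t(1)], simp)+
    have m: "t powr ((1 + \<delta>) / 8) \<le> real m" "real m \<le> 2 * t powr ((1 + \<delta>) / 8)" "0 < m"
      unfolding m_def by (rule nat_ceiling_powr[OF t(1)], use \<delta> in simp)+
    have \<theta>: "0 < \<theta>" using t by (simp add: \<theta>_def)
    have small: "t powr c \<le> t powr - a" if "c \<le> - a" for c using that t by (intro powr_mono) auto
    have shift: "t * t powr (c - 1) = t powr c" for c using t by (simp add: powr_diff)
    have rank: "real (K * (b div m + 1 + K * m)) \<le> t * t powr - \<gamma>"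
    proof -
      have 1: "real K * real (b div m) \<le> t * (2 * t powr - a)"
      proof -
        have "real K * real (b div m) \<le> 2 * t powr (1 / 8) * (t / t powr ((1 + \<delta>) / 8))"
        proof (rule mult_mono)
          have "t / real m \<le> t / t powr ((1 + \<delta>) / 8)" using m t by (intro divide_left_mono) auto
          then show "real (b div m) \<le> t / t powr ((1 + \<delta>) / 8)"
            using real_div_le[of b m] by (simp add: t_def)
        qed (use K in auto)
        also have "\<dots> = t * (2 * t powr (1 / 8 - (1 + \<delta>) / 8))" by (simp add: powr_diff)
        also have "1 / 8 - (1 + \<delta>) / 8 = - \<delta> / 8" by (simp add: field_simps)
        also have "t * (2 * t powr (- \<delta> / 8)) \<le> t * (2 * t powr - a)"
          using small[of "- \<delta> / 8"] a8 t by (intro mult_left_mono) auto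
        finally show ?thesis .
      qed
      have 2: "real K \<le> t * (2 * t powr - a)"
      proof -
        have "2 * t powr (1 / 8) = t * (2 * t powr (1 / 8 - 1))"
          by (simp only: mult.left_commute[of t 2] shift)
        also have "\<dots> \<le> t * (2 * t powr - a)"
          using small[of "1 / 8 - 1"] a8 \<delta> t by (intro mult_left_mono) auto
        finally show ?thesis using K by linarith
      qed
      have 3: "real K * (real K * real m) \<le> t * (8 * t powr - a)"
      proof -
        have "real K * (real K * real m) \<le> 2 * t powr (1 / 8) * (2 * t powr (1 / 8) * (2 * t powr ((1 + \<delta>) / 8)))"
          using K m by (intro mult_mono) auto
        also have "\<dots> = 8 * t powr (1 / 8 + 1 / 8 + (1 + \<delta>) / 8)"
          unfolding powr_add by simp
        also have "\<dots> = t * (8 * t powr (1 / 8 + 1 / 8 + (1 + \<delta>) / 8 - 1))"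
          by (simp only: mult.left_commute[of t 8] shift)
        also have "\<dots> \<le> t * (8 * t powr - a)"
        proof -
          have "1 / 8 + 1 / 8 + (1 + \<delta>) / 8 - 1 \<le> - a" using a8 \<delta> by argo
          then show ?thesis using small t by (intro mult_left_mono) auto
        qed
        finally show ?thesis .
      qed
      have "real (K * (b div m + 1 + K * m)) = real K * real (b div m) + real K + real K * (real K * real m)"
        by (simp add: algebra_simps)
      also have "\<dots> \<le> t * (12 * t powr - a)" using 1 2 3 by linarith
      also have "\<dots> \<le> t * t powr - \<gamma>" using gain t by (intro mult_left_mono) auto
      finally show ?thesis .
    qed
    have "real (s * (K * (b div m + 1 + K * m))) \<le> real s * (t * t powr - \<gamma>)"
      using rank unfolding of_nat_mult[of s] by (intro mult_left_mono) auto
    also have "\<dots> \<le> real n" using n by (simp add: t_def mult.assoc)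
    finally have n': "s * (K * (b div m + 1 + K * m)) \<le> n" by (simp only: of_nat_le_iff)
    have ap: "approximable n p1 (ereal p) q1 (ereal q) s b (norm_ratio q1 p1 s *
        (\<theta> powr (1 - p / q) + (real m * real K powr (1 - q)) powr (1 / q) * \<theta> powr - p))"
      by (rule averaged_hash_approximable[OF b(2,3) m(3) K(3) e(1,2,3,4) \<theta> n'])
    have e1: "\<theta> powr (1 - p / q) \<le> t powr - a"
      unfolding \<theta>_def powr_powr by (rule small) (use a in simp)
    have e2: "(real m * real K powr (1 - q)) powr (1 / q) * \<theta> powr - p \<le> 2 * t powr - a"
    proof -
      have "real K powr (1 - q) \<le> (t powr (1 / 8)) powr (1 - q)"
        using K t e by (intro powr_mono2') auto
      then have "real m * real K powr (1 - q) \<le> 2 * t powr ((1 + \<delta>) / 8) * (t powr (1 / 8)) powr (1 - q)"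
        using m by (intro mult_mono) auto
      also have "\<dots> = 2 * t powr ((1 + \<delta>) / 8 + (1 - q) / 8)" by (simp add: powr_add powr_powr)
      also have "\<dots> \<le> 2 * t powr (- \<delta> / 8)"
      proof -
        have "(1 + \<delta>) / 8 + (1 - q) / 8 \<le> - \<delta> / 8" using \<delta> by argo
        then show ?thesis using t by (intro mult_left_mono powr_mono) auto
      qed
      finally have "(real m * real K powr (1 - q)) powr (1 / q) \<le> (2 * t powr (- \<delta> / 8)) powr (1 / q)"
        using e by (intro powr_mono2) auto
      also have "\<dots> = 2 powr (1 / q) * t powr (- \<delta> / (8 * q))" by (simp add: powr_mult powr_powr)
      also have "\<dots> \<le> 2 * t powr (- \<delta> / (8 * q))"
        using e powr_mono[of "1 / q" 1 2] by (intro mult_right_mono) auto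
      finally have "(real m * real K powr (1 - q)) powr (1 / q) * \<theta> powr - p
          \<le> 2 * t powr (- \<delta> / (8 * q)) * t powr (\<tau> * p)"
        by (simp add: \<theta>_def powr_powr mult_right_mono)
      also have "\<dots> = 2 * t powr (- \<delta> / (8 * q) + \<tau> * p)" by (simp only: powr_add mult.assoc)
      also have "- \<delta> / (8 * q) + \<tau> * p = - (\<delta> / (16 * q))"
        using e by (simp add: \<tau>_def field_simps)
      also have "2 * t powr - (\<delta> / (16 * q)) \<le> 2 * t powr - a"
        using a by (intro mult_left_mono small) auto
      finally show ?thesis .
    qed
    have "0 \<le> t powr - a" by simp
    then have "\<theta> powr (1 - p / q) + (real m * real K powr (1 - q)) powr (1 / q) * \<theta> powr - p \<le> t powr - \<gamma>"
      using e1 e2 gain by linarith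
    then have "norm_ratio q1 p1 s * (\<theta> powr (1 - p / q) + (real m * real K powr (1 - q)) powr (1 / q) * \<theta> powr - p)
        \<le> real b powr - \<gamma> * norm_ratio q1 p1 s"
      unfolding t_def by (subst mult.commute) (intro mult_right_mono; simp)
    then show ?thesis using e b by (intro approximable_mono[OF ap]) auto
  qed
  then show ?thesis by (intro exI[of _ \<gamma>] conjI \<gamma>(1) exI[of _ b0] allI impI)
qed

lemma approximable_outer:
  assumes e: "1 \<le> p1" "1 \<le> q1" "1 \<le> p2" "p2 < q2" "2 < q2"
  shows "\<exists>\<gamma>>0. \<exists>b0. \<forall>b\<ge>b0. \<forall>s n. 0 < s \<longrightarrow> 0 < b \<longrightarrow>
    real s * real b * real b powr - \<gamma> \<le> real n \<longrightarrow>
    approximable n p1 p2 q1 q2 s b (real b powr - \<gamma> * norm_ratio q1 p1 s)"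
proof -
  obtain p where p: "p2 = ereal p" "1 \<le> p" using e by (cases p2) auto
  show ?thesis
  proof (cases "q2 = \<infinity>")
    case True
    \<comment> \<open>The supremum norm is below every \<open>q\<close>-norm, so any finite admissible exponent will do.\<close>
    define q where "q = max p 2 + 1"
    have q: "p < q" "2 < q" by (auto simp: q_def)
    obtain \<gamma> b0 where "0 < \<gamma>" and ap: "\<And>b s n. b0 \<le> b \<Longrightarrow> 0 < s \<Longrightarrow> 0 < b \<Longrightarrow>
        real s * real b * real b powr - \<gamma> \<le> real n \<Longrightarrow>
        approximable n p1 (ereal p) q1 (ereal q) s b (real b powr - \<gamma> * norm_ratio q1 p1 s)"
      using approximable_outer_finite[OF e(1,2) p(2) q] by metis
    show ?thesis
      unfolding True p
    proof (intro exI[of _ \<gamma>] conjI \<open>0 < \<gamma>\<close> exI[of _ b0] allI impI)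
      fix b s n assume "b0 \<le> b" "0 < s" "0 < b" "real s * real b * real b powr - \<gamma> \<le> real n"
      then show "approximable n p1 (ereal p) q1 \<infinity> s b (real b powr - \<gamma> * norm_ratio q1 p1 s)"
        using q by (intro approximable_outer_infinity[OF ap]) auto
    qed
  next
    case False
    then obtain q where "q2 = ereal q" using e by (cases q2) auto
    then show ?thesis using approximable_outer_finite[OF e(1,2) p(2), of q] e p by simp
  qed
qed

text \<open>
  The inner gain has exponent \<open>\<rho> = (1 / r - 1 / p1) (q - r) > 0\<close>. With \<open>K\<close> about \<open>t powr (1 / 2)\<close> it
  leaves room for buckets of size \<open>m = t powr (\<rho> / 4)\<close> and for the threshold.
\<close>

lemma approximable_exceptional:
  assumes e: "1 \<le> p1" "1 \<le> p2" "1 \<le> q1" and x: "exceptional_case p1 p2 q1 q2"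
  shows "\<exists>\<gamma>>0. \<exists>t0. \<forall>s b n. 0 < s \<longrightarrow> 0 < b \<longrightarrow> t0 \<le> min s b \<longrightarrow>
    real (s * b) * real (min s b) powr - \<gamma> \<le> real n \<longrightarrow>
    approximable n p1 p2 q1 q2 s b (real (min s b) powr - \<gamma> * norm_ratio q1 p1 s)"
proof -
  have x': "q1 < p1" "q1 < q2" "p2 < q2" "q2 \<le> 2" using x by (auto simp: exceptional_case_def)
  then obtain q where q: "q2 = ereal q" "q \<le> 2" using e by (cases q2) auto
  obtain p where p: "p2 = ereal p" "1 \<le> p" "p < q" using e x' q by (cases p2) auto
  obtain r where r: "q1 = ereal r" "1 \<le> r" "r < q" using e x' q by (cases q1) auto
  define \<rho> where "\<rho> = (1 / r - recip p1) * (q - r)"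
  have "0 < 1 / r - recip p1" using recip_strict_antimono[of q1 p1] e x' r by simp
  moreover have "1 / r \<le> 1" using r by simp
  then have "1 / r - recip p1 \<le> 1" using recip_nonneg[OF e(1)] by linarith
  ultimately have \<rho>: "0 < \<rho>" "\<rho> \<le> 1" using r q mult_mono[of "1 / r - recip p1" 1 "q - r" 1] by (auto simp: \<rho>_def)
  define \<mu> where "\<mu> = \<rho> / 4"
  have \<mu>: "0 < \<mu>" "\<mu> \<le> 1 / 4" using \<rho> by (auto simp: \<mu>_def)
  define \<tau> where "\<tau> = \<mu> / (2 * p * q)"
  have \<tau>: "0 < \<tau>" using \<mu> p by (simp add: \<tau>_def)
  define a where "a = min (\<tau> * (1 - p / q)) (\<mu> / (2 * q))"
  have a: "0 < a" "a \<le> \<tau> * (1 - p / q)" "a \<le> \<mu> / (2 * q)" using \<tau> \<mu> p by (auto simp: a_def)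
  have "\<mu> / (2 * q) \<le> \<mu> / 1" using \<mu> p by (intro divide_left_mono) auto
  then have a\<mu>: "a \<le> \<mu>" using a by simp
  define \<gamma> where "\<gamma> = a / 2"
  have \<gamma>: "0 < \<gamma>" "2 * \<gamma> \<le> a" using a by (auto simp: \<gamma>_def)
  define t0 where "t0 = nat \<lceil>12 powr (1 / \<gamma>)\<rceil>"
  have "approximable n p1 p2 q1 q2 s b (real (min s b) powr - \<gamma> * norm_ratio q1 p1 s)"
    if sb: "0 < s" "0 < b" and t0: "t0 \<le> min s b"
      and n: "real (s * b) * real (min s b) powr - \<gamma> \<le> real n" for s b n
  proof -
    define t where "t = real (min s b)"
    have t: "1 \<le> t" "12 powr (1 / \<gamma>) \<le> t" using sb t0 unfolding t_def t0_def by linarith+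
    have tb: "t \<le> real b" by (simp add: t_def)
    have gain: "12 * t powr - a \<le> t powr - \<gamma>" by (rule absorb_factor_12[OF t \<gamma>])
    define K where "K = nat \<lceil>t powr (1 / 2)\<rceil>"
    define m where "m = nat \<lceil>t powr \<mu>\<rceil>"
    define \<theta> where "\<theta> = t powr - \<tau>"
    have K: "t powr (1 / 2) \<le> real K" "real K \<le> 2 * t powr (1 / 2)" "0 < K"
      unfolding K_def by (rule nat_ceiling_powr[OF t(1)], simp)+
    have m: "t powr \<mu> \<le> real m" "real m \<le> 2 * t powr \<mu>" "0 < m"
      unfolding m_def by (rule nat_ceiling_powr[OF t(1)], use \<mu> in simp)+
    have "t powr (1 / 2) \<le> t powr 1" using t by (intro powr_mono) auto
    then have "t powr (1 / 2) \<le> real (min s b)" using t by (simp add: t_def)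
    then have "K \<le> min s b" unfolding K_def by linarith
    then have Ks: "K \<le> s" by simp
    have \<theta>: "0 < \<theta>" using t by (simp add: \<theta>_def)
    have small: "t powr c \<le> t powr - a" if "c \<le> - a" for c using that t by (intro powr_mono) auto
    have shift: "t * t powr (c - 1) = t powr c" for c using t by (simp add: powr_diff)
    have rank: "real (b div m + 1 + K * m) \<le> real b * t powr - \<gamma>"
    proof -
      have 1: "real (b div m) \<le> real b * t powr - a"
      proof -
        have "real (b div m) \<le> real b / t powr \<mu>"
          using m t by (intro order_trans[OF real_div_le] divide_left_mono) auto
        also have "\<dots> = real b * t powr - \<mu>" by (simp add: powr_minus field_simps)
        also have "\<dots> \<le> real b * t powr - a" using small[of "- \<mu>"] a\<mu> by (intro mult_left_mono) auto
        finally show ?thesis .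
      qed
      have scaled: "t * t powr c \<le> real b * t powr - a" if "c \<le> - a" for c
        using tb small[OF that] t by (intro mult_mono) auto
      have 2: "1 \<le> real b * t powr - a"
        using scaled[of "- 1"] a\<mu> \<mu> t by (simp add: powr_minus field_simps)
      have 3: "real K * real m \<le> 4 * (real b * t powr - a)"
      proof -
        have "real K * real m \<le> 2 * t powr (1 / 2) * (2 * t powr \<mu>)"
          using K m by (intro mult_mono) auto
        also have "\<dots> = 4 * t powr (1 / 2 + \<mu>)" by (simp add: powr_add)
        also have "\<dots> = 4 * (t * t powr (1 / 2 + \<mu> - 1))" by (simp only: shift)
        also have "\<dots> \<le> 4 * (real b * t powr - a)"
        proof -
          have "1 / 2 + \<mu> - 1 \<le> - a" using a\<mu> \<mu> by argo
          then show ?thesis using scaled by (intro mult_left_mono) auto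
        qed
        finally show ?thesis .
      qed
      have "real (b div m + 1 + K * m) = real (b div m) + 1 + real K * real m" by simp
      also have "\<dots> \<le> 6 * (real b * t powr - a)" using 1 2 3 by linarith
      also have "\<dots> \<le> 12 * (real b * t powr - a)" by simp
      also have "\<dots> \<le> real b * t powr - \<gamma>" using mult_left_mono[OF gain, of "real b"] by simp
      finally show ?thesis .
    qed
    have "real (s * (b div m + 1 + K * m)) \<le> real s * (real b * t powr - \<gamma>)"
      using rank unfolding of_nat_mult[of s] by (intro mult_left_mono) auto
    also have "\<dots> \<le> real n" using n by (simp add: t_def mult.assoc)
    finally have n': "s * (b div m + 1 + K * m) \<le> n" by (simp only: of_nat_le_iff)
    have ap: "approximable n p1 (ereal p) (ereal r) (ereal q) s b (norm_ratio (ereal r) p1 s *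
        (\<theta> powr (1 - p / q) + (real m * (2 / real K) powr \<rho>) powr (1 / q) * \<theta> powr - p))"
      unfolding \<rho>_def using x' r p
      by (intro rotating_hash_approximable[OF sb m(3) K(3) Ks _ _ _ _ _ \<theta> n']) auto
    have e1: "\<theta> powr (1 - p / q) \<le> t powr - a"
      unfolding \<theta>_def powr_powr by (rule small) (use a in simp)
    have e2: "(real m * (2 / real K) powr \<rho>) powr (1 / q) * \<theta> powr - p \<le> 4 * t powr - a"
    proof -
      have "(2 / real K) powr \<rho> \<le> (2 / t powr (1 / 2)) powr \<rho>"
        using K t \<rho> by (intro powr_mono2 divide_left_mono) auto
      also have "\<dots> = 2 powr \<rho> * t powr (- \<rho> / 2)"
        using t by (simp add: powr_divide powr_powr powr_minus field_simps)
      also have "\<dots> \<le> 2 * t powr (- \<rho> / 2)"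
        using \<rho> powr_mono[of \<rho> 1 2] by (intro mult_right_mono) auto
      finally have "real m * (2 / real K) powr \<rho> \<le> 2 * t powr \<mu> * (2 * t powr (- \<rho> / 2))"
        using m by (intro mult_mono) auto
      also have "\<dots> = 4 * t powr (\<mu> + - \<rho> / 2)" unfolding powr_add by simp
      also have "\<mu> + - \<rho> / 2 = - \<mu>" by (simp add: \<mu>_def)
      finally have "(real m * (2 / real K) powr \<rho>) powr (1 / q) \<le> (4 * t powr - \<mu>) powr (1 / q)"
        using p by (rule_tac powr_mono2) auto
      also have "\<dots> = 4 powr (1 / q) * t powr (- \<mu> / q)" by (simp add: powr_mult powr_powr)
      also have "\<dots> \<le> 4 * t powr (- \<mu> / q)"
        using p powr_mono[of "1 / q" 1 4] by (intro mult_right_mono) auto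
      finally have "(real m * (2 / real K) powr \<rho>) powr (1 / q) * \<theta> powr - p
          \<le> 4 * t powr (- \<mu> / q) * t powr (\<tau> * p)"
        by (simp add: \<theta>_def powr_powr mult_right_mono)
      also have "\<dots> = 4 * t powr (- \<mu> / q + \<tau> * p)" by (simp only: powr_add mult.assoc)
      also have "- \<mu> / q + \<tau> * p = - (\<mu> / (2 * q))"
        using p by (simp add: \<tau>_def field_simps)
      also have "4 * t powr - (\<mu> / (2 * q)) \<le> 4 * t powr - a"
        using a by (intro mult_left_mono small) auto
      finally show ?thesis .
    qed
    have "0 \<le> t powr - a" by simp
    then have "\<theta> powr (1 - p / q) + (real m * (2 / real K) powr \<rho>) powr (1 / q) * \<theta> powr - p \<le> t powr - \<gamma>"
      using e1 e2 gain by linarith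
    then have "norm_ratio q1 p1 s * (\<theta> powr (1 - p / q) + (real m * (2 / real K) powr \<rho>) powr (1 / q) * \<theta> powr - p)
        \<le> real (min s b) powr - \<gamma> * norm_ratio q1 p1 s"
      unfolding t_def by (subst mult.commute) (intro mult_right_mono; simp)
    then show ?thesis
      using p(2) sb unfolding r(1) p(1) q(1) by (intro approximable_mono[OF ap]) auto
  qed
  then show ?thesis by (intro exI[of _ \<gamma>] conjI \<gamma>(1) exI[of _ t0] allI impI)
qed

text \<open>
  A failure of (i) is treated inside each block, where \<open>s\<close> plays the part of the number of blocks, and
  a failure of (ii) or (iii) across the blocks.
\<close>

lemma non_rigid_upper_bound:
  assumes e: "1 \<le> p1" "1 \<le> p2" "1 \<le> q1" "1 \<le> q2"
    and fails: "\<not> (q1 \<le> max p1 2 \<and> q2 \<le> max p2 2 \<and> \<not> exceptional_case p1 p2 q1 q2)"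
  shows "\<exists>\<gamma>>0. \<exists>t0. \<forall>s b n. 0 < s \<longrightarrow> 0 < b \<longrightarrow> t0 \<le> min s b \<longrightarrow>
    real (s * b) * real (min s b) powr - \<gamma> \<le> real n \<longrightarrow>
    mixed_width n p1 p2 q1 q2 s b \<le> ennreal (real (min s b) powr - \<gamma>) * mixed_width 0 p1 p2 q1 q2 s b"
proof -
  have conclude: "mixed_width n p1 p2 q1 q2 s b
      \<le> ennreal (real (min s b) powr - \<gamma>) * mixed_width 0 p1 p2 q1 q2 s b"
    if "approximable n p1 p2 q1 q2 s b D" "0 \<le> D" "0 < s" "0 < b"
      "D \<le> real (min s b) powr - \<gamma> * (norm_ratio q1 p1 s * norm_ratio q2 p2 b)" for s b n \<gamma> D
  proof -
    have "mixed_width n p1 p2 q1 q2 s b \<le> ennreal D" using that by (intro approximable_width)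
    also have "\<dots> \<le> ennreal (real (min s b) powr - \<gamma> * (norm_ratio q1 p1 s * norm_ratio q2 p2 b))"
      using that(5) by (rule ennreal_leI)
    also have "\<dots> = ennreal (real (min s b) powr - \<gamma>) * mixed_width 0 p1 p2 q1 q2 s b"
      using e that by (simp add: mixed_width_0_eq ennreal_mult)
    finally show ?thesis .
  qed
  have min_powr: "real k powr - \<gamma> \<le> real (min s b) powr - \<gamma>"
    if "0 < s" "0 < b" "0 < \<gamma>" "min s b \<le> k" for k s b :: nat and \<gamma> :: real
    using that by (intro powr_mono2') auto
  consider (i) "max p1 2 < q1" | (ii) "max p2 2 < q2" | (iii) "exceptional_case p1 p2 q1 q2"
    using fails not_le by blast
  then show ?thesis
  proof cases
    case i
    then have q: "p1 < q1" "2 < q1" by auto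
    obtain \<gamma> b0 where \<gamma>: "0 < \<gamma>" and ap: "\<And>b s n. b0 \<le> b \<Longrightarrow> 0 < s \<Longrightarrow> 0 < b \<Longrightarrow>
        real s * real b * real b powr - \<gamma> \<le> real n \<Longrightarrow>
        approximable n 1 p1 1 q1 s b (real b powr - \<gamma> * norm_ratio 1 1 s)"
      using approximable_outer[OF order_refl order_refl e(1) q] by metis
    define \<gamma>' where "\<gamma>' = min (\<gamma> / 2) (1 / 2)"
    have \<gamma>': "0 < \<gamma>'" "2 * \<gamma>' \<le> \<gamma>" "2 * \<gamma>' \<le> 1" using \<gamma> by (auto simp: \<gamma>'_def min_def)
    show ?thesis
    proof (intro exI[of _ \<gamma>'] conjI \<gamma>' exI[of _ "max b0 (nat \<lceil>2 powr (1 / \<gamma>')\<rceil>)"] allI impI)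
      fix s b n :: nat
      assume sb: "0 < s" "0 < b" and t0: "max b0 (nat \<lceil>2 powr (1 / \<gamma>')\<rceil>) \<le> min s b"
        and n: "real (s * b) * real (min s b) powr - \<gamma>' \<le> real n"
      have s: "1 \<le> real s" "b0 \<le> s" "2 powr (1 / \<gamma>') \<le> real s" using sb t0 by linarith+
      have "(2 powr (1 / \<gamma>')) powr \<gamma>' \<le> real s powr \<gamma>'" using s \<gamma>' by (intro powr_mono2) auto
      then have s2: "2 \<le> real s powr \<gamma>'" using \<gamma>' by (simp add: powr_powr)
      have small: "real s powr - \<gamma>' \<le> real (min s b) powr - \<gamma>'" using sb \<gamma>' by (intro min_powr) auto
      \<comment> \<open>The dimension spent per block. Passing to \<open>\<gamma>' \<le> \<gamma> / 2\<close> makes room for the rounding.\<close>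
      define m where "m = nat \<lceil>real s powr (1 - \<gamma>)\<rceil>"
      have "0 \<le> real s powr (1 - \<gamma>)" by simp
      then have m: "real s powr (1 - \<gamma>) \<le> real m" "real m \<le> real s powr (1 - \<gamma>) + 1"
        unfolding m_def by linarith+
      have "real m \<le> real s powr (1 - \<gamma>')"
      proof -
        have "2 * real s powr (1 - \<gamma>) \<le> real s powr \<gamma>' * real s powr (1 - 2 * \<gamma>')"
          using s2 s \<gamma>' by (intro mult_mono powr_mono) auto
        also have "\<dots> = real s powr (1 - \<gamma>')" by (simp flip: powr_add)
        finally have "2 * real s powr (1 - \<gamma>) \<le> real s powr (1 - \<gamma>')" .
        moreover have "real s powr \<gamma>' \<le> real s powr (1 - \<gamma>')" using s \<gamma>' by (intro powr_mono) auto
        ultimately show ?thesis using m s2 by linarith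
      qed
      then have "real (b * m) \<le> real b * (real s * real s powr - \<gamma>')"
        using s by (simp add: mult_left_mono powr_diff powr_minus divide_inverse)
      also have "\<dots> \<le> real (s * b) * real (min s b) powr - \<gamma>'"
        using mult_left_mono[OF small, of "real (s * b)"] by (simp add: mult_ac)
      finally have bm: "b * m \<le> n" using n by (meson of_nat_le_iff order_trans)
      have "real 1 * real s * real s powr - \<gamma> \<le> real m"
        using m s by (simp add: powr_diff powr_minus divide_inverse)
      then have "approximable m 1 p1 1 q1 1 s (real s powr - \<gamma> * norm_ratio 1 1 1)"
        using s sb by (intro ap) auto
      then have "approximable n p1 p2 q1 q2 s b (real s powr - \<gamma> * norm_ratio 1 1 1 * norm_ratio q2 p2 b)"
        using e sb bm by (intro approximable_blockwise) auto
      moreover have "real s powr - \<gamma> \<le> real s powr - \<gamma>'" using s \<gamma>' by (intro powr_mono) auto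
      then have "real s powr - \<gamma> \<le> real (min s b) powr - \<gamma>'" using small by linarith
      ultimately show "mixed_width n p1 p2 q1 q2 s b
          \<le> ennreal (real (min s b) powr - \<gamma>') * mixed_width 0 p1 p2 q1 q2 s b"
        using sb e q by (intro conclude) (auto simp: norm_ratio_eq_1 mult_right_mono)
    qed
  next
    case ii
    then have q: "p2 < q2" "2 < q2" by auto
    obtain \<gamma> b0 where \<gamma>: "0 < \<gamma>" and ap: "\<And>b s n. b0 \<le> b \<Longrightarrow> 0 < s \<Longrightarrow> 0 < b \<Longrightarrow>
        real s * real b * real b powr - \<gamma> \<le> real n \<Longrightarrow>
        approximable n p1 p2 q1 q2 s b (real b powr - \<gamma> * norm_ratio q1 p1 s)"
      using approximable_outer[OF e(1,3,2) q] by metis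
    show ?thesis
    proof (intro exI[of _ \<gamma>] conjI \<gamma> exI[of _ b0] allI impI)
      fix s b n :: nat
      assume sb: "0 < s" "0 < b" and t0: "b0 \<le> min s b"
        and n: "real (s * b) * real (min s b) powr - \<gamma> \<le> real n"
      have small: "real b powr - \<gamma> \<le> real (min s b) powr - \<gamma>" using sb \<gamma> by (intro min_powr) auto
      have "real s * real b * real b powr - \<gamma> \<le> real (s * b) * real (min s b) powr - \<gamma>"
        using small by (simp add: mult_left_mono)
      then have "real s * real b * real b powr - \<gamma> \<le> real n" using n by linarith
      then have "approximable n p1 p2 q1 q2 s b (real b powr - \<gamma> * norm_ratio q1 p1 s)"
        using t0 sb by (intro ap) auto
      then show "mixed_width n p1 p2 q1 q2 s b
          \<le> ennreal (real (min s b) powr - \<gamma>) * mixed_width 0 p1 p2 q1 q2 s b"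
        using sb small e q by (intro conclude) (auto simp: norm_ratio_eq_1[of p2 q2] mult_right_mono)
    qed
  next
    case iii
    then have q: "p2 < q2" by (simp add: exceptional_case_def)
    obtain \<gamma> t0 where \<gamma>: "0 < \<gamma>" and ap: "\<And>s b n. 0 < s \<Longrightarrow> 0 < b \<Longrightarrow> t0 \<le> min s b \<Longrightarrow>
        real (s * b) * real (min s b) powr - \<gamma> \<le> real n \<Longrightarrow>
        approximable n p1 p2 q1 q2 s b (real (min s b) powr - \<gamma> * norm_ratio q1 p1 s)"
      using approximable_exceptional[OF e(1,2,3) iii] by blast
    show ?thesis
    proof (intro exI[of _ \<gamma>] conjI \<gamma> exI[of _ t0] allI impI)
      fix s b n :: nat
      assume sb: "0 < s" "0 < b" and t: "t0 \<le> min s b"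
        and n: "real (s * b) * real (min s b) powr - \<gamma> \<le> real n"
      show "mixed_width n p1 p2 q1 q2 s b
          \<le> ennreal (real (min s b) powr - \<gamma>) * mixed_width 0 p1 p2 q1 q2 s b"
        using sb e q ap[OF sb t n] by (intro conclude) (auto simp: norm_ratio_eq_1[of p2 q2])
    qed
  qed
qed

section \<open>Rigidity and its failure\<close>

theorem mainTheorem1:
  shows
    "(\<exists>c :: ereal \<Rightarrow> real \<Rightarrow> real.
        (\<forall>q2 \<epsilon>. 1 \<le> q2 \<longrightarrow> 0 < \<epsilon> \<longrightarrow> 0 < c q2 \<epsilon>) \<and>
        (\<forall>(p1::ereal) (p2::ereal) (q1::ereal) (q2::ereal).
           1 \<le> p1 \<longrightarrow> 1 \<le> p2 \<longrightarrow> 1 \<le> q1 \<longrightarrow> 1 \<le> q2 \<longrightarrow>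
           q1 \<le> max p1 2 \<longrightarrow> q2 \<le> max p2 2 \<longrightarrow> \<not> exceptional_case p1 p2 q1 q2 \<longrightarrow>
           (\<forall>(\<epsilon>::real) (s::nat) (b::nat) (n::nat).
              0 < \<epsilon> \<longrightarrow> 0 < s \<longrightarrow> 0 < b \<longrightarrow> real n \<le> real (s * b) * (1 - \<epsilon>) \<longrightarrow>
              mixed_width n p1 p2 q1 q2 s b
                \<ge> ennreal (c q2 \<epsilon>) * mixed_width 0 p1 p2 q1 q2 s b)))
     \<and>
     (\<forall>(p1::ereal) (p2::ereal) (q1::ereal) (q2::ereal).
        1 \<le> p1 \<longrightarrow> 1 \<le> p2 \<longrightarrow> 1 \<le> q1 \<longrightarrow> 1 \<le> q2 \<longrightarrow>
        \<not> (q1 \<le> max p1 2 \<and> q2 \<le> max p2 2 \<and> \<not> exceptional_case p1 p2 q1 q2) \<longrightarrow>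
        (\<exists>\<gamma>::real. 0 < \<gamma> \<and>
          (\<exists>t0::nat. \<forall>(s::nat) (b::nat) (n::nat).
             0 < s \<longrightarrow> 0 < b \<longrightarrow> t0 \<le> min s b \<longrightarrow>
             real n \<ge> real (s * b) * real (min s b) powr (- \<gamma>) \<longrightarrow>
             mixed_width n p1 p2 q1 q2 s b
               \<le> ennreal (real (min s b) powr (- \<gamma>)) * mixed_width 0 p1 p2 q1 q2 s b)))"
proof (intro conjI exI[of _ rigidity_const] allI impI)
  show "0 < rigidity_const q2 \<epsilon>" if "0 < \<epsilon>" for q2 \<epsilon>
    using that by (rule rigidity_const_pos)
qed (rule rigid_lower_bound non_rigid_upper_bound; assumption)+

end
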